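(* Let $A$ be a J-2 ring (for example, an excellent ring) and let $N\subseteq M$ be two finitely generated $A$-modules such that $\dim(M/N)\leq 1$. Then there exists an integer $s\geq 1$ such that, for all integers $n\geq s$ and for all ideals $I$ of $A$, $$I^{n}M\cap N=I^{n-s}(I^{s}M\cap N).$$
   Context: Rings are commutative with unity. Dimension means Krull dimension. A J-2 ring is a noetherian ring $A$ such that for every finitely generated $A$-algebra $B$ the set of primes $\mathfrak{q}\in\mathrm{Spec}(B)$ with $B_{\mathfrak{q}}$ regular is open in $\mathrm{Spec}(B)$. Every excellent ring is J-2. *)

theory Defs
  imports "HOL-Algebra.Algebra" "HOL-Library.Extended_Real" "HOL-Analysis.Abstract_Topology"
begin

text \<open>The supremum is taken in \<^typ>\<open>ereal\<close>, so the zero ring has dimension \<open>-\<infinity>\<close>.\<close>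

definition krull_dim :: "('a, 'b) ring_scheme \<Rightarrow> ereal" where
  "krull_dim R =
     (SUP n \<in> {n. \<exists>p. (\<forall>i\<le>n. primeideal (p i) R) \<and> (\<forall>i<n. p i \<subset> p (Suc i))}. ereal (real n))"

definition Spec :: "('a, 'b) ring_scheme \<Rightarrow> 'a set set" where
  "Spec R = {p. primeideal p R}"

definition zariski_topology :: "('a, 'b) ring_scheme \<Rightarrow> 'a set topology" where
  "zariski_topology R = topology (\<lambda>U. \<exists>E \<subseteq> carrier R. U = {p \<in> Spec R. \<not> E \<subseteq> p})"

lemma openin_zariski:
  "openin (zariski_topology R) U \<longleftrightarrow> (\<exists>E \<subseteq> carrier R. U = {p \<in> Spec R. \<not> E \<subseteq> p})"
proof -
  let ?P = "\<lambda>U. \<exists>E \<subseteq> carrier R. U = {p \<in> Spec R. \<not> E \<subseteq> p}"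
  have "istopology ?P"
    unfolding istopology_def
  proof (intro conjI allI impI)
    fix U V assume "?P U" "?P V"
    then obtain E F where E: "E \<subseteq> carrier R" "U = {p \<in> Spec R. \<not> E \<subseteq> p}"
      and F: "F \<subseteq> carrier R" "V = {p \<in> Spec R. \<not> F \<subseteq> p}" by blast
    let ?G = "{e \<otimes>\<^bsub>R\<^esub> f | e f. e \<in> E \<and> f \<in> F}"
    have G: "?G \<subseteq> p \<longleftrightarrow> E \<subseteq> p \<or> F \<subseteq> p" if "primeideal p R" for p
    proof -
      interpret primeideal p R by fact
      have "e \<in> p \<or> f \<in> p" if "?G \<subseteq> p" "e \<in> E" "f \<in> F" for e f
        using that E(1) F(1) I_prime[of e f] by blast
      moreover have "e \<otimes>\<^bsub>R\<^esub> f \<in> p" if "E \<subseteq> p \<or> F \<subseteq> p" "e \<in> E" "f \<in> F" for e f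
        using that E(1) F(1) I_l_closed I_r_closed by blast
      ultimately show ?thesis by blast
    qed
    have *: "?G \<subseteq> carrier R" if "p \<in> Spec R" for p
    proof -
      interpret primeideal p R using that by (simp add: Spec_def)
      show ?thesis using E(1) F(1) by auto
    qed
    have eq: "U \<inter> V = {p \<in> Spec R. \<not> ?G \<subseteq> p}"
    proof (rule Set.set_eqI)
      fix p
      show "p \<in> U \<inter> V \<longleftrightarrow> p \<in> {p \<in> Spec R. \<not> ?G \<subseteq> p}"
        unfolding E(2) F(2) using G[of p] unfolding Spec_def by blast
    qed
    show "?P (U \<inter> V)"
    proof (cases "Spec R = {}")
      case True
      then show ?thesis using E(2) by auto
    next
      case False
      then show ?thesis using * eq by blast
    qed
  next
    fix K assume K: "\<forall>U\<in>K. ?P U"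
    then obtain E where E: "\<And>U. U \<in> K \<Longrightarrow> E U \<subseteq> carrier R \<and> U = {p \<in> Spec R. \<not> E U \<subseteq> p}"
      by metis
    have "\<Union>K = {p \<in> Spec R. \<not> \<Union>(E ` K) \<subseteq> p}" using E by blast
    moreover have "\<Union>(E ` K) \<subseteq> carrier R" using E by blast
    ultimately show "?P (\<Union>K)" by blast
  qed
  then show ?thesis by (simp add: zariski_topology_def)
qed

definition loc_frac :: "('a, 'b) ring_scheme \<Rightarrow> 'a set \<Rightarrow> 'a \<Rightarrow> 'a \<Rightarrow> ('a \<times> 'a) set" where
  "loc_frac R S r s =
     {(r', s') \<in> carrier R \<times> S. \<exists>t \<in> S. t \<otimes>\<^bsub>R\<^esub> (s' \<otimes>\<^bsub>R\<^esub> r) = t \<otimes>\<^bsub>R\<^esub> (s \<otimes>\<^bsub>R\<^esub> r')}"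

definition localization :: "('a, 'b) ring_scheme \<Rightarrow> 'a set \<Rightarrow> ('a \<times> 'a) set ring" where
  "localization R S =
     \<lparr>carrier = {loc_frac R S r s | r s. r \<in> carrier R \<and> s \<in> S},
      monoid.mult = (\<lambda>P Q. \<Union>(r, s) \<in> P. \<Union>(r', s') \<in> Q. loc_frac R S (r \<otimes>\<^bsub>R\<^esub> r') (s \<otimes>\<^bsub>R\<^esub> s')),
      monoid.one = loc_frac R S \<one>\<^bsub>R\<^esub> \<one>\<^bsub>R\<^esub>,
      ring.zero = loc_frac R S \<zero>\<^bsub>R\<^esub> \<one>\<^bsub>R\<^esub>,
      ring.add = (\<lambda>P Q. \<Union>(r, s) \<in> P. \<Union>(r', s') \<in> Q.
               loc_frac R S (s' \<otimes>\<^bsub>R\<^esub> r \<oplus>\<^bsub>R\<^esub> s \<otimes>\<^bsub>R\<^esub> r') (s \<otimes>\<^bsub>R\<^esub> s'))\<rparr>"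

text \<open>The unions run over all representatives of the two fractions; for a submonoid \<open>S\<close> all members
  agree, see \<open>localization_mult\<close> and \<open>localization_add\<close> below.\<close>

lemma UN_pair_const:
  assumes "p \<in> P" "q \<in> Q"
    and "\<And>a b a' b'. (a, b) \<in> P \<Longrightarrow> (a', b') \<in> Q \<Longrightarrow> g a b a' b' = c"
  shows "(\<Union>(a, b) \<in> P. \<Union>(a', b') \<in> Q. g a b a' b') = c"
proof (intro equalityI subsetI)
  fix x assume "x \<in> (\<Union>(a, b) \<in> P. \<Union>(a', b') \<in> Q. g a b a' b')"
  then obtain a b a' b' where "(a, b) \<in> P" "(a', b') \<in> Q" "x \<in> g a b a' b'" by blast
  then show "x \<in> c" using assms(3)[of a b a' b'] by simp
next
  fix x assume "x \<in> c"
  moreover obtain a b where ab: "p = (a, b)" by (cases p)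
  moreover obtain a' b' where ab': "q = (a', b')" by (cases q)
  ultimately have "x \<in> g a b a' b'" using assms(3)[of a b a' b'] assms(1,2) by simp
  then show "x \<in> (\<Union>(a, b) \<in> P. \<Union>(a', b') \<in> Q. g a b a' b')"
    using assms(1,2) ab ab' by blast
qed

context cring
begin

context
  fixes S assumes S: "submonoid S R"
begin

lemma loc_S: "\<And>s. s \<in> S \<Longrightarrow> s \<in> carrier R" "\<one> \<in> S" "\<And>s t. s \<in> S \<Longrightarrow> t \<in> S \<Longrightarrow> s \<otimes> t \<in> S"
  using S by (auto simp: submonoid_def)

lemma loc_frac_eqI:
  assumes "r \<in> carrier R" "r' \<in> carrier R" "s \<in> S" "s' \<in> S" "t \<in> S"
    and "t \<otimes> (s' \<otimes> r) = t \<otimes> (s \<otimes> r')"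
  shows "loc_frac R S r s = loc_frac R S r' s'"
proof -
  have *: "loc_frac R S r s \<subseteq> loc_frac R S r' s'"
    if "r \<in> carrier R" "r' \<in> carrier R" "s \<in> S" "s' \<in> S" "t \<in> S"
      and e: "t \<otimes> (s' \<otimes> r) = t \<otimes> (s \<otimes> r')" for r r' s s'
  proof (clarsimp simp: loc_frac_def)
    fix a b u assume a: "a \<in> carrier R" "b \<in> S" "u \<in> S" and e2: "u \<otimes> (b \<otimes> r) = u \<otimes> (s \<otimes> a)"
    note c = that(1,2) loc_S(1)[OF that(3)] loc_S(1)[OF that(4)] loc_S(1)[OF that(5)]
      a(1) loc_S(1)[OF a(2)] loc_S(1)[OF a(3)]
    have "(u \<otimes> t \<otimes> s) \<otimes> (b \<otimes> r') = u \<otimes> b \<otimes> (t \<otimes> (s \<otimes> r'))" using c by (simp add: m_ac)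
    also have "\<dots> = t \<otimes> s' \<otimes> (u \<otimes> (b \<otimes> r))" unfolding e[symmetric] using c by (simp add: m_ac)
    also have "\<dots> = (u \<otimes> t \<otimes> s) \<otimes> (s' \<otimes> a)" unfolding e2 using c by (simp add: m_ac)
    finally have f: "(u \<otimes> t \<otimes> s) \<otimes> (b \<otimes> r') = (u \<otimes> t \<otimes> s) \<otimes> (s' \<otimes> a)" .
    have "u \<otimes> t \<otimes> s \<in> S" by (intro loc_S(3) that a)
    with f show "\<exists>t\<in>S. t \<otimes> (b \<otimes> r') = t \<otimes> (s' \<otimes> a)" by blast
  qed
  show ?thesis
    by (intro equalityI *[OF assms] *[OF assms(2,1,4,3,5) assms(6)[symmetric]])
qed

lemma loc_frac_mem:
  "r \<in> carrier R \<Longrightarrow> s \<in> S \<Longrightarrow> (r, s) \<in> loc_frac R S r s"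
  using loc_S by (auto simp: loc_frac_def)

lemma loc_frac_memD:
  assumes "(a, b) \<in> loc_frac R S r s"
  shows "a \<in> carrier R" "b \<in> S" "\<exists>t\<in>S. t \<otimes> (b \<otimes> r) = t \<otimes> (s \<otimes> a)"
  using assms by (auto simp: loc_frac_def)

lemma loc_frac_eq_iff:
  assumes "r \<in> carrier R" "r' \<in> carrier R" "s \<in> S" "s' \<in> S"
  shows "loc_frac R S r s = loc_frac R S r' s' \<longleftrightarrow> (\<exists>t\<in>S. t \<otimes> (s' \<otimes> r) = t \<otimes> (s \<otimes> r'))"
  using loc_frac_eqI[OF assms] loc_frac_memD(3)[of r' s' r s] loc_frac_mem[OF assms(2,4)]
  by blast

lemma localization_mult:
  assumes c: "r \<in> carrier R" "r' \<in> carrier R" "s \<in> S" "s' \<in> S"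
  shows "loc_frac R S r s \<otimes>\<^bsub>localization R S\<^esub> loc_frac R S r' s'
    = loc_frac R S (r \<otimes> r') (s \<otimes> s')"
proof -
  have *: "loc_frac R S (a \<otimes> a') (b \<otimes> b') = loc_frac R S (r \<otimes> r') (s \<otimes> s')"
    if m: "(a, b) \<in> loc_frac R S r s" "(a', b') \<in> loc_frac R S r' s'" for a b a' b'
  proof -
    note d = loc_frac_memD[OF m(1)] loc_frac_memD[OF m(2)]
    obtain t u where t: "t \<in> S" "t \<otimes> (b \<otimes> r) = t \<otimes> (s \<otimes> a)"
      and u: "u \<in> S" "u \<otimes> (b' \<otimes> r') = u \<otimes> (s' \<otimes> a')" using d by blast
    note k = c(1,2) d(1,4) loc_S(1)[OF c(3)] loc_S(1)[OF c(4)] loc_S(1)[OF d(2)] loc_S(1)[OF d(5)]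
      loc_S(1)[OF t(1)] loc_S(1)[OF u(1)]
    have "(t \<otimes> u) \<otimes> ((s \<otimes> s') \<otimes> (a \<otimes> a')) = (t \<otimes> (s \<otimes> a)) \<otimes> (u \<otimes> (s' \<otimes> a'))"
      using k by (simp add: m_ac)
    also have "\<dots> = (t \<otimes> u) \<otimes> ((b \<otimes> b') \<otimes> (r \<otimes> r'))"
      unfolding t(2)[symmetric] u(2)[symmetric] using k by (simp add: m_ac)
    finally show ?thesis
      by (rule loc_frac_eqI[rotated 5]) (simp_all add: k c(3,4) d(2,5) t(1) u(1) loc_S(3))
  qed
  show ?thesis
    unfolding localization_def monoid.simps ring.simps
    by (rule UN_pair_const[OF loc_frac_mem[OF c(1,3)] loc_frac_mem[OF c(2,4)]]) (rule *)
qed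

lemma localization_add:
  assumes c: "r \<in> carrier R" "r' \<in> carrier R" "s \<in> S" "s' \<in> S"
  shows "loc_frac R S r s \<oplus>\<^bsub>localization R S\<^esub> loc_frac R S r' s'
    = loc_frac R S (s' \<otimes> r \<oplus> s \<otimes> r') (s \<otimes> s')"
proof -
  have *: "loc_frac R S (b' \<otimes> a \<oplus> b \<otimes> a') (b \<otimes> b')
      = loc_frac R S (s' \<otimes> r \<oplus> s \<otimes> r') (s \<otimes> s')"
    if m: "(a, b) \<in> loc_frac R S r s" "(a', b') \<in> loc_frac R S r' s'" for a b a' b'
  proof -
    note d = loc_frac_memD[OF m(1)] loc_frac_memD[OF m(2)]
    obtain t u where t: "t \<in> S" "t \<otimes> (b \<otimes> r) = t \<otimes> (s \<otimes> a)"
      and u: "u \<in> S" "u \<otimes> (b' \<otimes> r') = u \<otimes> (s' \<otimes> a')" using d by blast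
    note k = c(1,2) d(1,4) loc_S(1)[OF c(3)] loc_S(1)[OF c(4)] loc_S(1)[OF d(2)] loc_S(1)[OF d(5)]
      loc_S(1)[OF t(1)] loc_S(1)[OF u(1)]
    have "(t \<otimes> u) \<otimes> ((s \<otimes> s') \<otimes> (b' \<otimes> a \<oplus> b \<otimes> a'))
        = (u \<otimes> s' \<otimes> b') \<otimes> (t \<otimes> (s \<otimes> a)) \<oplus> (t \<otimes> s \<otimes> b) \<otimes> (u \<otimes> (s' \<otimes> a'))"
      using k by (simp add: m_ac r_distr)
    also have "\<dots> = (t \<otimes> u) \<otimes> ((b \<otimes> b') \<otimes> (s' \<otimes> r \<oplus> s \<otimes> r'))"
      unfolding t(2)[symmetric] u(2)[symmetric] using k by (simp add: m_ac r_distr)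
    finally show ?thesis
      by (rule loc_frac_eqI[rotated 5]) (simp_all add: k c(3,4) d(2,5) t(1) u(1) loc_S(3))
  qed
  show ?thesis
    unfolding localization_def monoid.simps ring.simps
    by (rule UN_pair_const[OF loc_frac_mem[OF c(1,3)] loc_frac_mem[OF c(2,4)]]) (rule *)
qed

lemma localization_carrier_cases:
  assumes "P \<in> carrier (localization R S)"
  obtains r s where "r \<in> carrier R" "s \<in> S" "P = loc_frac R S r s"
  using assms by (auto simp: localization_def)

lemma loc_frac_closed: "r \<in> carrier R \<Longrightarrow> s \<in> S \<Longrightarrow> loc_frac R S r s \<in> carrier (localization R S)"
  by (auto simp: localization_def)

lemma localization_cring: "cring (localization R S)"
proof -
  let ?L = "localization R S"
  have one: "\<one>\<^bsub>?L\<^esub> = loc_frac R S \<one> \<one>" and zero: "\<zero>\<^bsub>?L\<^esub> = loc_frac R S \<zero> \<one>"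
    by (simp_all add: localization_def)
  note [simp] = localization_mult localization_add loc_frac_closed one zero loc_S
  note [elim!] = localization_carrier_cases
  have eq: "loc_frac R S r s = loc_frac R S r' s'"
    if "r \<in> carrier R" "r' \<in> carrier R" "s \<in> S" "s' \<in> S" "s' \<otimes> r = s \<otimes> r'" for r r' s s'
    using that by (intro loc_frac_eqI[where t = \<one>]) auto
  show ?thesis
  proof (intro cringI abelian_groupI comm_monoidI)
    fix P assume "P \<in> carrier ?L"
    then obtain r s where x: "r \<in> carrier R" "s \<in> S" "P = loc_frac R S r s" by auto
    have "loc_frac R S (\<ominus> r) s \<oplus>\<^bsub>?L\<^esub> P = \<zero>\<^bsub>?L\<^esub>"
      using x by (simp, intro eq) (auto simp: r_distr[symmetric] l_neg)
    then show "\<exists>Q \<in> carrier ?L. Q \<oplus>\<^bsub>?L\<^esub> P = \<zero>\<^bsub>?L\<^esub>"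
      using x by (intro bexI[of _ "loc_frac R S (\<ominus> r) s"]) auto
  next
    fix P Q T assume P: "P \<in> carrier ?L" and Q: "Q \<in> carrier ?L" and T: "T \<in> carrier ?L"
    obtain r s where x: "r \<in> carrier R" "s \<in> S" "P = loc_frac R S r s"
      by (rule localization_carrier_cases[OF P])
    obtain r' s' where y: "r' \<in> carrier R" "s' \<in> S" "Q = loc_frac R S r' s'"
      by (rule localization_carrier_cases[OF Q])
    obtain r'' s'' where z: "r'' \<in> carrier R" "s'' \<in> S" "T = loc_frac R S r'' s''"
      by (rule localization_carrier_cases[OF T])
    show "(P \<oplus>\<^bsub>?L\<^esub> Q) \<otimes>\<^bsub>?L\<^esub> T = P \<otimes>\<^bsub>?L\<^esub> T \<oplus>\<^bsub>?L\<^esub> Q \<otimes>\<^bsub>?L\<^esub> T"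
    proof -
      note k = x(1,2) y(1,2) z(1,2)
      note c = k(1,3,5) loc_S(1)[OF k(2)] loc_S(1)[OF k(4)] loc_S(1)[OF k(6)]
      have "s \<otimes> s'' \<otimes> (s' \<otimes> s'') \<otimes> ((s' \<otimes> r \<oplus> s \<otimes> r') \<otimes> r'')
          = s \<otimes> s' \<otimes> s'' \<otimes> (s' \<otimes> s'' \<otimes> (r \<otimes> r'') \<oplus> s \<otimes> s'' \<otimes> (r' \<otimes> r''))"
        using c by algebra
      then have "loc_frac R S ((s' \<otimes> r \<oplus> s \<otimes> r') \<otimes> r'') (s \<otimes> s' \<otimes> s'')
          = loc_frac R S (s' \<otimes> s'' \<otimes> (r \<otimes> r'') \<oplus> s \<otimes> s'' \<otimes> (r' \<otimes> r'')) (s \<otimes> s'' \<otimes> (s' \<otimes> s''))"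
        using k c by (intro eq) simp_all
      then show ?thesis unfolding x(3) y(3) z(3) using k c by simp
    qed
  qed (auto intro!: eq simp: r_distr l_distr m_ac a_ac)
qed

end

end

definition regular_local_ring :: "('a, 'b) ring_scheme \<Rightarrow> bool" where
  "regular_local_ring R \<longleftrightarrow> cring R \<and> noetherian_ring R \<and>
     (\<exists>m. {J. maximalideal J R} = {m} \<and>
          (\<exists>S \<subseteq> carrier R. finite S \<and> m = Idl\<^bsub>R\<^esub> S \<and> ereal (real (card S)) = krull_dim R))"

text \<open>When \<open>krull_dim R\<close> is infinite no such finite \<open>S\<close> exists; a noetherian local ring always has finite
  dimension.\<close>

definition regular_locus :: "('a, 'b) ring_scheme \<Rightarrow> 'a set set" where
  "regular_locus B = {q \<in> Spec B. regular_local_ring (localization B (carrier B - q))}"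

definition fin_gen_algebra ::
    "('a, 'b) ring_scheme \<Rightarrow> ('c, 'd) ring_scheme \<Rightarrow> ('a \<Rightarrow> 'c) \<Rightarrow> bool" where
  "fin_gen_algebra A B \<phi> \<longleftrightarrow> cring B \<and> \<phi> \<in> ring_hom A B \<and>
     (\<exists>S \<subseteq> carrier B. finite S \<and> carrier B = generate_ring B (\<phi> ` carrier A \<union> S))"

text \<open>A definition in HOL cannot quantify over all types, so the algebras \<open>B\<close> range over rings whose
  elements are taken from \<^typ>\<open>('a + nat) list list\<close> (sums of words in elements of \<open>A\<close> and countably
  many generators). This loses nothing: lemma \<open>fin_gen_algebra_copy\<close> below shows that every finitely
  generated \<open>A\<close>-algebra on any type is isomorphic to one of these.\<close>

definition J2_ring :: "('a, 'b) ring_scheme \<Rightarrow> bool" where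
  "J2_ring A \<longleftrightarrow> cring A \<and> noetherian_ring A \<and>
     (\<forall>(B :: ('a + nat) list list ring) \<phi>. fin_gen_algebra A B \<phi> \<longrightarrow>
        openin (zariski_topology B) (regular_locus B))"

primrec word_eval :: "('c, 'd) ring_scheme \<Rightarrow> ('x \<Rightarrow> 'c) \<Rightarrow> 'x list \<Rightarrow> 'c" where
  "word_eval B v [] = \<one>\<^bsub>B\<^esub>"
| "word_eval B v (x # w) = v x \<otimes>\<^bsub>B\<^esub> word_eval B v w"

primrec words_eval :: "('c, 'd) ring_scheme \<Rightarrow> ('x \<Rightarrow> 'c) \<Rightarrow> 'x list list \<Rightarrow> 'c" where
  "words_eval B v [] = \<zero>\<^bsub>B\<^esub>"
| "words_eval B v (w # ws) = word_eval B v w \<oplus>\<^bsub>B\<^esub> words_eval B v ws"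

lemma generate_ring_words:
  assumes "cring B" and v: "range v \<subseteq> carrier B" and neg: "\<ominus>\<^bsub>B\<^esub> \<one>\<^bsub>B\<^esub> \<in> range v"
    and b: "b \<in> generate_ring B (range v)"
  shows "b \<in> range (words_eval B v)"
proof -
  interpret B: cring B by fact
  have w [simp]: "word_eval B v w \<in> carrier B" for w using v by (induction w) auto
  have ws [simp]: "words_eval B v ws \<in> carrier B" for ws by (induction ws) auto
  have vc [simp]: "v x \<in> carrier B" for x using v by auto
  have app: "words_eval B v (xs @ ys) = words_eval B v xs \<oplus>\<^bsub>B\<^esub> words_eval B v ys" for xs ys
    by (induction xs) (auto simp: B.a_assoc)
  have wapp: "word_eval B v (xs @ ys) = word_eval B v xs \<otimes>\<^bsub>B\<^esub> word_eval B v ys" for xs ys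
    by (induction xs) (auto simp: B.m_assoc)
  have mp: "words_eval B v (map ((@) w) ys) = word_eval B v w \<otimes>\<^bsub>B\<^esub> words_eval B v ys" for w ys
    by (induction ys) (auto simp: wapp B.r_distr)
  have mult: "\<exists>zs. words_eval B v zs = words_eval B v xs \<otimes>\<^bsub>B\<^esub> words_eval B v ys" for xs ys
  proof (induction xs)
    case Nil
    show ?case by (rule exI[of _ "[]"]) auto
  next
    case (Cons a xs)
    then obtain zs where "words_eval B v zs = words_eval B v xs \<otimes>\<^bsub>B\<^esub> words_eval B v ys" by blast
    then show ?case
      by (intro exI[of _ "map ((@) a) ys @ zs"]) (auto simp: app mp B.l_distr)
  qed
  obtain n where n: "v n = \<ominus>\<^bsub>B\<^esub> \<one>\<^bsub>B\<^esub>" using neg by (auto simp: image_iff)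
  show ?thesis using b
  proof induction
    case one
    show ?case by (rule range_eqI[of _ _ "[[]]"]) auto
  next
    case (incl h)
    then obtain x where "h = v x" by auto
    then show ?case by (intro range_eqI[of _ _ "[[x]]"]) auto
  next
    case (a_inv h)
    then obtain xs where "h = words_eval B v xs" by auto
    then show ?case
      by (intro range_eqI[of _ _ "map ((@) [n]) xs"]) (simp only: mp, simp add: n B.l_minus)
  next
    case (eng_add h1 h2)
    then obtain xs ys where "h1 = words_eval B v xs" "h2 = words_eval B v ys" by blast
    then show ?case using app[of xs ys] by (metis rangeI)
  next
    case (eng_mult h1 h2)
    then obtain xs ys where "h1 = words_eval B v xs" "h2 = words_eval B v ys" by blast
    then show ?case using mult[of xs ys] by (metis rangeI)
  qed
qed

lemma fin_gen_algebra_copy: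
  fixes A :: "('a, 'b) ring_scheme" and B :: "('c, 'd) ring_scheme"
  assumes A: "cring A" and fg: "fin_gen_algebra A B \<phi>"
  shows "\<exists>(B' :: ('a + nat) list list ring) h. h \<in> ring_iso B B' \<and> fin_gen_algebra A B' (h \<circ> \<phi>)"
proof -
  interpret A: cring A by fact
  interpret B: cring B using fg by (simp add: fin_gen_algebra_def)
  from fg have \<phi>: "\<phi> \<in> ring_hom A B" by (simp add: fin_gen_algebra_def)
  interpret \<phi>: ring_hom_cring A B \<phi>
    using \<phi> by unfold_locales
  from fg obtain S where S: "S \<subseteq> carrier B" "finite S"
    "carrier B = generate_ring B (\<phi> ` carrier A \<union> S)" unfolding fin_gen_algebra_def by blast
  obtain g :: "nat \<Rightarrow> 'c" where g: "range g = insert \<zero>\<^bsub>B\<^esub> S"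
    using S(2) by (metis finite_insert from_nat_into countable_finite insert_not_empty range_from_nat_into)
  define v :: "'a + nat \<Rightarrow> 'c"
    where "v = case_sum (\<lambda>a. if a \<in> carrier A then \<phi> a else \<zero>\<^bsub>B\<^esub>) g"
  have rv: "range v = \<phi> ` carrier A \<union> S \<union> {\<zero>\<^bsub>B\<^esub>}"
  proof
    show "range v \<subseteq> \<phi> ` carrier A \<union> S \<union> {\<zero>\<^bsub>B\<^esub>}"
    proof
      fix x assume "x \<in> range v"
      then obtain y where y: "x = v y" by auto
      show "x \<in> \<phi> ` carrier A \<union> S \<union> {\<zero>\<^bsub>B\<^esub>}"
      proof (cases y)
        case (Inl a)
        then show ?thesis using y by (auto simp: v_def)
      next
        case (Inr i)
        then have "x \<in> range g" using y by (auto simp: v_def)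
        then show ?thesis using g by auto
      qed
    qed
    show "\<phi> ` carrier A \<union> S \<union> {\<zero>\<^bsub>B\<^esub>} \<subseteq> range v"
    proof
      fix x assume "x \<in> \<phi> ` carrier A \<union> S \<union> {\<zero>\<^bsub>B\<^esub>}"
      then consider a where "a \<in> carrier A" "x = \<phi> a" | "x \<in> range g" using g by auto
      then show "x \<in> range v"
      proof cases
        case 1
        then have "x = v (Inl a)" by (simp add: v_def)
        then show ?thesis by simp
      next
        case 2
        then obtain i where "x = v (Inr i)" by (auto simp: v_def)
        then show ?thesis by simp
      qed
    qed
  qed
  have rv1: "range v \<subseteq> carrier B" using rv S(1) by auto
  have "\<ominus>\<^bsub>B\<^esub> \<one>\<^bsub>B\<^esub> = \<phi> (\<ominus>\<^bsub>A\<^esub> \<one>\<^bsub>A\<^esub>)" by simp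
  then have rv2: "\<ominus>\<^bsub>B\<^esub> \<one>\<^bsub>B\<^esub> \<in> range v" using rv by blast
  have "carrier B \<subseteq> generate_ring B (range v)"
    using rv B.mono_generate_ring[OF _ rv1, of "\<phi> ` carrier A \<union> S"] S(3) by auto
  then have sub: "carrier B \<subseteq> range (words_eval B v)"
    using generate_ring_words[OF B.is_cring rv1 rv2] by blast
  define h where "h = inv_into UNIV (words_eval B v)"
  have inj: "inj_on h (carrier B)" unfolding h_def by (rule inj_on_inv_into[OF sub])
  let ?B = "image_ring h B"
  have iso: "h \<in> ring_iso B ?B" by (rule inj_imp_image_ring_iso[OF inj])
  have cr: "cring ?B"
    using B.ring_iso_imp_img_cring[OF iso]
    by (simp add: image_ring_def image_group_def monoid.defs)
  interpret B': cring ?B by fact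
  interpret h: ring_hom_cring B ?B h
    using iso by unfold_locales (simp add: ring_iso_def)
  have gen: "h x \<in> generate_ring ?B (h ` H)"
    if "x \<in> generate_ring B H" "H \<subseteq> carrier B" for x H
    using that(1)
  proof induction
    case one
    show ?case using generate_ring.one[of ?B] by simp
  next
    case (incl k)
    then show ?case by (simp add: generate_ring.incl)
  next
    case (a_inv k)
    have k: "k \<in> carrier B" using a_inv.hyps B.generate_ring_in_carrier[OF that(2)] by blast
    show ?case using generate_ring.a_inv[OF a_inv.IH] h.hom_a_inv[OF k] by simp
  next
    case (eng_add k l)
    have kl: "k \<in> carrier B" "l \<in> carrier B"
      using eng_add.hyps B.generate_ring_in_carrier[OF that(2)] by blast+
    show ?case using generate_ring.eng_add[OF eng_add.IH] h.hom_add[OF kl] by simp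
  next
    case (eng_mult k l)
    have kl: "k \<in> carrier B" "l \<in> carrier B"
      using eng_mult.hyps B.generate_ring_in_carrier[OF that(2)] by blast+
    show ?case using generate_ring.eng_mult[OF eng_mult.IH] h.hom_mult[OF kl] by simp
  qed
  have H: "\<phi> ` carrier A \<union> S \<subseteq> carrier B" using S(1) by auto
  have im: "h ` (\<phi> ` carrier A \<union> S) = (h \<circ> \<phi>) ` carrier A \<union> h ` S" by auto
  have "carrier ?B \<subseteq> generate_ring ?B ((h \<circ> \<phi>) ` carrier A \<union> h ` S)"
    using gen[OF _ H] S(3) unfolding im image_ring_carrier by blast
  moreover have "(h \<circ> \<phi>) ` carrier A \<union> h ` S \<subseteq> carrier ?B"
    using S(1) by auto
  ultimately have "carrier ?B = generate_ring ?B ((h \<circ> \<phi>) ` carrier A \<union> h ` S)"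
    using B'.generate_ring_incl by blast
  moreover have "h \<circ> \<phi> \<in> ring_hom A ?B"
    using \<phi> iso by (auto simp: ring_iso_def intro: ring_hom_trans)
  moreover have "h ` S \<subseteq> carrier ?B" "finite (h ` S)" using S by auto
  ultimately have "fin_gen_algebra A ?B (h \<circ> \<phi>)" using cr unfolding fin_gen_algebra_def by blast
  with iso show ?thesis by blast
qed

definition gen_submodule ::
    "('a, 'c) ring_scheme \<Rightarrow> ('a, 'b, 'd) module_scheme \<Rightarrow> 'b set \<Rightarrow> 'b set" where
  "gen_submodule A M S = \<Inter>{H. submodule H A M \<and> S \<subseteq> H}"

definition fin_gen_module :: "('a, 'c) ring_scheme \<Rightarrow> ('a, 'b, 'd) module_scheme \<Rightarrow> bool" where
  "fin_gen_module A M \<longleftrightarrow> Module.module A M \<and>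
     (\<exists>S \<subseteq> carrier M. finite S \<and> carrier M = gen_submodule A M S)"

definition ideal_smult ::
    "('a, 'c) ring_scheme \<Rightarrow> ('a, 'b, 'd) module_scheme \<Rightarrow> 'a set \<Rightarrow> 'b set \<Rightarrow> 'b set" where
  "ideal_smult A M I N = gen_submodule A M {a \<odot>\<^bsub>M\<^esub> x | a x. a \<in> I \<and> x \<in> N}"

text \<open>The multiplicative fields of a \<^typ>\<open>('a, 'b) module\<close> record carry no information for a module.\<close>

definition quot_module :: "('a, 'b, 'd) module_scheme \<Rightarrow> 'b set \<Rightarrow> ('a, 'b set) module" where
  "quot_module M N =
     \<lparr>carrier = a_rcosets\<^bsub>M\<^esub> N, monoid.mult = undefined, monoid.one = undefined,
      ring.zero = N, ring.add = set_add M,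
      module.smult = (\<lambda>a P. \<Union>x \<in> P. N +>\<^bsub>M\<^esub> (a \<odot>\<^bsub>M\<^esub> x))\<rparr>"

lemma (in Module.module) quot_module_module:
  assumes N: "submodule N R M"
  shows "Module.module R (quot_module M N)"
proof -
  have "subgroup N (add_monoid M)" using N by (simp add: submodule_def)
  then interpret N: abelian_subgroup N M
    by (intro abelian_subgroupI3 additive_subgroup.intro) (auto intro: M.abelian_group_axioms)
  let ?K = "quot_module M N"
  have cc: "P \<in> carrier ?K \<longleftrightarrow> (\<exists>x\<in>carrier M. P = N +>\<^bsub>M\<^esub> x)" for P
    by (auto simp: quot_module_def A_RCOSETS_def' a_r_coset_def')
  have ccE: thesis
    if "P \<in> carrier ?K" "\<And>x. x \<in> carrier M \<Longrightarrow> P = N +>\<^bsub>M\<^esub> x \<Longrightarrow> thesis" for P thesis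
    using that cc by blast
  have [simp]: "N +>\<^bsub>M\<^esub> x \<in> carrier ?K" if "x \<in> carrier M" for x using that cc by blast
  have zero: "\<zero>\<^bsub>?K\<^esub> = N +>\<^bsub>M\<^esub> \<zero>\<^bsub>M\<^esub>"
    using M.a_coset_add_zero[of N] N.a_subset by (simp add: quot_module_def)
  have add: "(N +>\<^bsub>M\<^esub> x) \<oplus>\<^bsub>?K\<^esub> (N +>\<^bsub>M\<^esub> y) = N +>\<^bsub>M\<^esub> (x \<oplus>\<^bsub>M\<^esub> y)"
    if "x \<in> carrier M" "y \<in> carrier M" for x y
    using that N.a_rcos_sum by (simp add: quot_module_def)
  have smult: "a \<odot>\<^bsub>?K\<^esub> (N +>\<^bsub>M\<^esub> x) = N +>\<^bsub>M\<^esub> (a \<odot>\<^bsub>M\<^esub> x)"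
    if a: "a \<in> carrier R" "x \<in> carrier M" for a x
  proof -
    have eq: "N +>\<^bsub>M\<^esub> (a \<odot>\<^bsub>M\<^esub> y) = N +>\<^bsub>M\<^esub> (a \<odot>\<^bsub>M\<^esub> x)" if y: "y \<in> N +>\<^bsub>M\<^esub> x" for y
    proof -
      obtain n where n: "n \<in> N" "y = n \<oplus>\<^bsub>M\<^esub> x"
        using y by (auto simp: a_r_coset_def')
      have "a \<odot>\<^bsub>M\<^esub> y = a \<odot>\<^bsub>M\<^esub> n \<oplus>\<^bsub>M\<^esub> a \<odot>\<^bsub>M\<^esub> x"
        using n a N.a_subset by (auto intro: smult_r_distr)
      moreover have "a \<odot>\<^bsub>M\<^esub> n \<in> N" using N n a by (simp add: submodule.smult_closed)
      ultimately have "a \<odot>\<^bsub>M\<^esub> y \<in> N +>\<^bsub>M\<^esub> (a \<odot>\<^bsub>M\<^esub> x)" by (auto simp: a_r_coset_def')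
      then show ?thesis
        using M.a_repr_independence[of _ N "a \<odot>\<^bsub>M\<^esub> x"] N.a_subgroup a by simp
    qed
    have "N +>\<^bsub>M\<^esub> x \<noteq> {}" using a N.a_rcos_self by blast
    then show ?thesis unfolding quot_module_def module.simps by (rule SUP_eq_const) (rule eq)
  qed
  show ?thesis
  proof (intro moduleI abelian_groupI)
    show "cring R" by (rule R.is_cring)
    fix P assume "P \<in> carrier ?K"
    then obtain x where "x \<in> carrier M" "P = N +>\<^bsub>M\<^esub> x" using cc by blast
    then show "\<exists>Q \<in> carrier ?K. Q \<oplus>\<^bsub>?K\<^esub> P = \<zero>\<^bsub>?K\<^esub>"
      by (intro bexI[of _ "N +>\<^bsub>M\<^esub> (\<ominus>\<^bsub>M\<^esub> x)"]) (auto simp: add zero M.l_neg)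
  qed (auto elim!: ccE simp: add zero smult smult_l_distr smult_r_distr smult_assoc1 M.a_ac)
qed

definition annihilator :: "('a, 'c) ring_scheme \<Rightarrow> ('a, 'b, 'd) module_scheme \<Rightarrow> 'a set" where
  "annihilator A M = {a \<in> carrier A. \<forall>x \<in> carrier M. a \<odot>\<^bsub>M\<^esub> x = \<zero>\<^bsub>M\<^esub>}"

definition module_dim :: "('a, 'c) ring_scheme \<Rightarrow> ('a, 'b, 'd) module_scheme \<Rightarrow> ereal" where
  "module_dim A M = krull_dim (A Quot annihilator A M)"

end

theory Submission
  imports Defs
begin

text \<open>
  The modules are first turned into ideals: in the trivial extension of \<open>A\<close> by \<open>M\<close> the submodules \<open>N \<subseteq> M\<close> become
  ideals, and \<open>I\<^sup>n M\<close> becomes the product of \<open>(I \<times> M)\<^sup>n\<close> with \<open>0 \<times> M\<close>. The trivial extension is noetherian and has the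
  same primes as \<open>A\<close>. So let \<open>N \<subseteq> M\<close> be ideals of a noetherian ring \<open>R\<close>. The property follows from
  \<open>I\<^sup>n\<^sup>+\<^sup>1 M \<inter> N = I (I\<^sup>n M \<inter> N)\<close> for all large \<open>n\<close>, and this may be checked at each prime \<open>Q\<close>.

  Suppose that \<open>y \<in> I\<close> satisfies \<open>I\<^sup>n M = y I\<^sup>n\<^sup>-\<^sup>1 M + N \<inter> I\<^sup>n M\<close> at \<open>Q\<close> and is no zero divisor on \<open>I\<^sup>n M\<close> modulo \<open>N\<close>.
  Then an element of \<open>I\<^sup>n\<^sup>+\<^sup>1 M \<inter> N\<close> is \<open>y z + w\<close> with \<open>w \<in> I (I\<^sup>n M \<inter> N)\<close> and \<open>z \<in> I\<^sup>n M\<close>, and \<open>y z \<in> N\<close> forces \<open>z \<in> N\<close>, so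
  that it lies in \<open>I (I\<^sup>n M \<inter> N)\<close> (\<open>artin_rees_step\<close>). The point is to find such \<open>y\<close> for all \<open>n\<close> beyond a bound that depends
  neither on \<open>I\<close> nor on \<open>Q\<close>.

  The first condition holds for general \<open>y\<close> as soon as \<open>I\<^sup>n M\<close> has at most \<open>n\<close> generators at \<open>Q\<close> modulo \<open>N\<close>: this is the theorem of
  Eakin and Sathaye (\<open>reduction_cofinite\<close>), followed by Nakayama's lemma. General elements need an infinite residue field,
  hence everything is extended to \<open>R[t]\<close> at the prime \<open>Q[t]\<close>, where \<open>y = \<Sum> x\<^sub>i t\<^sup>i\<^sup>k\<close> with \<open>I = (x\<^sub>0, \<dots>, x\<^sub>r)\<close>
  and large \<open>k\<close> is general and still has coefficient ideal \<open>I\<close>.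

  So a bound for the number of local generators of all submodules of \<open>M/N\<close> is needed, uniform in \<open>Q\<close>. A prime filtration of \<open>M/N\<close>
  reduces this to the ideals of the domains \<open>R/p\<close>, of dimension at most one. There the inequality of Krull and Akizuki
  bounds the generators of every ideal at \<open>Q\<close> by the length of \<open>(R/p)/f\<close> at \<open>Q\<close>, for any \<open>f \<notin> p\<close> in \<open>Q\<close> (\<open>krull_akizuki\<close>).
  This is where the J-2 property enters: the regular locus of \<open>R/p\<close> contains some \<open>D(f)\<close>, on which \<open>f\<close> can be replaced by
  a generator of the maximal ideal, giving the bound one; and the length of \<open>(R/p)/f\<close> itself is finite, which bounds the
  remaining primes (\<open>loc_gen_bound_exists\<close>).

  The second condition, with a uniform bound on \<open>n\<close>, is obtained by descending induction along the filtration from the Artin-Rees property of the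
  larger ideals in it (\<open>torsion_bound_step\<close>); the induction is \<open>artin_rees_uniform\<close>.
\<close>

no_notation Sum_Type.Plus (infixr "<+>" 65)

section \<open>Ideals and their localisations\<close>

text \<open>Membership in the localisation \<open>U\<^sub>Q\<close>, tested by one denominator outside \<open>Q\<close>. Statements at a prime
  are proved with these preimages in \<open>R\<close>, so that no ring of fractions has to be formed.\<close>

definition satur :: "('a, 'b) ring_scheme \<Rightarrow> 'a set \<Rightarrow> 'a set \<Rightarrow> 'a set" where
  "satur R Q U = {x \<in> carrier R. \<exists>a \<in> carrier R - Q. a \<otimes>\<^bsub>R\<^esub> x \<in> U}"

text \<open>Multiplying \<open>V\<close> repeatedly by \<open>J\<close>, instead of once by a power of \<open>J\<close>, makes
  \<open>J\<^sup>m (J\<^sup>n V) = J\<^sup>m\<^sup>+\<^sup>n V\<close> a fact about iteration.\<close>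

definition pow_prod :: "('a, 'b) ring_scheme \<Rightarrow> 'a set \<Rightarrow> nat \<Rightarrow> 'a set \<Rightarrow> 'a set" where
  "pow_prod R J n V = (ideal_prod R J ^^ n) V"

definition colon :: "('a, 'b) ring_scheme \<Rightarrow> 'a set \<Rightarrow> 'a \<Rightarrow> 'a set" where
  "colon R K m = {c \<in> carrier R. c \<otimes>\<^bsub>R\<^esub> m \<in> K}"

context cring
begin

lemma ideal_add: "ideal I R \<Longrightarrow> x \<in> I \<Longrightarrow> y \<in> I \<Longrightarrow> x \<oplus> y \<in> I"
  by (simp add: additive_subgroup.a_closed ideal.axioms(1))

lemma ideal_uminus: "ideal I R \<Longrightarrow> x \<in> I \<Longrightarrow> \<ominus> x \<in> I"
  by (simp add: additive_subgroup.a_inv_closed ideal.axioms(1))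

lemma ideal_minus: "ideal I R \<Longrightarrow> x \<in> I \<Longrightarrow> y \<in> I \<Longrightarrow> x \<ominus> y \<in> I"
  unfolding a_minus_def by (intro ideal_add ideal_uminus)

lemma ideal_zero: "ideal I R \<Longrightarrow> \<zero> \<in> I"
  by (simp add: additive_subgroup.zero_closed ideal.axioms(1))

lemma ideal_mult: "ideal I R \<Longrightarrow> x \<in> I \<Longrightarrow> a \<in> carrier R \<Longrightarrow> a \<otimes> x \<in> I"
  by (rule ideal.I_l_closed)

lemma ideal_subset: "ideal I R \<Longrightarrow> I \<subseteq> carrier R"
  by (auto intro: ideal.Icarr)

lemma idealI':
  assumes "I \<subseteq> carrier R" "\<zero> \<in> I" "\<And>x y. x \<in> I \<Longrightarrow> y \<in> I \<Longrightarrow> x \<oplus> y \<in> I"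
    "\<And>a x. a \<in> carrier R \<Longrightarrow> x \<in> I \<Longrightarrow> a \<otimes> x \<in> I"
  shows "ideal I R"
proof (rule idealI[OF ring_axioms])
  have neg: "\<ominus> x \<in> I" if "x \<in> I" for x
    using assms(4)[of "\<ominus> \<one>" x] assms(1) that l_minus[of \<one> x] by auto
  show "subgroup I (add_monoid R)"
    by (rule add.subgroupI) (use assms neg in \<open>auto simp: a_inv_def\<close>)
  show "\<And>a x. a \<in> I \<Longrightarrow> x \<in> carrier R \<Longrightarrow> x \<otimes> a \<in> I" by (rule assms(4))
  show "\<And>a x. a \<in> I \<Longrightarrow> x \<in> carrier R \<Longrightarrow> a \<otimes> x \<in> I"
    using assms(1,4) m_comm by (metis subsetD)
qed

lemma prime_mult: "primeideal Q R \<Longrightarrow> a \<in> carrier R - Q \<Longrightarrow> b \<in> carrier R - Q \<Longrightarrow> a \<otimes> b \<in> carrier R - Q"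
  using primeideal.I_prime by fastforce

lemma prime_one: "primeideal Q R \<Longrightarrow> \<one> \<in> carrier R - Q"
  using ideal.one_imp_carrier[of Q R] primeideal.axioms(1) primeideal.I_notcarr[of Q R]
  by fastforce

lemma prime_ideal: "primeideal Q R \<Longrightarrow> ideal Q R"
  by (rule primeideal.axioms(1))

lemma set_addI: "x \<in> I \<Longrightarrow> y \<in> J \<Longrightarrow> x \<oplus> y \<in> I <+> J"
  by (auto simp: set_add_def')

lemma set_addE:
  assumes "z \<in> I <+> J" obtains x y where "x \<in> I" "y \<in> J" "z = x \<oplus> y"
  using assms by (auto simp: set_add_def')

lemma set_add_upper1: "I \<subseteq> carrier R \<Longrightarrow> ideal J R \<Longrightarrow> I \<subseteq> I <+> J"
  using set_addI[of _ I \<zero> J] ideal_zero[of J] by fastforce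

lemma set_add_upper2: "J \<subseteq> carrier R \<Longrightarrow> ideal I R \<Longrightarrow> J \<subseteq> I <+> J"
  using set_addI[of \<zero> I _ J] ideal_zero[of I] by fastforce

lemma set_add_le1: "ideal I R \<Longrightarrow> ideal J R \<Longrightarrow> I \<subseteq> I <+> J"
  by (rule set_add_upper1[OF ideal_subset])

lemma set_add_le2: "ideal I R \<Longrightarrow> ideal J R \<Longrightarrow> J \<subseteq> I <+> J"
  by (rule set_add_upper2[OF ideal_subset])

lemma set_add_least: "ideal K R \<Longrightarrow> I \<subseteq> K \<Longrightarrow> J \<subseteq> K \<Longrightarrow> I <+> J \<subseteq> K"
  by (auto elim!: set_addE intro: ideal_add)

lemma set_add_mono: "I \<subseteq> I' \<Longrightarrow> J \<subseteq> J' \<Longrightarrow> I <+> J \<subseteq> I' <+> J'"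
  by (auto simp: set_add_def')

lemma ideal_prod_least:
  assumes "ideal K R" "\<And>i j. i \<in> I \<Longrightarrow> j \<in> J \<Longrightarrow> i \<otimes> j \<in> K" shows "I \<cdot> J \<subseteq> K"
proof
  fix s assume "s \<in> I \<cdot> J"
  then show "s \<in> K" by induct (auto intro: assms ideal_add)
qed

lemma ideal_prod_mono: "I \<subseteq> I' \<Longrightarrow> J \<subseteq> J' \<Longrightarrow> I \<cdot> J \<subseteq> I' \<cdot> J'"
proof
  fix s assume "I \<subseteq> I'" "J \<subseteq> J'" "s \<in> I \<cdot> J"
  from this(3,1,2) show "s \<in> I' \<cdot> J'"
    by induct (auto intro: ideal_prod.prod ideal_prod.sum)
qed

lemma ideal_prod_le2: "ideal I R \<Longrightarrow> ideal J R \<Longrightarrow> I \<cdot> J \<subseteq> J"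
  using ideal_prod_inter by blast

lemma PIdl_prod_iff:
  assumes "ideal H R" "f \<in> carrier R"
  shows "x \<in> (PIdl f) \<cdot> H \<longleftrightarrow> (\<exists>h \<in> H. x = f \<otimes> h)"
proof
  have H: "H \<subseteq> carrier R" using assms ideal_subset by blast
  have "ideal {f \<otimes> h | h. h \<in> H} R"
  proof (rule idealI')
    show "\<zero> \<in> {f \<otimes> h | h. h \<in> H}" using ideal_zero[OF assms(1)] assms by force
    fix x y assume "x \<in> {f \<otimes> h | h. h \<in> H}" "y \<in> {f \<otimes> h | h. h \<in> H}"
    then obtain h h' where "h \<in> H" "h' \<in> H" "x = f \<otimes> h" "y = f \<otimes> h'" by blast
    moreover from this have "x \<oplus> y = f \<otimes> (h \<oplus> h')" using H assms by (simp add: r_distr subsetD)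
    ultimately show "x \<oplus> y \<in> {f \<otimes> h | h. h \<in> H}" using ideal_add[OF assms(1)] by blast
  next
    fix a x assume "a \<in> carrier R" "x \<in> {f \<otimes> h | h. h \<in> H}"
    then obtain h where "h \<in> H" "x = f \<otimes> h" by blast
    moreover from this have "a \<otimes> x = f \<otimes> (a \<otimes> h)"
      using H assms \<open>a \<in> _\<close> by (simp add: m_lcomm subsetD)
    ultimately show "a \<otimes> x \<in> {f \<otimes> h | h. h \<in> H}"
      using ideal_mult[OF assms(1)] \<open>a \<in> _\<close> by blast
  qed (use H assms in auto)
  then have "(PIdl f) \<cdot> H \<subseteq> {f \<otimes> h | h. h \<in> H}"
  proof (rule ideal_prod_least)
    fix i j assume "i \<in> PIdl f" and j: "j \<in> H"
    then obtain c where c: "c \<in> carrier R" "i = c \<otimes> f" by (auto simp: cgenideal_def)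
    have "i \<otimes> j = f \<otimes> (c \<otimes> j)" using c j H assms by (simp add: m_ac subsetD)
    then show "i \<otimes> j \<in> {f \<otimes> h | h. h \<in> H}" using ideal_mult[OF assms(1) j c(1)] by blast
  qed
  then show "x \<in> (PIdl f) \<cdot> H \<Longrightarrow> \<exists>h \<in> H. x = f \<otimes> h" by blast
  show "\<exists>h \<in> H. x = f \<otimes> h \<Longrightarrow> x \<in> (PIdl f) \<cdot> H"
    using ideal_prod.prod[of f "PIdl f" _ H R] cgenideal_self[OF assms(2)] by auto
qed

lemma PIdl_iff: "x \<in> PIdl f \<longleftrightarrow> (\<exists>c \<in> carrier R. x = c \<otimes> f)"
  by (auto simp: cgenideal_def)

lemma PIdl_least: "ideal K R \<Longrightarrow> f \<in> K \<Longrightarrow> PIdl f \<subseteq> K"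
  by (auto simp: cgenideal_def intro: ideal_mult)

lemmas ideal_ops = add_ideals ideal_prod_is_ideal cgenideal_ideal i_intersect

lemma satur_ideal:
  assumes Q: "primeideal Q R" and I: "ideal I R"
  shows "ideal (satur R Q I) R"
proof (rule idealI')
  note one = prime_one[OF Q]
  show "\<zero> \<in> satur R Q I" using one ideal_zero[OF I] by (auto simp: satur_def)
  fix x y assume "x \<in> satur R Q I" "y \<in> satur R Q I"
  then obtain a b where a: "a \<in> carrier R - Q" "a \<otimes> x \<in> I" and b: "b \<in> carrier R - Q" "b \<otimes> y \<in> I"
    and xy: "x \<in> carrier R" "y \<in> carrier R" by (auto simp: satur_def)
  have "a \<otimes> b \<otimes> (x \<oplus> y) = b \<otimes> (a \<otimes> x) \<oplus> a \<otimes> (b \<otimes> y)" using a b xy by (simp add: m_ac r_distr)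
  also have "\<dots> \<in> I" using a b by (intro ideal_add[OF I] ideal_mult[OF I a(2)] ideal_mult[OF I b(2)]) auto
  finally show "x \<oplus> y \<in> satur R Q I" using prime_mult[OF Q a(1) b(1)] xy by (auto simp: satur_def)
next
  fix c x assume c: "c \<in> carrier R" "x \<in> satur R Q I"
  then obtain a where a: "a \<in> carrier R - Q" "a \<otimes> x \<in> I" "x \<in> carrier R" by (auto simp: satur_def)
  have "a \<otimes> (c \<otimes> x) = c \<otimes> (a \<otimes> x)" using a c by (simp add: m_lcomm)
  also have "\<dots> \<in> I" using ideal_mult[OF I a(2) c(1)] .
  finally show "c \<otimes> x \<in> satur R Q I" using a c by (auto simp: satur_def)
qed (auto simp: satur_def)

lemma saturI: "a \<in> carrier R - Q \<Longrightarrow> x \<in> carrier R \<Longrightarrow> a \<otimes> x \<in> U \<Longrightarrow> x \<in> satur R Q U"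
  by (auto simp: satur_def)

lemma saturE:
  assumes "x \<in> satur R Q U"
  obtains a where "a \<in> carrier R" "a \<notin> Q" "a \<otimes> x \<in> U" "x \<in> carrier R"
  using assms by (auto simp: satur_def)

lemma satur_upper: "primeideal Q R \<Longrightarrow> U \<subseteq> carrier R \<Longrightarrow> U \<subseteq> satur R Q U"
  using prime_one[of Q] by (auto simp: satur_def intro!: bexI[of _ \<one>])

lemma satur_le: "primeideal Q R \<Longrightarrow> ideal U R \<Longrightarrow> U \<subseteq> satur R Q U"
  by (rule satur_upper[OF _ ideal_subset])

lemma satur_mono: "U \<subseteq> Y \<Longrightarrow> satur R Q U \<subseteq> satur R Q Y"
  by (auto simp: satur_def)

lemma satur_absorb:
  assumes "primeideal Q R" "a \<in> carrier R - Q" "x \<in> carrier R" "a \<otimes> x \<in> satur R Q U"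
  shows "x \<in> satur R Q U"
proof -
  from assms(4) obtain b where b: "b \<in> carrier R" "b \<notin> Q" "b \<otimes> (a \<otimes> x) \<in> U" by (rule saturE)
  then show ?thesis using prime_mult[OF assms(1), of b a] assms(2,3)
    by (intro saturI[of "b \<otimes> a"]) (auto simp: m_assoc)
qed

lemma satur_closed:
  assumes "primeideal Q R" "U \<subseteq> satur R Q Y"
  shows "satur R Q U \<subseteq> satur R Q Y"
  using assms by (auto elim!: saturE intro: satur_absorb)

lemma satur_leI: "primeideal Q R \<Longrightarrow> U \<subseteq> carrier R \<Longrightarrow> U \<subseteq> Y \<Longrightarrow> U \<subseteq> satur R Q Y"
  by (rule order_trans[OF satur_upper satur_mono])

lemma satur_prod:
  assumes "primeideal Q R" "ideal I R" "ideal J R"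
  shows "I \<cdot> satur R Q J \<subseteq> satur R Q (I \<cdot> J)"
proof (rule ideal_prod_least)
  show "ideal (satur R Q (I \<cdot> J)) R" using assms by (intro satur_ideal ideal_ops)
  fix i j assume i: "i \<in> I" and "j \<in> satur R Q J"
  then obtain a where a: "a \<in> carrier R" "a \<notin> Q" "a \<otimes> j \<in> J" "j \<in> carrier R" by (auto elim: saturE)
  have "i \<in> carrier R" using i assms(2) ideal.Icarr by fast
  then have "a \<otimes> (i \<otimes> j) = i \<otimes> (a \<otimes> j)" using a by (simp add: m_lcomm)
  also have "\<dots> \<in> I \<cdot> J" using i a by (intro ideal_prod.prod)
  finally show "i \<otimes> j \<in> satur R Q (I \<cdot> J)" using a \<open>i \<in> carrier R\<close> by (intro saturI[of a]) auto
qed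

lemma satur_prod_le:
  assumes "primeideal Q R" "ideal I R" "ideal J R" "U \<subseteq> satur R Q J"
  shows "I \<cdot> U \<subseteq> satur R Q (I \<cdot> J)"
  using satur_prod[OF assms(1-3)] ideal_prod_mono[OF subset_refl assms(4)] by blast

lemma colon_ideal:
  assumes "ideal K R" "m \<in> carrier R" shows "ideal (colon R K m) R"
  by (rule idealI')
    (use assms in \<open>auto simp: colon_def l_distr m_assoc intro: ideal_zero ideal_add ideal_mult\<close>)

lemma pow_prod_0 [simp]: "pow_prod R J 0 V = V"
  and pow_prod_Suc: "pow_prod R J (Suc n) V = J \<cdot> pow_prod R J n V"
  by (simp_all add: pow_prod_def)

lemma pow_prod_ideal: "ideal J R \<Longrightarrow> ideal V R \<Longrightarrow> ideal (pow_prod R J n V) R"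
  by (induct n) (auto simp: pow_prod_Suc intro: ideal_ops)

lemma pow_prod_add: "pow_prod R J (m + n) V = pow_prod R J m (pow_prod R J n V)"
  by (simp add: pow_prod_def funpow_add)

lemma pow_prod_mono: "V \<subseteq> W \<Longrightarrow> pow_prod R J n V \<subseteq> pow_prod R J n W"
  by (induct n) (auto simp: pow_prod_Suc dest: ideal_prod_mono[OF subset_refl] del: subsetI)

lemma pow_prod_le: "ideal J R \<Longrightarrow> ideal V R \<Longrightarrow> pow_prod R J n V \<subseteq> V"
  by (induct n) (use ideal_prod_le2 pow_prod_ideal in \<open>force simp: pow_prod_Suc\<close>)+

lemma ideal_prod_left_comm:
  assumes "ideal I R" "ideal J R" "ideal K R" shows "I \<cdot> (J \<cdot> K) = J \<cdot> (I \<cdot> K)"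
  using assms by (metis ideal_prod_assoc ideal_prod_commute)

lemma pow_prod_comm:
  assumes "ideal I R" "ideal J R" "ideal V R"
  shows "pow_prod R J n (I \<cdot> V) = I \<cdot> pow_prod R J n V"
  using assms by (induct n) (auto simp: pow_prod_Suc ideal_prod_left_comm pow_prod_ideal)

end

section \<open>Length at a prime\<close>

text \<open>\<open>len_le R Q U Z n\<close> says that \<open>U\<^sub>Q / Z\<^sub>Q\<close> has length at most \<open>n\<close>: every step of the chain adjoins one
  element that \<open>Q\<close> multiplies into the previous step, so each factor is zero or the residue field
  at \<open>Q\<close>. When \<open>Q U \<subseteq> Z\<close> this is a bound for the dimension of a vector space over that field.\<close>

inductive len_le :: "('a, 'b) ring_scheme \<Rightarrow> 'a set \<Rightarrow> 'a set \<Rightarrow> 'a set \<Rightarrow> nat \<Rightarrow> bool"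
  for R Q where
  len_le_0: "ideal U R \<Longrightarrow> ideal Z R \<Longrightarrow> Z \<subseteq> U \<Longrightarrow> U \<subseteq> satur R Q Z \<Longrightarrow> len_le R Q U Z 0"
| len_le_Suc: "len_le R Q K Z n \<Longrightarrow> ideal U R \<Longrightarrow> K \<subseteq> U \<Longrightarrow> m \<in> U \<Longrightarrow>
    (\<And>c. c \<in> Q \<Longrightarrow> c \<otimes>\<^bsub>R\<^esub> m \<in> satur R Q K) \<Longrightarrow>
    U \<subseteq> satur R Q (K <+>\<^bsub>R\<^esub> PIdl\<^bsub>R\<^esub> m) \<Longrightarrow> len_le R Q U Z (Suc n)"

context cring
begin

lemma len_leD: "len_le R Q U Z n \<Longrightarrow> ideal U R \<and> ideal Z R \<and> Z \<subseteq> U"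
  by (induct rule: len_le.induct) auto

lemma len_le_mono_Suc:
  assumes Q: "primeideal Q R" and l: "len_le R Q U Z n"
  shows "len_le R Q U Z (Suc n)"
proof -
  have U: "ideal U R" using len_leD[OF l] by simp
  have s: "satur R Q U \<subseteq> satur R Q (U <+> PIdl \<zero>)"
    using U by (intro satur_mono set_add_upper1 ideal_subset ideal_ops) auto
  have U': "U \<subseteq> satur R Q U" using satur_le[OF Q U] .
  show ?thesis
    by (rule len_le_Suc[OF l U subset_refl, of \<zero>])
      (use U U' s ideal_zero[OF U] ideal.Icarr[OF prime_ideal[OF Q]] in auto)
qed

lemma len_le_mono:
  assumes Q: "primeideal Q R" and l: "len_le R Q U Z m" and "m \<le> n"
  shows "len_le R Q U Z n"
  using assms(3,1,2) by (induct rule: dec_induct) (auto intro: len_le_mono_Suc)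

lemma len_le_trans:
  assumes "len_le R Q U Y n" "len_le R Q Y Z m" and Q: "primeideal Q R"
  shows "len_le R Q U Z (n + m)"
  using assms(1,2)
proof (induct rule: len_le.induct)
  case (len_le_0 U Y)
  from len_le_0(5,1,3,4) show ?case
  proof (cases rule: len_le.cases)
    case len_le_0': len_le_0
    then show ?thesis using len_le_0 satur_closed[OF Q len_le_0'(5)]
      by (auto intro!: len_le.len_le_0)
  next
    case (len_le_Suc K n m)
    have "U \<subseteq> satur R Q (K <+> PIdl m)" using satur_closed[OF Q len_le_Suc(7)] len_le_0 by blast
    then show ?thesis using len_le_Suc len_le_0
      by (auto intro!: len_le.len_le_Suc[of _ _ K _ _ _ m])
  qed
next
  case (len_le_Suc K Y n U k)
  then show ?case by (auto intro!: len_le.len_le_Suc[of _ _ K _ _ _ k])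
qed

text \<open>The chain for \<open>U\<close> is intersected with \<open>Y\<close>. If \<open>Y\<close> reaches beyond \<open>K\<^sub>Q\<close> in the top step, some \<open>y \<in> Y\<close>
  equals \<open>c m\<close> modulo \<open>K\<close> with \<open>c\<close> a unit at \<open>Q\<close>, and \<open>y\<close> takes over the role of the generator \<open>m\<close>.
  If no step is lost in this way, then \<open>Y\<close> is all of \<open>U\<close> at \<open>Q\<close>; otherwise the length drops.\<close>

lemma len_le_sub:
  assumes Q: "primeideal Q R" and "len_le R Q U Z n"
    and "ideal Y R" "Z \<subseteq> Y" "Y \<subseteq> U"
  shows "len_le R Q Y Z n \<and> (U \<subseteq> satur R Q Y \<or> (n \<ge> 1 \<and> len_le R Q Y Z (n - 1)))"
  using assms(2-)
proof (induct arbitrary: Y rule: len_le.induct)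
  case (len_le_0 U Z)
  then show ?case using satur_mono[of Z Y Q]
    by (auto intro!: len_le.len_le_0)
next
  case (len_le_Suc K Z n U m)
  have K: "ideal K R" and Z: "ideal Z R" "Z \<subseteq> K" using len_leD[OF len_le_Suc(1)] by auto
  note U = len_le_Suc(3) note Y = len_le_Suc(8)
  note cU = ideal_subset[OF U]
  have m: "m \<in> carrier R" using cU len_le_Suc by auto
  let ?Y = "Y \<inter> K"
  have iY: "ideal ?Y R" using K Y by (rule i_intersect[rotated])
  have IH: "len_le R Q ?Y Z n" "K \<subseteq> satur R Q ?Y \<or> (n \<ge> 1 \<and> len_le R Q ?Y Z (n - 1))"
    using len_le_Suc(2)[OF iY] Z(2) len_le_Suc(9) by auto
  show ?case
  proof (cases "Y \<subseteq> satur R Q K")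
    case True
    have "Y \<subseteq> satur R Q ?Y"
    proof
      fix y assume y: "y \<in> Y"
      then obtain a where "a \<in> carrier R" "a \<notin> Q" "a \<otimes> y \<in> K" "y \<in> carrier R" using True by (auto elim: saturE)
      then show "y \<in> satur R Q ?Y" using y by (intro saturI[of a]) (auto intro: ideal_mult[OF Y])
    qed
    from len_le_trans[OF len_le.len_le_0[OF Y iY _ this] IH(1) Q]
    have "len_le R Q Y Z n" by simp
    then show ?thesis using len_le_mono_Suc[OF Q] by simp
  next
    case False
    then obtain y where y: "y \<in> Y" "y \<notin> satur R Q K" by blast
    have yc: "y \<in> carrier R" using y Y ideal.Icarr by fast
    from y len_le_Suc(7,10) have "y \<in> satur R Q (K <+> PIdl m)" by blast
    then obtain a where a: "a \<in> carrier R" "a \<notin> Q" "a \<otimes> y \<in> K <+> PIdl m" by (rule saturE)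
    then obtain k c where k: "k \<in> K" "c \<in> carrier R" "a \<otimes> y = k \<oplus> c \<otimes> m"
      by (auto simp: PIdl_iff elim!: set_addE)
    have kc: "k \<in> carrier R" using k K ideal.Icarr by fast
    have sK: "ideal (satur R Q K) R" using satur_ideal[OF Q K] .
    have "c \<notin> Q"
    proof
      assume "c \<in> Q"
      then have "c \<otimes> m \<in> satur R Q K" by (rule len_le_Suc(6))
      then have "a \<otimes> y \<in> satur R Q K" using k satur_le[OF Q K]
        by (auto intro!: ideal_add[OF sK])
      then show False using satur_absorb[OF Q _ yc] a y by blast
    qed
    have cm: "c \<otimes> m = a \<otimes> y \<ominus> k"
      unfolding k(3) using kc k(2) m by algebra
    have iPy: "ideal (PIdl y) R" "ideal (?Y <+> PIdl y) R" using yc iY by (auto intro: ideal_ops)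
    have gen: "Y \<subseteq> satur R Q (?Y <+> PIdl y)"
    proof
      fix w assume w: "w \<in> Y"
      then have wc: "w \<in> carrier R" using Y ideal.Icarr by fast
      from w len_le_Suc(7,10) have "w \<in> satur R Q (K <+> PIdl m)" by blast
      then obtain b where b: "b \<in> carrier R" "b \<notin> Q" "b \<otimes> w \<in> K <+> PIdl m" by (rule saturE)
      then obtain k' d where k': "k' \<in> K" "d \<in> carrier R" "b \<otimes> w = k' \<oplus> d \<otimes> m"
        by (auto simp: PIdl_iff elim!: set_addE)
      have k'c: "k' \<in> carrier R" using k' K ideal.Icarr by fast
      have "c \<otimes> b \<otimes> w = c \<otimes> (k' \<oplus> d \<otimes> m)" using k'(3) wc b k by (simp add: m_assoc)
      also have "\<dots> = c \<otimes> k' \<oplus> d \<otimes> (c \<otimes> m)" using k'c k'(2) k(2) m by algebra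
      also have "\<dots> = (c \<otimes> k' \<ominus> d \<otimes> k) \<oplus> (d \<otimes> a) \<otimes> y"
        unfolding cm using k'c k'(2) kc k(2) a yc by algebra
      finally have e: "c \<otimes> b \<otimes> w = (c \<otimes> k' \<ominus> d \<otimes> k) \<oplus> (d \<otimes> a) \<otimes> y" .
      have e2: "c \<otimes> k' \<ominus> d \<otimes> k = (c \<otimes> b) \<otimes> w \<ominus> (d \<otimes> a) \<otimes> y"
        unfolding e using k'c k'(2) kc k(2) a yc by algebra
      have "c \<otimes> k' \<ominus> d \<otimes> k \<in> K" using k k' by (intro ideal_minus ideal_mult K)
      moreover have "c \<otimes> k' \<ominus> d \<otimes> k \<in> Y" unfolding e2 using k k' a b
        by (intro ideal_minus[OF Y] ideal_mult[OF Y w] ideal_mult[OF Y y(1)]) auto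
      ultimately have "c \<otimes> b \<otimes> w \<in> ?Y <+> PIdl y" unfolding e using k' a
        by (intro set_addI) (auto simp: PIdl_iff)
      moreover have "c \<otimes> b \<in> carrier R - Q" using prime_mult[OF Q] \<open>c \<notin> Q\<close> k b by blast
      ultimately show "w \<in> satur R Q (?Y <+> PIdl y)" using wc by (intro saturI)
    qed
    have Qy: "q \<otimes> y \<in> satur R Q ?Y" if q: "q \<in> Q" for q
    proof -
      have qc: "q \<in> carrier R" using q prime_ideal[OF Q] ideal.Icarr by fast
      have "q \<otimes> m \<in> satur R Q K" using len_le_Suc(6) q .
      then have "c \<otimes> (q \<otimes> m) \<in> satur R Q K" using k(2) by (rule ideal_mult[OF sK])
      moreover have "q \<otimes> k \<in> satur R Q K"
        using satur_le[OF Q K] ideal_mult[OF K k(1) qc] by blast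
      ultimately have "q \<otimes> k \<oplus> c \<otimes> (q \<otimes> m) \<in> satur R Q K" by (rule ideal_add[OF sK, rotated])
      also have "q \<otimes> k \<oplus> c \<otimes> (q \<otimes> m) = q \<otimes> (k \<oplus> c \<otimes> m)" using qc kc k(2) m by algebra
      also have "\<dots> = a \<otimes> (q \<otimes> y)" unfolding k(3)[symmetric] using a qc yc by (simp add: m_lcomm)
      finally have "q \<otimes> y \<in> satur R Q K" using a qc yc by - (rule satur_absorb[OF Q, of a], auto)
      then obtain b where "b \<in> carrier R" "b \<notin> Q" "b \<otimes> (q \<otimes> y) \<in> K" by (rule saturE)
      then show ?thesis using qc yc ideal_mult[OF Y ideal_mult[OF Y y(1) qc]] by (intro saturI[of b]) auto
    qed
    have step: "len_le R Q Y Z (Suc j)" if "len_le R Q ?Y Z j" for j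
      by (rule len_le.len_le_Suc[OF that Y _ y(1) Qy gen]) auto
    have "U \<subseteq> satur R Q Y" if KY: "K \<subseteq> satur R Q ?Y"
    proof -
      have KY': "K \<subseteq> satur R Q Y" using KY satur_mono[of ?Y Y Q] by blast
      have iY': "ideal (satur R Q Y) R" using satur_ideal[OF Q Y] .
      have "a \<otimes> y \<in> satur R Q Y"
        using ideal_mult[OF Y y(1) a(1)] satur_le[OF Q Y] by blast
      then have "c \<otimes> m \<in> satur R Q Y" unfolding cm
        using k(1) KY' by (intro ideal_minus[OF iY']) auto
      then have "m \<in> satur R Q Y" using \<open>c \<notin> Q\<close> k m by - (rule satur_absorb[OF Q, of c], auto)
      then have "K <+> PIdl m \<subseteq> satur R Q Y" using KY' iY' by (intro set_add_least PIdl_least)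
      from order_trans[OF len_le_Suc(7) satur_closed[OF Q this]] show ?thesis .
    qed
    then have "U \<subseteq> satur R Q Y \<or> len_le R Q Y Z n"
    proof (cases "K \<subseteq> satur R Q ?Y")
      case False
      then have "len_le R Q Y Z (Suc (n - 1))" "n \<ge> 1" using IH(2) step by blast+
      then show ?thesis by simp
    qed simp
    then show ?thesis using step[OF IH(1)] by simp
  qed
qed

end


section \<open>Local generators of ideals in dimension one\<close>

locale noetherian_cring = noetherian_ring R + cring R for R (structure)

text \<open>A filtration of \<open>M/K\<close> with factors \<open>R/P\<close>, \<open>P\<close> prime; the factor generated by \<open>m\<close> over \<open>K\<close> is \<open>R/(K : m)\<close>.\<close>

inductive prime_filt :: "('a, 'b) ring_scheme \<Rightarrow> 'a set \<Rightarrow> 'a set \<Rightarrow> bool" for R M where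
  prime_filt_top: "ideal M R \<Longrightarrow> prime_filt R M M"
| prime_filt_step: "prime_filt R M (K <+>\<^bsub>R\<^esub> PIdl\<^bsub>R\<^esub> m) \<Longrightarrow> ideal K R \<Longrightarrow> K \<subseteq> M \<Longrightarrow> m \<in> M \<Longrightarrow>
    primeideal (colon R K m) R \<Longrightarrow> prime_filt R M K"

text \<open>One bound, for all primes \<open>Q\<close> and all ideals \<open>J\<close> of \<open>R/p\<close> at once, for the dimension of \<open>J/QJ\<close> over the
  residue field at \<open>Q\<close>.\<close>

definition loc_gen_bound :: "('a, 'b) ring_scheme \<Rightarrow> 'a set \<Rightarrow> nat \<Rightarrow> bool" where
  "loc_gen_bound R p e \<longleftrightarrow> (\<forall>Q J. primeideal Q R \<longrightarrow> ideal J R \<longrightarrow> p \<subseteq> J \<longrightarrow>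
     (\<exists>S \<subseteq> J. finite S \<and> card S \<le> e \<and>
        J \<subseteq> satur R Q (Idl\<^bsub>R\<^esub> S <+>\<^bsub>R\<^esub> ((Q \<cdot>\<^bsub>R\<^esub> J) <+>\<^bsub>R\<^esub> p))))"

context cring
begin

lemma Idl_insert_le:
  assumes "S \<subseteq> carrier R" "s \<in> carrier R"
  shows "Idl (insert s S) \<subseteq> Idl S <+> PIdl s"
proof (rule genideal_minimal)
  show "ideal (Idl S <+> PIdl s) R" using assms by (intro add_ideals genideal_ideal cgenideal_ideal)
  have "Idl S \<subseteq> Idl S <+> PIdl s" "PIdl s \<subseteq> Idl S <+> PIdl s"
    using assms by (auto intro!: set_add_upper1 set_add_upper2 ideal_subset genideal_ideal cgenideal_ideal del: subsetI)
  then show "insert s S \<subseteq> Idl S <+> PIdl s"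
    using genideal_self[OF assms(1)] cgenideal_self[OF assms(2)] by blast
qed

lemma Idl_mono: "S \<subseteq> T \<Longrightarrow> T \<subseteq> carrier R \<Longrightarrow> Idl S \<subseteq> Idl T"
  using subset_Idl_subset by blast

lemma len_le_gens:
  assumes Q: "primeideal Q R" and "len_le R Q U Z n"
  shows "\<exists>S \<subseteq> U. finite S \<and> card S \<le> n \<and> U \<subseteq> satur R Q (Idl S <+> Z)"
  using assms(2)
proof induct
  case (len_le_0 U Z)
  have "Z \<subseteq> Idl {} <+> Z" using len_le_0 by (intro set_add_le2 genideal_ideal) auto
  then show ?case using len_le_0 satur_mono[of Z "Idl {} <+> Z" Q] by (intro exI[of _ "{}"]) auto
next
  case (len_le_Suc K Z n U m)
  then obtain S where S: "S \<subseteq> K" "finite S" "card S \<le> n" "K \<subseteq> satur R Q (Idl S <+> Z)" by blast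
  have KZ: "ideal K R" "ideal Z R" using len_leD len_le_Suc by auto
  have Sc: "S \<subseteq> carrier R" "insert m S \<subseteq> carrier R" "m \<in> carrier R"
    using S KZ len_le_Suc ideal_subset by blast+
  let ?T = "Idl (insert m S) <+> Z"
  have T: "ideal ?T R" using Sc KZ by (intro add_ideals genideal_ideal)
  have sT: "ideal (satur R Q ?T) R" using satur_ideal[OF Q T] .
  have "Idl S <+> Z \<subseteq> ?T" using Sc by (intro set_add_mono Idl_mono) auto
  then have K: "K \<subseteq> satur R Q ?T" using S(4) satur_mono[of "Idl S <+> Z" ?T Q] by blast
  have "Idl (insert m S) \<subseteq> ?T" by (rule set_add_le1[OF genideal_ideal[OF Sc(2)] KZ(2)])
  then have "m \<in> ?T" using genideal_self[OF Sc(2)] by blast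
  then have "m \<in> satur R Q ?T" using satur_le[OF Q T] by blast
  then have "K <+> PIdl m \<subseteq> satur R Q ?T" using K sT by (intro set_add_least PIdl_least)
  from order_trans[OF len_le_Suc(7) satur_closed[OF Q this]]
  have "U \<subseteq> satur R Q ?T" .
  moreover have "card (insert m S) \<le> Suc n" using S card_insert_le_m1[of "Suc n" S m] by simp
  ultimately show ?case using S len_le_Suc(4,5) by (intro exI[of _ "insert m S"]) auto
qed

lemma len_le_of_gens:
  assumes Q: "primeideal Q R" and "finite S" "ideal U R" "ideal Z R" "Z \<subseteq> U" "S \<subseteq> U"
    "U \<subseteq> satur R Q (Idl S <+> Z)" "\<And>s c. s \<in> S \<Longrightarrow> c \<in> Q \<Longrightarrow> c \<otimes> s \<in> Z"
  shows "len_le R Q U Z (card S)"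
  using assms(2-)
proof (induct arbitrary: U)
  case empty
  have "Idl {} \<subseteq> Z" using empty by (intro genideal_minimal) auto
  then have "Idl {} <+> Z \<subseteq> Z" using empty by (intro set_add_least) auto
  from order_trans[OF empty(5) satur_mono[OF this]] show ?case using empty by (auto intro!: len_le_0)
next
  case (insert s S)
  have c: "S \<subseteq> carrier R" "s \<in> carrier R" using ideal_subset[OF insert(4)] insert(7) by auto
  let ?K = "Idl S <+> Z"
  have K: "ideal ?K R" using c insert by (intro add_ideals genideal_ideal)
  have u: "Idl S \<subseteq> ?K" "Z \<subseteq> ?K"
    using set_add_le1[OF genideal_ideal[OF c(1)]] set_add_le2[OF genideal_ideal[OF c(1)]] insert by auto
  have l: "len_le R Q ?K Z (card S)"
    by (rule insert(3)[OF K]) (use insert(5,9) u genideal_self[OF c(1)] satur_le[OF Q K] in auto)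
  have "Idl S \<subseteq> U" using insert by (intro genideal_minimal) auto
  then have KU: "?K \<subseteq> U" using insert by (intro set_add_least) auto
  have PI: "ideal (PIdl s) R" "ideal (?K <+> PIdl s) R" using c add_ideals[OF K cgenideal_ideal] cgenideal_ideal by auto
  have "Idl (insert s S) <+> Z \<subseteq> ?K <+> PIdl s"
  proof (rule set_add_least[OF PI(2)])
    have "Idl S <+> PIdl s \<subseteq> ?K <+> PIdl s" using u by (intro set_add_mono) auto
    then show "Idl (insert s S) \<subseteq> ?K <+> PIdl s" using Idl_insert_le[OF c] by blast
    show "Z \<subseteq> ?K <+> PIdl s" using u set_add_le1[OF K PI(1)] by blast
  qed
  from order_trans[OF insert(8) satur_mono[OF this]] have "U \<subseteq> satur R Q (?K <+> PIdl s)" .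
  moreover have "c \<otimes> s \<in> satur R Q ?K" if "c \<in> Q" for c
    using insert(9)[OF _ that, of s] u satur_le[OF Q K] by blast
  ultimately have "len_le R Q U Z (Suc (card S))" using insert(7) KU
    by (intro len_le_Suc[OF l insert(4), of s]) auto
  then show ?case using insert by simp
qed

lemma PIdl_prod_le: "ideal J R \<Longrightarrow> ideal I R \<Longrightarrow> f \<in> I \<Longrightarrow> (PIdl f) \<cdot> J \<subseteq> I \<cdot> J"
  by (intro ideal_prod_mono PIdl_least) auto

end

context noetherian_cring
begin

lemma maximal_ideal_in:
  assumes "S \<noteq> {}" "\<And>I. I \<in> S \<Longrightarrow> ideal I R"
  shows "\<exists>M\<in>S. \<forall>I\<in>S. M \<subseteq> I \<longrightarrow> I = M"
proof (rule subset_Zorn_nonempty[OF assms(1)])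
  fix C assume C: "C \<noteq> {}" "subset.chain S C"
  then have "subset.chain {I. ideal I R} C" using assms(2) by (auto simp: pred_on.chain_def)
  from ideal_chain_is_trivial[OF C(1) this] show "\<Union>C \<in> S" using C(2) unfolding pred_on.chain_def by blast
qed

lemma ideal_induct_up [consumes 1, case_names step]:
  assumes I: "ideal I R"
    and step: "\<And>I. ideal I R \<Longrightarrow> (\<And>I'. ideal I' R \<Longrightarrow> I \<subset> I' \<Longrightarrow> P I') \<Longrightarrow> P I"
  shows "P I"
proof (rule ccontr)
  assume "\<not> P I"
  then obtain M where M: "ideal M R" "\<not> P M" and max: "\<And>I'. ideal I' R \<Longrightarrow> \<not> P I' \<Longrightarrow> M \<subseteq> I' \<Longrightarrow> I' = M"
    using maximal_ideal_in[of "{I. ideal I R \<and> \<not> P I}"] I by blast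
  have "P M" by (rule step[OF M(1)]) (use max in blast)
  then show False using M by simp
qed

text \<open>Among the ideals \<open>(K : m)\<close> with \<open>m \<in> L - K\<close> a maximal one is prime: if \<open>ab\<close> lies in it and \<open>a\<close> does not,
  then \<open>am\<close> is another admissible element whose colon ideal is at least as large and contains \<open>b\<close>.\<close>

lemma associated_prime:
  assumes K: "ideal K R" and L: "ideal L R" "\<not> L \<subseteq> K"
  shows "\<exists>m \<in> L - K. primeideal (colon R K m) R"
proof -
  have Lc: "L \<subseteq> carrier R" using ideal_subset[OF L(1)] .
  have "\<exists>M\<in>colon R K ` (L - K). \<forall>I\<in>colon R K ` (L - K). M \<subseteq> I \<longrightarrow> I = M"
    by (rule maximal_ideal_in) (use L Lc in \<open>auto intro!: colon_ideal K\<close>)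
  then obtain P where P: "P \<in> colon R K ` (L - K)" "\<forall>I\<in>colon R K ` (L - K). P \<subseteq> I \<longrightarrow> I = P"
    by (rule bexE)
  from P(1) obtain m where "P = colon R K m" "m \<in> L - K" by (rule imageE)
  then have m: "m \<in> L" "m \<notin> K"
    and max: "\<And>m'. m' \<in> L \<Longrightarrow> m' \<notin> K \<Longrightarrow> colon R K m \<subseteq> colon R K m' \<Longrightarrow> colon R K m' = colon R K m"
    using P(2) by auto
  have mc: "m \<in> carrier R" using m Lc by blast
  have "primeideal (colon R K m) R"
  proof (rule primeidealI[OF colon_ideal[OF K mc] is_cring])
    show "carrier R \<noteq> colon R K m"

    proof
      assume "carrier R = colon R K m"
      then have "\<one> \<in> colon R K m" using one_closed by blast
      then show False using m mc by (simp add: colon_def)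
    qed
    fix a b assume ab: "a \<in> carrier R" "b \<in> carrier R" "a \<otimes> b \<in> colon R K m"
    show "a \<in> colon R K m \<or> b \<in> colon R K m"
    proof (rule disjCI[THEN disj_commute[THEN iffD1]])
      assume na: "a \<notin> colon R K m"
      then have "a \<otimes> m \<notin> K" using ab by (simp add: colon_def)
      moreover have "a \<otimes> m \<in> L" using ideal_mult[OF L(1) m(1) ab(1)] .
      moreover have "colon R K m \<subseteq> colon R K (a \<otimes> m)"
      proof
        fix x assume x: "x \<in> colon R K m"
        then have "x \<otimes> (a \<otimes> m) = a \<otimes> (x \<otimes> m)" using ab mc by (simp add: colon_def m_lcomm)
        then show "x \<in> colon R K (a \<otimes> m)" using x ideal_mult[OF K _ ab(1)] by (simp add: colon_def)
      qed
      ultimately have "colon R K (a \<otimes> m) = colon R K m" using max by blast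
      moreover have "b \<in> colon R K (a \<otimes> m)"
      proof -
        have "b \<otimes> (a \<otimes> m) = (a \<otimes> b) \<otimes> m" using ab mc by (simp add: m_ac)
        then show ?thesis using ab by (simp add: colon_def)
      qed
      ultimately show "b \<in> colon R K m" by simp
    qed
  qed
  then show ?thesis using m by blast
qed

lemma prime_filt_exists:
  assumes M: "ideal M R" and "ideal N R" "N \<subseteq> M"
  shows "prime_filt R M N"
  using assms(2,3)
proof (induct N rule: ideal_induct_up)
  case (step N)
  show ?case
  proof (cases "M \<subseteq> N")
    case True
    then have "N = M" using step(3) by blast
    then show ?thesis using M by (simp add: prime_filt_top)
  next
    case False
    then obtain m where m: "m \<in> M - N" "primeideal (colon R N m) R"
      using associated_prime[OF step(1) M] by blast
    have mc: "m \<in> carrier R" using m M ideal_subset by blast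
    have P: "ideal (PIdl m) R" using cgenideal_ideal[OF mc] .
    have "N \<subseteq> N <+> PIdl m" "PIdl m \<subseteq> N <+> PIdl m"
      using set_add_le1[OF step(1) P] set_add_le2[OF step(1) P] .
    then have "N \<subset> N <+> PIdl m" using m cgenideal_self[OF mc] by blast
    moreover have "N <+> PIdl m \<subseteq> M" using step(3) m M by (intro set_add_least PIdl_least) auto
    ultimately have "prime_filt R M (N <+> PIdl m)" using step(2)[OF add_ideals[OF step(1) P]] by blast
    then show ?thesis by (rule prime_filt_step) (use step m in auto)
  qed
qed

text \<open>The inequality of Krull and Akizuki: the length of \<open>J/fJ\<close> in the one-dimensional domain \<open>R/p\<close> is at most that of
  \<open>(R/p)/f\<close>. Take \<open>J\<close> maximal among the ideals for which this is not known. If \<open>J\<^sub>Q\<close> is proper, then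
  \<open>R/J\<close> has at \<open>Q\<close> an element \<open>m\<close> whose annihilator is a prime strictly above \<open>p\<close>, which must be \<open>Q\<close>.
  For \<open>H = J + (m)\<close> both \<open>H/J\<close> and \<open>fH/fJ\<close> have length at most one and the first is not zero, hence passing
  from \<open>H/fH\<close> to \<open>J/fJ\<close> does not increase the length.\<close>

lemma krull_akizuki:
  assumes Q: "primeideal Q R" and p: "ideal p R"
    and dim: "\<And>P. primeideal P R \<Longrightarrow> p \<subset> P \<Longrightarrow> P \<subseteq> Q \<Longrightarrow> P = Q"
    and f: "f \<in> carrier R"
    and l: "len_le R Q (carrier R) (PIdl f <+> p) l"
    and J: "ideal J R" "p \<subset> J"
  shows "len_le R Q J (((PIdl f) \<cdot> J) <+> p) l"
  using J
proof (induct J rule: ideal_induct_up)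
  case (step J)
  note iJ = step(1)
  have Pf: "ideal (PIdl f) R" using cgenideal_ideal[OF f] .
  let ?Z = "\<lambda>J. ((PIdl f) \<cdot> J) <+> p"
  have iZ: "ideal (?Z H) R" if "ideal H R" for H using that Pf p by (intro add_ideals ideal_prod_is_ideal)
  have Zle: "?Z H \<subseteq> H" if "ideal H R" "p \<subseteq> H" for H
    using that Pf ideal_prod_le2[OF Pf] by (intro set_add_least) auto
  have ZI: "f \<otimes> h \<in> ?Z H" if "ideal H R" "h \<in> H" for h H
  proof -
    have "f \<otimes> h \<in> (PIdl f) \<cdot> H" using that PIdl_prod_iff[OF that(1) f] by blast
    then show ?thesis using set_add_le1[OF ideal_prod_is_ideal[OF Pf that(1)] p] by blast
  qed
  have pZ: "p \<subseteq> ?Z H" if "ideal H R" for H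
    using set_add_le2[OF ideal_prod_is_ideal[OF Pf that] p] .
  have sJ: "ideal (satur R Q J) R" "J \<subseteq> satur R Q J"
    using satur_ideal[OF Q iJ] satur_le[OF Q iJ] .
  have sZ: "ideal (satur R Q (?Z J)) R" "?Z J \<subseteq> satur R Q (?Z J)"
    using satur_ideal[OF Q iZ[OF iJ]] satur_le[OF Q iZ[OF iJ]] .
  have fs: "f \<otimes> s \<in> satur R Q (?Z J)" if "s \<in> satur R Q J" for s
  proof -
    from that obtain a where a: "a \<in> carrier R" "a \<notin> Q" "a \<otimes> s \<in> J" "s \<in> carrier R" by (rule saturE)
    have "a \<otimes> (f \<otimes> s) \<in> ?Z J" using ZI[OF iJ a(3)] a f by (simp add: m_lcomm)
    then show ?thesis using a f by (intro saturI[of a]) auto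
  qed
  show ?case
  proof (cases "carrier R \<subseteq> satur R Q J")
    case True
    \<comment> \<open>as \<open>J\<close> is the unit ideal at \<open>Q\<close>, the ideals \<open>f J\<close> and \<open>(f)\<close> agree there\<close>
    have "PIdl f <+> p \<subseteq> satur R Q (?Z J)"
    proof (rule set_add_least[OF sZ(1)])
      have "f \<otimes> \<one> \<in> satur R Q (?Z J)" using fs True by blast
      then show "PIdl f \<subseteq> satur R Q (?Z J)" using sZ(1) f by (intro PIdl_least) auto
      show "p \<subseteq> satur R Q (?Z J)" using pZ[OF iJ] sZ(2) by blast
    qed
    moreover have "?Z J \<subseteq> PIdl f <+> p" using ideal_prod_inter[OF Pf iJ] by (intro set_add_mono) auto
    ultimately have "len_le R Q (PIdl f <+> p) (?Z J) 0"
      using add_ideals[OF Pf p] iZ[OF iJ] by (intro len_le_0)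
    from len_le_sub[OF Q len_le_trans[OF l this Q] iJ Zle[OF iJ] ideal_subset[OF iJ]] step(3)
    show ?thesis by auto
  next
    case False
    then obtain m where m: "m \<in> carrier R" "m \<notin> satur R Q J" "primeideal (colon R (satur R Q J) m) R"
      using associated_prime[OF sJ(1) oneideal] by blast
    let ?P = "colon R (satur R Q J) m"
    have "satur R Q J \<subseteq> ?P" using m ideal.I_r_closed[OF sJ(1)] ideal_subset[OF sJ(1)]
      by (auto simp: colon_def)
    then have "p \<subset> ?P" using step(3) sJ(2) by blast
    moreover have "?P \<subseteq> Q" using m satur_absorb[OF Q _ m(1)] by (auto simp: colon_def)
    ultimately have PQ: "?P = Q" using dim m(3) by blast
    let ?H = "satur R Q J <+> PIdl m"
    have Pm: "ideal (PIdl m) R" using cgenideal_ideal[OF m(1)] .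
    have iH: "ideal ?H R" using sJ(1) Pm by (rule add_ideals)
    have HJ: "satur R Q J \<subseteq> ?H" "PIdl m \<subseteq> ?H"
      using set_add_le1[OF sJ(1) Pm] set_add_le2[OF sJ(1) Pm] .
    have mH: "m \<in> ?H" using HJ cgenideal_self[OF m(1)] by blast
    have JH: "J \<subset> ?H" using HJ sJ mH m(2) by blast
    have lH: "len_le R Q ?H (?Z ?H) l" using step(2)[OF iH JH] step(3) JH by blast
    have le: "?Z J \<subseteq> ?Z ?H" using JH by (intro set_add_mono ideal_prod_mono) auto
    have "len_le R Q (?Z ?H) (?Z J) (Suc 0)"
    proof (rule len_le_Suc[OF len_le_0[OF iZ[OF iJ] iZ[OF iJ] subset_refl sZ(2)] iZ[OF iH] le])
      show "f \<otimes> m \<in> ?Z ?H" using ZI[OF iH mH] .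
      fix c assume "c \<in> Q"
      then have c: "c \<in> carrier R" "c \<otimes> m \<in> satur R Q J" using equalityD2[OF PQ] by (auto simp: colon_def)
      then show "c \<otimes> (f \<otimes> m) \<in> satur R Q (?Z J)" using fs[OF c(2)] f m by (simp add: m_lcomm)
    next
      let ?T = "?Z J <+> PIdl (f \<otimes> m)"
      have Pfm: "ideal (PIdl (f \<otimes> m)) R" using cgenideal_ideal f m by simp
      have T: "ideal ?T R" using iZ[OF iJ] Pfm by (rule add_ideals)
      have sT: "ideal (satur R Q ?T) R" using satur_ideal[OF Q T] .
      have u1: "satur R Q (?Z J) \<subseteq> satur R Q ?T"
        by (intro satur_mono set_add_upper1 ideal_subset iZ iJ Pfm)
      have u2: "f \<otimes> m \<in> satur R Q ?T"
        using satur_le[OF Q T] set_add_le2[OF iZ[OF iJ] Pfm]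
          cgenideal_self[of "f \<otimes> m"] f m by blast
      have "(PIdl f) \<cdot> ?H \<subseteq> satur R Q ?T"
      proof
        fix x assume "x \<in> (PIdl f) \<cdot> ?H"
        then obtain h where "h \<in> ?H" "x = f \<otimes> h" using PIdl_prod_iff[OF iH f] by blast
        then obtain s d where s: "s \<in> satur R Q J" "d \<in> carrier R" "x = f \<otimes> (s \<oplus> d \<otimes> m)"
          by (auto simp: PIdl_iff elim!: set_addE)
        have "s \<in> carrier R" using s ideal_subset[OF sJ(1)] by blast
        then have x: "x = f \<otimes> s \<oplus> d \<otimes> (f \<otimes> m)" unfolding s(3) using s(2) f m(1) by algebra
        show "x \<in> satur R Q ?T" unfolding x
          using fs[OF s(1)] u1 ideal_mult[OF sT u2 s(2)] by (intro ideal_add[OF sT]) auto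
      qed
      moreover have "p \<subseteq> satur R Q ?T" using pZ[OF iJ] sZ u1 by blast
      ultimately show "?Z ?H \<subseteq> satur R Q ?T" by (intro set_add_least[OF sT])
    qed
    from len_le_trans[OF lH this Q] have "len_le R Q ?H (?Z J) (Suc l)" by simp
    from len_le_sub[OF Q this iJ Zle[OF iJ]] JH step(3)
    have "?H \<subseteq> satur R Q J \<or> len_le R Q J (?Z J) l" by auto
    then show ?thesis using m(2) mH by blast
  qed
qed

text \<open>The factors of a prime filtration of \<open>R/(f, p)\<close> are \<open>R/P\<close> with \<open>P\<close> strictly above \<open>p\<close>. At a prime \<open>Q\<close> such a
  factor is the residue field of \<open>Q\<close> if \<open>P = Q\<close> and vanishes otherwise, because the dimension leaves no room for
  \<open>P\<close> strictly inside \<open>Q\<close>. So the number of factors is a bound for the length that does not depend on \<open>Q\<close>.\<close>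

lemma len_le_above_hypersurface:
  assumes p: "primeideal p R" and f: "f \<in> carrier R" "f \<notin> p"
    and dim: "\<And>P Q. primeideal P R \<Longrightarrow> primeideal Q R \<Longrightarrow> p \<subset> P \<Longrightarrow> P \<subseteq> Q \<Longrightarrow> P = Q"
  shows "\<exists>l. \<forall>Q. primeideal Q R \<longrightarrow> len_le R Q (carrier R) (PIdl f <+> p) l"
proof -
  have ip: "ideal p R" using prime_ideal[OF p] .
  have Pf: "ideal (PIdl f) R" using cgenideal_ideal[OF f(1)] .
  have "f \<in> PIdl f <+> p" "p \<subseteq> PIdl f <+> p"
    using set_add_le1[OF Pf ip] set_add_le2[OF Pf ip]
      cgenideal_self[OF f(1)] by blast+
  moreover have "prime_filt R (carrier R) (PIdl f <+> p)"
    using add_ideals[OF Pf ip] by (intro prime_filt_exists oneideal ideal_subset)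
  moreover have "\<exists>l. \<forall>Q. primeideal Q R \<longrightarrow> len_le R Q (carrier R) K l"
    if "prime_filt R (carrier R) K" "f \<in> K" "p \<subseteq> K" for K
    using that
  proof (induct rule: prime_filt.induct)
    case prime_filt_top
    then show ?case using satur_upper[OF _ subset_refl] by (auto intro!: exI[of _ 0] len_le_0)
  next
    case (prime_filt_step K m)
    have Pm: "ideal (PIdl m) R" using cgenideal_ideal[OF prime_filt_step(5)] .
    let ?H = "K <+> PIdl m" and ?P = "colon R K m"
    note K = prime_filt_step(3)
    have H: "ideal ?H R" using add_ideals[OF K Pm] .
    have KH: "K \<subseteq> ?H" using set_add_le1[OF K Pm] .
    have mH: "m \<in> ?H" using set_add_le2[OF K Pm] cgenideal_self[OF prime_filt_step(5)] by blast
    obtain l where l: "\<And>Q. primeideal Q R \<Longrightarrow> len_le R Q (carrier R) ?H l"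
      using prime_filt_step KH by blast
    have KP: "K \<subseteq> ?P" using ideal.I_r_closed[OF K] ideal_subset[OF K] prime_filt_step(5)
      by (auto simp: colon_def)
    then have pP: "p \<subset> ?P" using prime_filt_step f by blast
    have "len_le R Q (carrier R) K (l + Suc 0)" if Q: "primeideal Q R" for Q
    proof (rule len_le_trans[OF l[OF Q] _ Q])
      have sK: "K \<subseteq> satur R Q K" "ideal (satur R Q K) R"
        using satur_le[OF Q K] satur_ideal[OF Q K] .
      have sH: "?H \<subseteq> satur R Q ?H" using satur_le[OF Q H] .
      have "c \<otimes> m \<in> satur R Q K" if c: "c \<in> Q" for c
      proof (cases "?P \<subseteq> Q")
        case True
        then have "?P = Q" using dim[OF prime_filt_step(6) Q pP] by simp
        then have "c \<otimes> m \<in> K" using c by (auto simp: colon_def)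
        then show ?thesis using sK by blast
      next
        case False
        then obtain a where "a \<in> carrier R" "a \<notin> Q" "a \<otimes> m \<in> K" by (auto simp: colon_def)
        then have "m \<in> satur R Q K" using prime_filt_step(5) by (intro saturI[of a]) auto
        then show ?thesis using c ideal_subset[OF prime_ideal[OF Q]] by (intro ideal_mult[OF sK(2)]) auto
      qed
      then show "len_le R Q ?H K (Suc 0)"
        by (intro len_le_Suc[OF len_le_0[OF K K subset_refl sK(1)] H KH mH] sH)
    qed
    then show ?case by blast
  qed
  ultimately show ?thesis by blast
qed

text \<open>Where \<open>f\<close> does not vanish the local ring of \<open>R/p\<close> has a principal maximal ideal, and the inequality of Krull and
  Akizuki with its generator gives one generator for each ideal. The primes containing \<open>f\<close> are covered
  by the same inequality with \<open>f\<close> itself.\<close>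

lemma loc_gen_bound_exists:
  assumes p: "primeideal p R" and f: "f \<in> carrier R" "f \<notin> p"
    and dim: "\<And>P Q. primeideal P R \<Longrightarrow> primeideal Q R \<Longrightarrow> p \<subset> P \<Longrightarrow> P \<subseteq> Q \<Longrightarrow> P = Q"
    and gen: "\<And>Q. primeideal Q R \<Longrightarrow> p \<subseteq> Q \<Longrightarrow> f \<notin> Q \<Longrightarrow> \<exists>g\<in>Q. Q \<subseteq> satur R Q (PIdl g <+> p)"
  shows "\<exists>e. loc_gen_bound R p e"
proof -
  have ip: "ideal p R" using prime_ideal[OF p] .
  obtain l where l: "\<And>Q. primeideal Q R \<Longrightarrow> len_le R Q (carrier R) (PIdl f <+> p) l"
    using len_le_above_hypersurface[OF p f dim] by blast
  have "\<exists>S \<subseteq> J. finite S \<and> card S \<le> Suc l \<and> J \<subseteq> satur R Q (Idl S <+> ((Q \<cdot> J) <+> p))"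
    if Q: "primeideal Q R" and J: "ideal J R" "p \<subseteq> J" for Q J
  proof -
    have iQ: "ideal Q R" using prime_ideal[OF Q] .
    have iQJ: "ideal ((Q \<cdot> J) <+> p) R" using iQ J ip by (intro ideal_ops)
    have pQJ: "p \<subseteq> (Q \<cdot> J) <+> p" using set_add_le2[OF ideal_prod_is_ideal[OF iQ J(1)] ip] .
    have up: "satur R Q ((Q \<cdot> J) <+> p) \<subseteq> satur R Q (Idl {} <+> ((Q \<cdot> J) <+> p))"
      by (intro satur_mono set_add_le2 iQJ genideal_ideal) auto
    have trivial: ?thesis if "J \<subseteq> satur R Q ((Q \<cdot> J) <+> p)"
      by (rule exI[of _ "{}"]) (use up that in auto)
    have bound: ?thesis if g: "g \<in> Q" and "p \<subset> J" "p \<subset> Q" and "len_le R Q (carrier R) (PIdl g <+> p) n" "n \<le> Suc l" for g n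
    proof -
      have gc: "g \<in> carrier R" using g ideal_subset[OF iQ] by blast
      have "len_le R Q J (((PIdl g) \<cdot> J) <+> p) n"
        by (rule krull_akizuki[OF Q ip _ gc that(4) J(1) that(2)]) (use dim Q in blast)
      from len_le_gens[OF Q this] obtain S where S: "S \<subseteq> J" "finite S" "card S \<le> n"
        "J \<subseteq> satur R Q (Idl S <+> (((PIdl g) \<cdot> J) <+> p))" by blast
      have "Idl S <+> (((PIdl g) \<cdot> J) <+> p) \<subseteq> Idl S <+> ((Q \<cdot> J) <+> p)"
        by (intro set_add_mono PIdl_prod_le subset_refl J iQ g)
      from order_trans[OF S(4) satur_mono[OF this]] show ?thesis using S that(5) by (intro exI[of _ S]) auto
    qed
    consider "\<not> p \<subseteq> Q" | "J = p" | "p = Q" "p \<subset> J" | "p \<subset> Q" "p \<subset> J" using J by blast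
    then show ?thesis
    proof cases
      case 1
      then obtain a where a: "a \<in> p" "a \<notin> Q" "a \<in> carrier R" using ideal_subset[OF ip] by blast
      have "J \<subseteq> satur R Q ((Q \<cdot> J) <+> p)"
      proof
        fix x assume "x \<in> J"
        then have x: "x \<in> carrier R" using ideal_subset[OF J(1)] by blast
        then have "a \<otimes> x \<in> p" using ideal_mult[OF ip a(1) x] a x by (simp add: m_comm)
        then show "x \<in> satur R Q ((Q \<cdot> J) <+> p)" using a x pQJ by (intro saturI[of a]) auto
      qed
      then show ?thesis by (rule trivial)
    next
      case 2
      have "J \<subseteq> satur R Q ((Q \<cdot> J) <+> p)" using pQJ 2 by (intro satur_leI[OF Q] ideal_subset[OF J(1)]) auto
      then show ?thesis by (rule trivial)
    next
      case 3
      then obtain j where j: "j \<in> J" "j \<notin> Q" by blast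
      have jc: "j \<in> carrier R" using j ideal_subset[OF J(1)] by blast
      have "J \<subseteq> satur R Q (Idl {j} <+> ((Q \<cdot> J) <+> p))"
      proof
        fix x assume "x \<in> J"
        then have x: "x \<in> carrier R" using ideal_subset[OF J(1)] by blast
        have "j \<otimes> x \<in> Idl {j}" using ideal_mult[OF genideal_ideal genideal_self'[OF jc] x] jc x by (simp add: m_comm)
        then have "j \<otimes> x \<in> Idl {j} <+> ((Q \<cdot> J) <+> p)"
          using set_add_le1[OF genideal_ideal iQJ, of "{j}"] jc by blast
        then show "x \<in> satur R Q (Idl {j} <+> ((Q \<cdot> J) <+> p))" using j jc x by (intro saturI[of j]) auto
      qed
      then show ?thesis using j by (intro exI[of _ "{j}"]) auto
    next
      case 4
      show ?thesis
      proof (cases "f \<in> Q")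
        case True
        show ?thesis by (rule bound[OF True 4(2,1) l[OF Q]]) simp
      next
        case False
        then obtain g where g: "g \<in> Q" "Q \<subseteq> satur R Q (PIdl g <+> p)" using gen[OF Q] 4 by blast
        have gc: "g \<in> carrier R" using g ideal_subset[OF iQ] by blast
        let ?K = "PIdl g <+> p"
        have K: "ideal ?K R" using ip gc by (intro ideal_ops)
        have "len_le R Q (carrier R) ?K (Suc 0)"
        proof (rule len_le_Suc[OF len_le_0[OF K K subset_refl] oneideal ideal_subset[OF K] one_closed])
          show "c \<otimes> \<one> \<in> satur R Q ?K" if "c \<in> Q" for c
            using that g(2) ideal_subset[OF iQ] by (auto simp: subset_iff)
          have P1: "ideal (PIdl \<one>) R" by (intro cgenideal_ideal) simp
          have "carrier R \<subseteq> PIdl \<one>" by (auto simp: PIdl_iff)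
          then have "carrier R \<subseteq> ?K <+> PIdl \<one>" using set_add_le2[OF K P1] by blast
          then show "carrier R \<subseteq> satur R Q (?K <+> PIdl \<one>)"
            by (rule satur_leI[OF Q subset_refl])
          show "?K \<subseteq> satur R Q ?K" using satur_le[OF Q K] .
        qed
        from bound[OF g(1) 4(2,1) this] show ?thesis by simp
      qed
    qed
  qed
  then show ?thesis unfolding loc_gen_bound_def by blast
qed

end


section \<open>General elements as reductions\<close>

fun horner :: "('a, 'b) ring_scheme \<Rightarrow> 'a list \<Rightarrow> 'a \<Rightarrow> 'a" where
  "horner R [] t = \<zero>\<^bsub>R\<^esub>"
| "horner R (x # xs) t = x \<oplus>\<^bsub>R\<^esub> t \<otimes>\<^bsub>R\<^esub> horner R xs t"

text \<open>The coefficients of the quotient of the polynomial with coefficients \<open>ws\<close> by \<open>T - t\<close>; see \<open>horner_synth_div\<close>.\<close>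

fun synth_div :: "('a, 'b) ring_scheme \<Rightarrow> 'a list \<Rightarrow> 'a \<Rightarrow> 'a list" where
  "synth_div R (w # v # ws) t = horner R (v # ws) t # synth_div R (v # ws) t"
| "synth_div R ws t = []"

context cring
begin

lemma add_minus_cancel: "x \<in> carrier R \<Longrightarrow> r \<in> carrier R \<Longrightarrow> (x \<oplus> r) \<ominus> r = x"
  by algebra

lemma horner_closed [simp]: "set ws \<subseteq> carrier R \<Longrightarrow> t \<in> carrier R \<Longrightarrow> horner R ws t \<in> carrier R"
  by (induct ws) auto

lemma horner_in_ideal: "ideal I R \<Longrightarrow> set ws \<subseteq> I \<Longrightarrow> t \<in> carrier R \<Longrightarrow> horner R ws t \<in> I"
  by (induct ws) (auto intro: ideal_zero ideal_add ideal_mult)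

lemma horner_map: "set ws \<subseteq> carrier R \<Longrightarrow> t \<in> carrier R \<Longrightarrow> v \<in> carrier R \<Longrightarrow>
    horner R (map (\<lambda>x. x \<otimes> v) ws) t = horner R ws t \<otimes> v"
  by (induct ws) (auto simp: l_distr m_assoc)

lemma synth_div_closed: "set ws \<subseteq> carrier R \<Longrightarrow> t \<in> carrier R \<Longrightarrow> set (synth_div R ws t) \<subseteq> carrier R"
proof (induct ws)
  case (Cons w ws)
  then show ?case by (cases ws) auto
qed simp

lemma length_synth_div: "length (synth_div R ws t) = length ws - 1"
  by (induct R ws t rule: synth_div.induct) auto

lemma horner_synth_div:
  assumes "set ws \<subseteq> carrier R" "t \<in> carrier R" "s \<in> carrier R"
  shows "horner R ws s \<ominus> horner R ws t = (s \<ominus> t) \<otimes> horner R (synth_div R ws t) s"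
  using assms(1)
proof (induct ws)
  case Nil
  then show ?case using assms by (simp add: a_minus_def)
next
  case (Cons w ws)
  show ?case
  proof (cases ws)
    case Nil
    then show ?thesis using assms Cons by (simp add: r_neg a_minus_def)
  next
    case (Cons v vs)
    have c: "w \<in> carrier R" "set ws \<subseteq> carrier R" using Cons.prems by auto
    define h where "h = horner R ws s"
    define k where "k = horner R ws t"
    define q where "q = horner R (synth_div R ws t) s"
    have hk: "h \<in> carrier R" "k \<in> carrier R" "q \<in> carrier R"
      using c assms synth_div_closed[OF c(2) assms(2)] by (auto simp: h_def k_def q_def)
    have IH: "h \<ominus> k = (s \<ominus> t) \<otimes> q" using Cons.hyps c by (simp add: h_def k_def q_def)
    have "h = k \<oplus> (h \<ominus> k)" using hk(1,2) by algebra
    then have h: "h = k \<oplus> (s \<ominus> t) \<otimes> q" using IH by simp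
    have "(w \<oplus> s \<otimes> h) \<ominus> (w \<oplus> t \<otimes> k) = (s \<ominus> t) \<otimes> (k \<oplus> s \<otimes> q)"
      unfolding h using hk(2,3) c(1) assms(2,3) by algebra
    then show ?thesis by (simp add: Cons flip: h_def k_def q_def) (simp add: h_def k_def q_def Cons)
  qed
qed

lemma synth_div_ideal:
  assumes W: "ideal W R" and t: "t \<in> carrier R"
    and "set ws \<subseteq> carrier R" "horner R ws t \<in> W" "set (synth_div R ws t) \<subseteq> W"
  shows "set ws \<subseteq> W"
  using assms(3-)
proof (induct ws)
  case (Cons w ws)
  have k: "horner R ws t \<in> W"
    using Cons(4) ideal_zero[OF W] by (cases ws) auto
  have "set ws \<subseteq> W"
  proof (rule Cons(1))
    show "set (synth_div R ws t) \<subseteq> W" using Cons(4) by (cases ws) auto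
  qed (use Cons(2) k in auto)
  moreover have "w = (w \<oplus> t \<otimes> horner R ws t) \<ominus> t \<otimes> horner R ws t"
    using Cons(2) t ideal_subset[OF W] k by (auto simp: a_minus_def a_assoc r_neg)
  moreover have "(w \<oplus> t \<otimes> horner R ws t) \<ominus> t \<otimes> horner R ws t \<in> W"
    using Cons(3) ideal_mult[OF W k t] by (intro ideal_minus[OF W]) auto
  ultimately show ?case by auto
qed simp

text \<open>A polynomial over \<open>R/W\<close> with more roots than its degree vanishes if the differences of the roots
  are no zero divisors. Here they are units at \<open>Q\<close>, and \<open>W\<close> is saturated at \<open>Q\<close>.\<close>

lemma vandermonde:
  assumes W: "ideal W R" and abs: "\<And>a x. a \<in> carrier R \<Longrightarrow> a \<notin> Q \<Longrightarrow> x \<in> carrier R \<Longrightarrow> a \<otimes> x \<in> W \<Longrightarrow> x \<in> W"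
    and "finite T" "T \<subseteq> carrier R" "length ws \<le> card T" "set ws \<subseteq> carrier R"
    and "\<And>s t. s \<in> T \<Longrightarrow> t \<in> T \<Longrightarrow> s \<noteq> t \<Longrightarrow> s \<ominus> t \<notin> Q"
    and "\<And>t. t \<in> T \<Longrightarrow> horner R ws t \<in> W"
  shows "set ws \<subseteq> W"
  using assms(3-)
proof (induct T arbitrary: ws)
  case (insert t T)
  have c: "t \<in> carrier R" "T \<subseteq> carrier R" using insert(4) by auto
  let ?d = "synth_div R ws t"
  have dc: "set ?d \<subseteq> carrier R" using synth_div_closed[OF insert(6) c(1)] .
  have "set ?d \<subseteq> W"
  proof (rule insert(3)[OF c(2) _ dc])
    show "length ?d \<le> card T" using insert(1,2,5) by (simp add: length_synth_div)
    fix s assume s: "s \<in> T"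
    then have sc: "s \<in> carrier R" and st: "s \<noteq> t" using c insert(2) by auto
    have "horner R ws s \<ominus> horner R ws t \<in> W" using insert(8) s by (intro ideal_minus[OF W]) auto
    then have "(s \<ominus> t) \<otimes> horner R ?d s \<in> W" using horner_synth_div[OF insert(6) c(1) sc] by simp
    then show "horner R ?d s \<in> W"
      using abs[of "s \<ominus> t"] insert(7)[of s t] s st sc c(1) dc by simp
  qed (use insert(7) in auto)
  then show ?case using insert(8)[of t] by (intro synth_div_ideal[OF W c(1) insert(6)]) auto
qed simp

text \<open>A form of the theorem of Eakin and Sathaye. The elements \<open>y\<^sub>j = \<Sum> \<lambda>\<^sub>j\<^sup>i x\<^sub>i\<close> play the role of general elements
  of \<open>J = (x\<^sub>0, \<dots>, x\<^sub>r)\<close>. If \<open>J\<^sup>n V/Z\<close> has length at most \<open>n\<close> at \<open>Q\<close>, then all but finitely many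
  of them satisfy \<open>J\<^sup>n V = y\<^sub>j J\<^sup>n\<^sup>-\<^sup>1 V\<close> modulo \<open>Z\<close> at \<open>Q\<close>.

  If \<open>y\<^sub>m\<close> violates this, then \<open>y\<^sub>m J\<^sup>n\<^sup>-\<^sup>1 V\<close> is strictly smaller than \<open>J\<^sup>n V\<close> and has length at most \<open>n - 1\<close>.
  By induction, applied to \<open>y\<^sub>m V\<close>, almost every \<open>y\<^sub>l\<close> satisfies
  \<open>y\<^sub>m J\<^sup>n\<^sup>-\<^sup>1 V = y\<^sub>l y\<^sub>m J\<^sup>n\<^sup>-\<^sup>2 V \<subseteq> y\<^sub>l J\<^sup>n\<^sup>-\<^sup>1 V\<close>. With infinitely many violating indices, one such \<open>l\<close> serves
  \<open>r + 1\<close> violating \<open>m\<close> simultaneously and is itself violating. The Vandermonde argument then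
  puts every \<open>x\<^sub>i J\<^sup>n\<^sup>-\<^sup>1 V\<close> into \<open>y\<^sub>l J\<^sup>n\<^sup>-\<^sup>1 V\<close>, a contradiction. In length zero the condition degenerates to \<open>V = 0\<close>.\<close>

lemma reduction_cofinite:
  assumes Q: "primeideal Q R" and xs: "set xs \<subseteq> carrier R" and J: "J = Idl (set xs)"
    and lam: "\<And>i. lam i \<in> carrier R" "\<And>i j :: nat. i \<noteq> j \<Longrightarrow> lam i \<ominus> lam j \<notin> Q"
    and Z: "ideal Z R"
  defines "y \<equiv> \<lambda>j. horner R xs (lam j)"
  defines "bad \<equiv> \<lambda>V k j. \<not> pow_prod R J (Suc k) V \<subseteq> satur R Q (((PIdl (y j)) \<cdot> pow_prod R J k V) <+> Z)"
  assumes "ideal V R" and "len_le R Q (pow_prod R J n V <+> Z) Z n"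
  shows "case n of 0 \<Rightarrow> V \<subseteq> satur R Q Z | Suc k \<Rightarrow> finite {j. bad V k j}"
  using assms(9,10)
proof (induct n arbitrary: V)
  case 0
  from 0(2) have "V <+> Z \<subseteq> satur R Q Z" by (cases rule: len_le.cases) auto
  then show ?case using set_add_le1[OF 0(1) Z] by auto
next
  case (Suc k)
  have iJ: "ideal J R" unfolding J using xs by (rule genideal_ideal)
  have xJ: "set xs \<subseteq> J" unfolding J using xs by (rule genideal_self)
  have yJ: "y j \<in> J" for j unfolding y_def using iJ xJ lam by (intro horner_in_ideal)
  have yc: "y j \<in> carrier R" for j using yJ ideal_subset[OF iJ] by blast
  have Py: "ideal (PIdl (y j)) R" for j using cgenideal_ideal[OF yc] .
  have PyJ: "PIdl (y j) \<subseteq> J" for j using PIdl_least[OF iJ yJ] .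
  note V = Suc(2)
  let ?V = "\<lambda>j. (PIdl (y j)) \<cdot> V"
  have iV: "ideal (?V j) R" for j using Py V by (rule ideal_prod_is_ideal)
  have iJV: "ideal (pow_prod R J i W) R" if "ideal W R" for i W using iJ that by (rule pow_prod_ideal)
  have JV: "pow_prod R J i (?V j) = (PIdl (y j)) \<cdot> pow_prod R J i V" for i j
    using pow_prod_comm[OF Py iJ V] .
  have VJ: "?V j \<subseteq> J \<cdot> V" for j using PyJ by (intro ideal_prod_mono subset_refl)
  have "finite {j. bad V k j}"
  proof (rule ccontr)
    assume inf: "infinite {j. bad V k j}"
    have len: "len_le R Q (pow_prod R J k (?V m) <+> Z) Z k" if m: "bad V k m" for m
    proof -
      let ?U = "pow_prod R J (Suc k) V <+> Z" and ?Y = "pow_prod R J k (?V m) <+> Z"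
      have iY: "ideal ?Y R" using add_ideals[OF iJV[OF iV] Z] .
      have "?Y \<subseteq> ?U" unfolding JV pow_prod_Suc by (intro set_add_mono ideal_prod_mono PyJ subset_refl)
      moreover have "\<not> ?U \<subseteq> satur R Q ?Y"
        using m set_add_le1[OF iJV[OF V] Z, of "Suc k"] unfolding bad_def JV by blast
      ultimately show ?thesis
        using len_le_sub[OF Q Suc(3) iY set_add_le2[OF iJV[OF iV] Z]] by auto
    qed
    \<comment> \<open>as many bad indices as there are generators, for the Vandermonde argument\<close>
    obtain M where M: "M \<subseteq> {j. bad V k j}" "finite M" "card M = length xs"
      using infinite_arbitrarily_large[OF inf] by blast
    let ?F = "\<Union>m\<in>M. {j. \<exists>i. k = Suc i \<and> bad (?V m) i j}"
    have "finite ?F"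
    proof (rule finite_UN_I[OF M(2)])
      fix m assume "m \<in> M"
      then have "case k of 0 \<Rightarrow> ?V m \<subseteq> satur R Q Z | Suc i \<Rightarrow> finite {j. bad (?V m) i j}"
        using Suc(1)[OF iV len] M(1) by blast
      then show "finite {j. \<exists>i. k = Suc i \<and> bad (?V m) i j}" by (cases k) auto
    qed
    then have "infinite ({j. bad V k j} - ?F)"
      using inf by (rule Diff_infinite_finite)
    then obtain l where l: "bad V k l" "\<And>m i. m \<in> M \<Longrightarrow> k = Suc i \<Longrightarrow> \<not> bad (?V m) i l"
    proof -
      assume "infinite ({j. bad V k j} - ?F)"
      from infinite_imp_nonempty[OF this] obtain l
        where "l \<in> {j. bad V k j} - ?F" by (meson ex_in_conv)
      then show thesis by (intro that[of l]) auto
    qed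
    define T where "T = ((PIdl (y l)) \<cdot> pow_prod R J k V) <+> Z"
    have iT: "ideal T R" unfolding T_def using add_ideals[OF ideal_prod_is_ideal[OF Py iJV[OF V]] Z] .
    define W where "W = satur R Q T"
    have iW: "ideal W R" unfolding W_def using satur_ideal[OF Q iT] .
    have VW: "pow_prod R J k (?V m) \<subseteq> W" if m: "m \<in> M" for m
    proof (cases k)
      case 0
      then have "?V m \<subseteq> satur R Q Z" using Suc(1)[OF iV len, of m] m M(1) by auto
      also have "\<dots> \<subseteq> W" unfolding W_def T_def
        using set_add_le2[OF ideal_prod_is_ideal[OF Py iJV[OF V]] Z] by (intro satur_mono)
      finally show ?thesis using 0 by simp
    next
      case k: (Suc i)
      have "pow_prod R J k (?V m) \<subseteq> satur R Q (((PIdl (y l)) \<cdot> pow_prod R J i (?V m)) <+> Z)"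
        using l(2)[OF m k] unfolding bad_def k by simp
      also have "\<dots> \<subseteq> W"
      proof -
        have "pow_prod R J i (?V m) \<subseteq> pow_prod R J k V"
          unfolding k JV pow_prod_Suc using PyJ by (intro ideal_prod_mono subset_refl)
        then show ?thesis unfolding W_def T_def
          by (intro satur_mono set_add_mono ideal_prod_mono subset_refl)
      qed
      finally show ?thesis .
    qed
    have inj: "inj_on lam M"
    proof (rule inj_onI, rule ccontr)
      fix i j assume "lam i = lam j" "i \<noteq> j"
      then show False using lam(2)[of i j] lam(1)[of j] ideal_zero[OF prime_ideal[OF Q]] by (simp add: a_minus_def r_neg)
    qed
    have "J \<cdot> pow_prod R J k V \<subseteq> W"
    proof (rule ideal_prod_least[OF iW])
      fix c v assume c: "c \<in> J" and v: "v \<in> pow_prod R J k V"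
      have vc: "v \<in> carrier R" using v ideal_subset[OF iJV[OF V]] by blast
      have "set (map (\<lambda>x. x \<otimes> v) xs) \<subseteq> W"
      proof (rule vandermonde[OF iW, of Q "lam ` M"])
        show "\<And>a x. a \<in> carrier R \<Longrightarrow> a \<notin> Q \<Longrightarrow> x \<in> carrier R \<Longrightarrow> a \<otimes> x \<in> W \<Longrightarrow> x \<in> W"
          unfolding W_def by (rule satur_absorb[OF Q]) auto
        show "length (map (\<lambda>x. x \<otimes> v) xs) \<le> card (lam ` M)" using M(3) inj by (simp add: card_image)
        show "set (map (\<lambda>x. x \<otimes> v) xs) \<subseteq> carrier R" using xs vc by auto
        fix t assume "t \<in> lam ` M"
        then obtain m where m: "m \<in> M" "t = lam m" by blast
        have "y m \<otimes> v \<in> pow_prod R J k (?V m)"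
          unfolding JV using ideal_prod.prod[OF cgenideal_self[OF yc] v] .
        then show "horner R (map (\<lambda>x. x \<otimes> v) xs) t \<in> W"
          using VW[OF m(1)] xs vc lam(1) unfolding m(2) by (auto simp: horner_map y_def)
      next
        fix s t assume "s \<in> lam ` M" "t \<in> lam ` M" "s \<noteq> t"
        then obtain i j where "s = lam i" "t = lam j" "i \<noteq> j" by auto
        then show "s \<ominus> t \<notin> Q" using lam(2)[of i j] by simp
      qed (use M(2) lam(1) in auto)
      then have "set xs \<subseteq> colon R W v" using xs by (auto simp: colon_def)
      then have "J \<subseteq> colon R W v" unfolding J by (rule genideal_minimal[OF colon_ideal[OF iW vc]])
      then show "c \<otimes> v \<in> W" using c by (auto simp: colon_def)
    qed
    then show False using l(1) unfolding bad_def W_def T_def pow_prod_Suc by simp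
  qed
  then show ?case by simp
qed

lemma reduction_exists:
  assumes Q: "primeideal Q R" and xs: "set xs \<subseteq> carrier R" and J: "J = Idl (set xs)"
    and lam: "\<And>i. lam i \<in> carrier R" "\<And>i j :: nat. i \<noteq> j \<Longrightarrow> lam i \<ominus> lam j \<notin> Q"
    and Z: "ideal Z R" and V: "ideal V R" and l: "len_le R Q (pow_prod R J (Suc k) V <+> Z) Z (Suc k)"
  shows "\<exists>j. pow_prod R J (Suc k) V \<subseteq> satur R Q (((PIdl (horner R xs (lam j))) \<cdot> pow_prod R J k V) <+> Z)"
proof -
  from reduction_cofinite[OF Q xs J lam Z V l]
  have "finite {j. \<not> pow_prod R J (Suc k) V \<subseteq> satur R Q (((PIdl (horner R xs (lam j))) \<cdot> pow_prod R J k V) <+> Z)}"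
    by simp
  from ex_new_if_finite[OF infinite_UNIV_nat this] show ?thesis by simp
qed

text \<open>Induction on the generators: modulo \<open>W\<close> and the other generators, \<open>(a - q) h\<close> vanishes for some \<open>a \<notin> Q\<close>
  and \<open>q \<in> Q\<close>, and \<open>a - q\<close> is again a denominator, so \<open>h\<close> can be eliminated.\<close>

lemma nakayama_gens:
  assumes Q: "primeideal Q R" and W: "ideal W R"
    and "finite S" "S \<subseteq> carrier R" "S \<subseteq> satur R Q (W <+> (Q \<cdot> (Idl S)))"
  shows "S \<subseteq> satur R Q W"
  using assms(3-)
proof (induct S)
  case (insert h S)
  have c: "h \<in> carrier R" "S \<subseteq> carrier R" "insert h S \<subseteq> carrier R" using insert(4) by auto
  have iQ: "ideal Q R" using prime_ideal[OF Q] .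
  have iS: "ideal (Idl S) R" "ideal (PIdl h) R" "ideal (Q \<cdot> (Idl S)) R" "ideal (Q \<cdot> (PIdl h)) R"
    using c iQ by (auto intro!: genideal_ideal cgenideal_ideal ideal_prod_is_ideal)
  let ?W1 = "W <+> (Q \<cdot> (Idl S))"
  have iW1: "ideal ?W1 R" using add_ideals[OF W iS(3)] .
  have sW1: "ideal (satur R Q ?W1) R" "?W1 \<subseteq> satur R Q ?W1"
    using satur_ideal[OF Q iW1] satur_le[OF Q iW1] .
  have "Q \<cdot> (Idl (insert h S)) \<subseteq> Q \<cdot> (Idl S <+> PIdl h)"
    using Idl_insert_le[OF c(2,1)] by (intro ideal_prod_mono) auto
  also have "\<dots> = (Q \<cdot> (Idl S)) <+> (Q \<cdot> (PIdl h))" using ideal_prod_r_distr[OF iQ iS(1,2)] .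
  finally have dec: "Q \<cdot> (Idl (insert h S)) \<subseteq> (Q \<cdot> (Idl S)) <+> (Q \<cdot> (PIdl h))" .
  have Qh: "\<exists>q \<in> Q. u = q \<otimes> h" if "u \<in> Q \<cdot> (PIdl h)" for u
    using that PIdl_prod_iff[OF iQ c(1)] ideal_prod_commute[OF iQ iS(2)] ideal_subset[OF iQ] c(1)
    by (auto simp: m_comm subset_iff)
  have h: "h \<in> satur R Q ?W1"
  proof -
    have "h \<in> satur R Q (W <+> (Q \<cdot> (Idl (insert h S))))" using insert(5) by simp
    then obtain a where a: "a \<in> carrier R" "a \<notin> Q" "a \<otimes> h \<in> W <+> (Q \<cdot> (Idl (insert h S)))" by (rule saturE)
    from a(3) obtain w u where w: "w \<in> W" "u \<in> Q \<cdot> (Idl (insert h S))" "a \<otimes> h = w \<oplus> u" by (rule set_addE)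
    from w(2) dec have "u \<in> (Q \<cdot> (Idl S)) <+> (Q \<cdot> (PIdl h))" by blast
    then obtain u1 u2 where u: "u1 \<in> Q \<cdot> (Idl S)" "u2 \<in> Q \<cdot> (PIdl h)" "u = u1 \<oplus> u2" by (rule set_addE)
    from Qh[OF u(2)] obtain q where q: "q \<in> Q" "u2 = q \<otimes> h" by blast
    have cc: "w \<in> carrier R" "u1 \<in> carrier R" "q \<in> carrier R"
      using w(1) u(1) q(1) ideal_subset[OF W] ideal_subset[OF iS(3)] ideal_subset[OF iQ] by auto
    have "(a \<ominus> q) \<otimes> h = a \<otimes> h \<ominus> q \<otimes> h" using cc(3) a(1) c(1) by algebra
    also have "\<dots> = (w \<oplus> (u1 \<oplus> q \<otimes> h)) \<ominus> q \<otimes> h" unfolding w(3) u(3) q(2) ..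
    also have "\<dots> = w \<oplus> u1" using cc c(1) by algebra
    also have "\<dots> \<in> ?W1" using w(1) u(1) by (rule set_addI)
    finally have "(a \<ominus> q) \<otimes> h \<in> ?W1" .
    moreover have "a \<ominus> q \<notin> Q"
    proof
      assume "a \<ominus> q \<in> Q"
      then have "a \<ominus> q \<oplus> q \<in> Q" using q(1) by (rule ideal_add[OF iQ])
      moreover have "a \<ominus> q \<oplus> q = a" using a(1) cc(3) by algebra
      ultimately show False using a(2) by simp
    qed
    ultimately show ?thesis using a(1) cc(3) c(1) by (intro saturI[of "a \<ominus> q"]) auto
  qed
  have "Q \<cdot> (PIdl h) \<subseteq> satur R Q ?W1"
    using Qh ideal_mult[OF sW1(1) h] ideal_subset[OF iQ] by blast
  moreover have "Q \<cdot> (Idl S) \<subseteq> satur R Q ?W1" using set_add_le2[OF W iS(3)] sW1(2) by blast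
  ultimately have "Q \<cdot> (Idl (insert h S)) \<subseteq> satur R Q ?W1"
    using dec set_add_least[OF sW1(1), of "Q \<cdot> (Idl S)" "Q \<cdot> (PIdl h)"] by blast
  moreover have "W \<subseteq> satur R Q ?W1" using set_add_le1[OF W iS(3)] sW1(2) by blast
  ultimately have "W <+> (Q \<cdot> (Idl (insert h S))) \<subseteq> satur R Q ?W1" by (intro set_add_least[OF sW1(1)])
  from satur_closed[OF Q this] have "S \<subseteq> satur R Q ?W1" using insert(5) by auto
  then have S: "S \<subseteq> satur R Q W" by (rule insert(3)[OF c(2)])
  have sW: "ideal (satur R Q W) R" "W \<subseteq> satur R Q W"
    using satur_ideal[OF Q W] satur_le[OF Q W] .
  have "Q \<cdot> (Idl S) \<subseteq> satur R Q W"
    using ideal_prod_le2[OF iQ iS(1)] genideal_minimal[OF sW(1) S] by blast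
  then have "?W1 \<subseteq> satur R Q W" using sW by (intro set_add_least)
  from satur_closed[OF Q this] have "h \<in> satur R Q W" using h by blast
  then show ?case using S by simp
qed simp

lemma nakayama:
  assumes Q: "primeideal Q R" and W: "ideal W R" and S: "finite S" "S \<subseteq> carrier R" "U = Idl S"
    and U: "U \<subseteq> satur R Q (W <+> (Q \<cdot> U))"
  shows "U \<subseteq> satur R Q W"
proof -
  have "S \<subseteq> satur R Q W"
    using U genideal_self[OF S(2)] unfolding S(3) by (intro nakayama_gens[OF Q W S(1,2)]) auto
  then show ?thesis unfolding S(3) by (rule genideal_minimal[OF satur_ideal[OF Q W]])
qed

lemma finsum_in_ideal:
  assumes I: "ideal I R" and f: "\<And>i. i \<in> A \<Longrightarrow> f i \<in> I"
  shows "finsum R f A \<in> I"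
proof (cases "finite A")
  case True
  then show ?thesis using f
  proof (induct A)
    case (insert a A)
    have "f \<in> A \<rightarrow> carrier R" "f a \<in> carrier R" using insert(4) ideal_subset[OF I] by auto
    then show ?case using insert by (simp add: ideal_add[OF I])
  qed (simp add: ideal_zero[OF I])
qed (simp add: finsum_infinite ideal_zero[OF I])

end

section \<open>Extension of ideals to polynomials\<close>

text \<open>The ideal \<open>H[t]\<close>. Passing from \<open>R\<close> at \<open>Q\<close> to \<open>R[t]\<close> at \<open>Q[t]\<close> makes the residue field infinite without changing
  numbers of generators.\<close>

definition poly_ext :: "('a, 'b) ring_scheme \<Rightarrow> 'a set \<Rightarrow> (nat \<Rightarrow> 'a) set" where
  "poly_ext R H = {f \<in> carrier (UP R). \<forall>n. up_ring.coeff (UP R) f n \<in> H}"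

context UP_cring
begin

lemma poly_ext_iff: "f \<in> poly_ext R H \<longleftrightarrow> f \<in> carrier P \<and> (\<forall>n. up_ring.coeff P f n \<in> H)"
  by (simp add: poly_ext_def P_def)

lemma poly_ext_mono: "H \<subseteq> K \<Longrightarrow> poly_ext R H \<subseteq> poly_ext R K"
  by (auto simp: poly_ext_iff subset_iff)

lemma poly_ext_Int: "poly_ext R (H \<inter> K) = poly_ext R H \<inter> poly_ext R K"
  by (auto simp: poly_ext_iff)

lemma poly_ext_ideal:
  assumes H: "ideal H R" shows "ideal (poly_ext R H) P"
proof (rule P.idealI')
  fix a x assume a: "a \<in> carrier P" and x: "x \<in> poly_ext R H"
  then have xc: "x \<in> carrier P" "\<And>n. up_ring.coeff P x n \<in> H" by (auto simp: poly_ext_iff)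
  have "up_ring.coeff P (a \<otimes>\<^bsub>P\<^esub> x) n \<in> H" for n
    unfolding coeff_mult[OF a xc(1)] using a xc by (intro R.finsum_in_ideal[OF H] R.ideal_mult[OF H]) auto
  then show "a \<otimes>\<^bsub>P\<^esub> x \<in> poly_ext R H" using a xc by (simp add: poly_ext_iff)
qed (auto simp: poly_ext_iff R.ideal_zero[OF H] R.ideal_add[OF H])

lemma monom_in_poly_ext: "ideal H R \<Longrightarrow> h \<in> H \<Longrightarrow> up_ring.monom P h n \<in> poly_ext R H"
  using R.ideal_subset[of H] R.ideal_zero[of H] by (auto simp: poly_ext_iff)

lemma const_in_poly_ext_iff:
  assumes "ideal H R" "h \<in> carrier R" shows "up_ring.monom P h 0 \<in> poly_ext R H \<longleftrightarrow> h \<in> H"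

proof
  assume "up_ring.monom P h 0 \<in> poly_ext R H"
  then have "up_ring.coeff P (up_ring.monom P h 0) 0 \<in> H" by (simp only: poly_ext_iff)
  then show "h \<in> H" using assms(2) by simp
qed (rule monom_in_poly_ext[OF assms(1)])

text \<open>A polynomial is the sum of its monomials, so \<open>H[t]\<close> is generated by the constants in \<open>H\<close>.\<close>

lemma poly_ext_least:
  assumes H: "ideal H R" and K: "ideal K P" and "\<And>h. h \<in> H \<Longrightarrow> up_ring.monom P h 0 \<in> K"
  shows "poly_ext R H \<subseteq> K"
proof
  fix f assume f: "f \<in> poly_ext R H"
  then have fc: "f \<in> carrier P" "\<And>n. up_ring.coeff P f n \<in> H" by (auto simp: poly_ext_iff)
  have "up_ring.monom P (up_ring.coeff P f i) i \<in> K" for i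
  proof -
    have "up_ring.monom P (up_ring.coeff P f i) i = up_ring.monom P \<one> i \<otimes>\<^bsub>P\<^esub> up_ring.monom P (up_ring.coeff P f i) 0"
      using fc(1) monom_mult[of \<one> "up_ring.coeff P f i" i 0] by simp
    then show ?thesis using P.ideal_mult[OF K assms(3)[OF fc(2)], of "up_ring.monom P \<one> i"] by simp
  qed
  then have "(\<Oplus>\<^bsub>P\<^esub>i\<in>{..deg R f}. up_ring.monom P (up_ring.coeff P f i) i) \<in> K" by (intro P.finsum_in_ideal[OF K])
  then show "f \<in> K" using up_repr[OF fc(1)] by simp
qed

lemma poly_ext_prod:
  assumes I: "ideal I R" and H: "ideal H R"
  shows "poly_ext R (I \<cdot> H) = poly_ext R I \<cdot>\<^bsub>P\<^esub> poly_ext R H"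
proof
  have IH: "ideal (I \<cdot> H) R" using R.ideal_prod_is_ideal[OF I H] .
  have e: "ideal (poly_ext R I) P" "ideal (poly_ext R H) P" using poly_ext_ideal I H by auto
  have eIH: "ideal (poly_ext R I \<cdot>\<^bsub>P\<^esub> poly_ext R H) P" using P.ideal_prod_is_ideal[OF e] .
  show "poly_ext R (I \<cdot> H) \<subseteq> poly_ext R I \<cdot>\<^bsub>P\<^esub> poly_ext R H"
  proof (rule poly_ext_least[OF IH eIH])
    fix h assume "h \<in> I \<cdot> H"
    then have "h \<in> carrier R \<and> up_ring.monom P h 0 \<in> poly_ext R I \<cdot>\<^bsub>P\<^esub> poly_ext R H"
    proof induct
      case (prod i j)
      have c: "i \<in> carrier R" "j \<in> carrier R" using prod R.ideal_subset I H by blast+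
      have "up_ring.monom P (i \<otimes> j) 0 = up_ring.monom P i 0 \<otimes>\<^bsub>P\<^esub> up_ring.monom P j 0" using monom_mult[OF c, of 0 0] by simp
      moreover have "up_ring.monom P i 0 \<otimes>\<^bsub>P\<^esub> up_ring.monom P j 0 \<in> poly_ext R I \<cdot>\<^bsub>P\<^esub> poly_ext R H"
        using prod by (intro ideal_prod.prod monom_in_poly_ext I H)
      ultimately show ?case using c by simp
    next
      case (sum s1 s2)
      then show ?case using monom_add[of s1 s2 0] P.ideal_add[OF eIH] by simp
    qed
    then show "up_ring.monom P h 0 \<in> poly_ext R I \<cdot>\<^bsub>P\<^esub> poly_ext R H" ..
  qed
  show "poly_ext R I \<cdot>\<^bsub>P\<^esub> poly_ext R H \<subseteq> poly_ext R (I \<cdot> H)"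
  proof (rule P.ideal_prod_least[OF poly_ext_ideal[OF IH]])
    fix f g assume "f \<in> poly_ext R I" "g \<in> poly_ext R H"
    then have c: "f \<in> carrier P" "g \<in> carrier P" "\<And>n. up_ring.coeff P f n \<in> I" "\<And>n. up_ring.coeff P g n \<in> H"
      by (auto simp: poly_ext_iff)
    have "up_ring.coeff P (f \<otimes>\<^bsub>P\<^esub> g) n \<in> I \<cdot> H" for n
      unfolding coeff_mult[OF c(1,2)] using c by (intro R.finsum_in_ideal[OF IH] ideal_prod.prod)
    then show "f \<otimes>\<^bsub>P\<^esub> g \<in> poly_ext R (I \<cdot> H)" using c by (simp add: poly_ext_iff)
  qed
qed

lemma poly_ext_pow_prod:
  assumes "ideal I R" "ideal V R"
  shows "poly_ext R (pow_prod R I n V) = pow_prod P (poly_ext R I) n (poly_ext R V)"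
  by (induct n) (auto simp: pow_prod_Suc P.pow_prod_Suc R.pow_prod_Suc poly_ext_prod assms R.pow_prod_ideal)

lemma poly_ext_add:
  assumes I: "ideal I R" and H: "ideal H R"
  shows "poly_ext R (I <+> H) = poly_ext R I <+>\<^bsub>P\<^esub> poly_ext R H"
proof
  have e: "ideal (poly_ext R I) P" "ideal (poly_ext R H) P" using poly_ext_ideal I H by auto
  have IH: "ideal (I <+> H) R" using R.add_ideals[OF I H] .
  show "poly_ext R (I <+> H) \<subseteq> poly_ext R I <+>\<^bsub>P\<^esub> poly_ext R H"
  proof (rule poly_ext_least[OF IH P.add_ideals[OF e]])
    fix h assume "h \<in> I <+> H"
    then obtain i j where ij: "i \<in> I" "j \<in> H" "h = i \<oplus> j" by (rule R.set_addE)
    then have "i \<in> carrier R" "j \<in> carrier R" using R.ideal_subset I H by blast+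
    then have "up_ring.monom P h 0 = up_ring.monom P i 0 \<oplus>\<^bsub>P\<^esub> up_ring.monom P j 0" unfolding ij(3) by (rule monom_add)
    then show "up_ring.monom P h 0 \<in> poly_ext R I <+>\<^bsub>P\<^esub> poly_ext R H"
      using ij(1,2) by (auto intro!: P.set_addI monom_in_poly_ext I H)
  qed
  show "poly_ext R I <+>\<^bsub>P\<^esub> poly_ext R H \<subseteq> poly_ext R (I <+> H)"
    by (intro P.set_add_least poly_ext_ideal IH poly_ext_mono R.set_add_le1 R.set_add_le2 I H)
qed

text \<open>The lowest coefficients of \<open>f\<close> and \<open>g\<close> outside \<open>Q\<close>, at \<open>i\<close> and \<open>j\<close>, produce a coefficient of \<open>f g\<close> outside \<open>Q\<close> at \<open>i + j\<close>.\<close>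

lemma poly_ext_prime:
  assumes Q: "primeideal Q R" shows "primeideal (poly_ext R Q) P"
proof (rule primeidealI[OF poly_ext_ideal P.is_cring])
  have iQ: "ideal Q R" using R.prime_ideal[OF Q] .
  then show "ideal Q R" .
  have "up_ring.monom P \<one> 0 \<notin> poly_ext R Q" using const_in_poly_ext_iff[OF iQ, of \<one>] R.prime_one[OF Q] by simp
  then show "carrier P \<noteq> poly_ext R Q" using monom_closed[of \<one> 0] by auto
  fix f g assume f: "f \<in> carrier P" and g: "g \<in> carrier P" and fg: "f \<otimes>\<^bsub>P\<^esub> g \<in> poly_ext R Q"
  show "f \<in> poly_ext R Q \<or> g \<in> poly_ext R Q"
  proof (rule ccontr)
    assume "\<not> ?thesis"
    then have "\<exists>i. up_ring.coeff P f i \<notin> Q" "\<exists>j. up_ring.coeff P g j \<notin> Q" using f g by (auto simp: poly_ext_iff)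
    then obtain i j where i: "up_ring.coeff P f i \<notin> Q" "\<And>k. k < i \<Longrightarrow> up_ring.coeff P f k \<in> Q"
      and j: "up_ring.coeff P g j \<notin> Q" "\<And>k. k < j \<Longrightarrow> up_ring.coeff P g k \<in> Q"
      using exists_least_iff[of "\<lambda>i. up_ring.coeff P f i \<notin> Q"] exists_least_iff[of "\<lambda>i. up_ring.coeff P g i \<notin> Q"]
      by blast
    let ?t = "\<lambda>k. up_ring.coeff P f k \<otimes> up_ring.coeff P g (i + j - k)"
    let ?r = "finsum R ?t ({..i + j} - {i})"
    have tc: "?t k \<in> carrier R" for k using f g by simp
    have "?r \<in> Q"
    proof (rule R.finsum_in_ideal[OF iQ])
      fix k assume "k \<in> {..i + j} - {i}"
      then consider "k < i" | "i + j - k < j" by force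
      then show "?t k \<in> Q"
      proof cases
        case 1
        then show ?thesis using i(2) f g by (auto intro: ideal.I_r_closed[OF iQ])
      next
        case 2
        then show ?thesis using j(2) f g by (auto intro: ideal.I_l_closed[OF iQ])
      qed
    qed
    moreover have "finsum R ?t {..i + j} \<in> Q"
      using fg unfolding poly_ext_iff coeff_mult[OF f g] by blast
    moreover have eq: "finsum R ?t {..i + j} = ?t i \<oplus> ?r"
      using R.finsum_insert[of "{..i + j} - {i}" i ?t] tc tc[of i] by (simp add: insert_absorb)
    ultimately have "(?t i \<oplus> ?r) \<ominus> ?r \<in> Q"
      by (intro R.ideal_minus[OF iQ]) auto
    moreover have "(?t i \<oplus> ?r) \<ominus> ?r = ?t i"
      using tc tc[of i] by (intro R.add_minus_cancel R.finsum_closed) auto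
    ultimately have "up_ring.coeff P f i \<otimes> up_ring.coeff P g j \<in> Q" by simp
    moreover have "up_ring.coeff P f i \<in> carrier R" "up_ring.coeff P g j \<in> carrier R" using f g by auto
    ultimately show False using primeideal.I_prime[OF Q] i(1) j(1) by blast
  qed
qed

lemma poly_ext_satur:
  assumes Q: "primeideal Q R" and U: "ideal U R" and H: "ideal H R" and "U \<subseteq> satur R Q H"
  shows "poly_ext R U \<subseteq> satur P (poly_ext R Q) (poly_ext R H)"
proof (rule poly_ext_least[OF U P.satur_ideal[OF poly_ext_prime[OF Q] poly_ext_ideal[OF H]]])
  fix h assume "h \<in> U"
  then obtain a where a: "a \<in> carrier R" "a \<notin> Q" "a \<otimes> h \<in> H" "h \<in> carrier R"
    using assms(4) by (auto elim: R.saturE)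
  have "up_ring.monom P a 0 \<otimes>\<^bsub>P\<^esub> up_ring.monom P h 0 \<in> poly_ext R H"
    using monom_mult[OF a(1,4), of 0 0] monom_in_poly_ext[OF H a(3), of 0] by simp
  then show "up_ring.monom P h 0 \<in> satur P (poly_ext R Q) (poly_ext R H)"
    using a const_in_poly_ext_iff[OF R.prime_ideal[OF Q] a(1)] by (intro P.saturI[of "up_ring.monom P a 0"]) auto
qed

end


text \<open>The element \<open>\<Sum> x\<^sub>i t\<^sup>i\<^sup>(\<^sup>j\<^sup>+\<^sup>1\<^sup>)\<close>. With the exponent \<open>j + 1\<close>, which is never zero, its coefficients are exactly
  the \<open>x\<^sub>i\<close>; for the exponent \<open>0\<close> it would collapse to the sum of the \<open>x\<^sub>i\<close>.\<close>

definition generic_comb :: "('a, 'b) ring_scheme \<Rightarrow> 'a list \<Rightarrow> nat \<Rightarrow> (nat \<Rightarrow> 'a)" where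
  "generic_comb R xs j =
     horner (UP R) (map (\<lambda>x. up_ring.monom (UP R) x 0) xs) (up_ring.monom (UP R) \<one>\<^bsub>R\<^esub> (Suc j))"

context UP_cring
begin

lemma coeff_const_mult:
  assumes "m \<in> carrier R" "f \<in> carrier P"
  shows "up_ring.coeff P (up_ring.monom P m 0 \<otimes>\<^bsub>P\<^esub> f) n = m \<otimes> up_ring.coeff P f n"
  using assms by (simp add: monom_mult_is_smult)

lemma coeff_shift_mult:
  assumes f: "f \<in> carrier P"
  shows "up_ring.coeff P (up_ring.monom P \<one> (Suc j) \<otimes>\<^bsub>P\<^esub> f) 0 = \<zero>"
    and "up_ring.coeff P (up_ring.monom P \<one> (Suc j) \<otimes>\<^bsub>P\<^esub> f) (Suc j + n) = up_ring.coeff P f n"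
proof -
  have "up_ring.coeff P f 0 \<in> carrier R" "up_ring.coeff P f n \<in> carrier R" using f by auto
  then show "up_ring.coeff P (up_ring.monom P \<one> (Suc j) \<otimes>\<^bsub>P\<^esub> f) 0 = \<zero>"
    "up_ring.coeff P (up_ring.monom P \<one> (Suc j) \<otimes>\<^bsub>P\<^esub> f) (Suc j + n) = up_ring.coeff P f n"
    using f coeff_monom_mult[OF R.one_closed f, of "Suc j" n] by (simp, simp del: coeff_mult add: add.commute)
qed

lemma poly_ext_Idl:
  assumes S: "S \<subseteq> carrier R"
  shows "poly_ext R (Idl S) = Idl\<^bsub>P\<^esub> ((\<lambda>s. up_ring.monom P s 0) ` S)"
proof
  let ?c = "\<lambda>s. up_ring.monom P s 0"
  have cS: "?c ` S \<subseteq> carrier P" using S by auto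
  have iS: "ideal (Idl S) R" using R.genideal_ideal[OF S] .
  have K: "ideal (Idl\<^bsub>P\<^esub> (?c ` S)) P" using P.genideal_ideal[OF cS] .
  let ?K = "{h \<in> carrier R. ?c h \<in> Idl\<^bsub>P\<^esub> (?c ` S)}"
  have "ideal ?K R"
  proof (rule R.idealI')
    fix a x assume a: "a \<in> carrier R" and x: "x \<in> ?K"
    then have "?c (a \<otimes> x) = ?c a \<otimes>\<^bsub>P\<^esub> ?c x" using monom_mult[of a x 0 0] by simp
    then show "a \<otimes> x \<in> ?K"
      using a x P.ideal_mult[OF K, of "?c x" "?c a"] by simp
  qed (use P.ideal_zero[OF K] P.ideal_add[OF K] in auto)
  moreover have "S \<subseteq> ?K"
    using S P.genideal_self[OF cS] by auto
  ultimately have "Idl S \<subseteq> ?K" by (rule R.genideal_minimal)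
  then show "poly_ext R (Idl S) \<subseteq> Idl\<^bsub>P\<^esub> (?c ` S)" by (intro poly_ext_least[OF iS K]) auto
  show "Idl\<^bsub>P\<^esub> (?c ` S) \<subseteq> poly_ext R (Idl S)"
    using R.genideal_self[OF S] by (intro P.genideal_minimal poly_ext_ideal[OF iS]) (auto intro!: monom_in_poly_ext[OF iS])
qed

lemma generic_comb_closed: "set xs \<subseteq> carrier R \<Longrightarrow> generic_comb R xs j \<in> carrier P"
  unfolding generic_comb_def P_def[symmetric] by (intro P.horner_closed) auto

lemma generic_comb_in: "ideal I R \<Longrightarrow> set xs \<subseteq> I \<Longrightarrow> generic_comb R xs j \<in> poly_ext R I"
  unfolding generic_comb_def P_def[symmetric]
  by (intro P.horner_in_ideal poly_ext_ideal) (auto intro!: monom_in_poly_ext)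

lemma generic_comb_content:
  assumes p: "ideal p R" and "set xs \<subseteq> carrier R" "generic_comb R xs j \<in> poly_ext R p"
  shows "set xs \<subseteq> p"
  using assms(2,3)
proof (induct xs)
  case (Cons x xs)
  define g where "g = generic_comb R xs j"
  have g: "g \<in> carrier P" unfolding g_def using Cons by (intro generic_comb_closed) auto
  have x: "x \<in> carrier R" using Cons by simp
  let ?t = "up_ring.monom P \<one> (Suc j)"
  let ?f = "up_ring.monom P x 0 \<oplus>\<^bsub>P\<^esub> ?t \<otimes>\<^bsub>P\<^esub> g"
  have e: "generic_comb R (x # xs) j = ?f"
    by (simp add: generic_comb_def g_def P_def[symmetric])
  have c: "up_ring.coeff P (?f) n \<in> p" for n
    using Cons(3) unfolding e poly_ext_iff by blast
  have "up_ring.coeff P (?f) 0 = x"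
    using x g coeff_shift_mult(1)[OF g, of j] by simp
  then have "x \<in> p" using c[of 0] by simp
  moreover have "up_ring.coeff P g n \<in> p" for n
  proof -
    have "up_ring.coeff P (?f) (Suc j + n) = up_ring.coeff P g n"
      using x g coeff_shift_mult(2)[OF g, of j n] by simp
    then show ?thesis using c[of "Suc j + n"] by simp
  qed
  then have "set xs \<subseteq> p" using Cons(1,2) g by (auto simp: poly_ext_iff g_def)
  ultimately show ?case by simp
qed simp

text \<open>The powers of \<open>t\<close> are infinitely many elements that stay distinct in the residue field at \<open>Q[t]\<close>, so they can
  serve as the parameters \<open>\<lambda>\<^sub>j\<close> of general elements.\<close>

lemma shift_diff_notin:
  assumes Q: "primeideal Q R" and "i \<noteq> j"
  shows "up_ring.monom P \<one> (Suc i) \<ominus>\<^bsub>P\<^esub> up_ring.monom P \<one> (Suc j) \<notin> poly_ext R Q"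
proof
  assume "up_ring.monom P \<one> (Suc i) \<ominus>\<^bsub>P\<^esub> up_ring.monom P \<one> (Suc j) \<in> poly_ext R Q"
  then have "up_ring.coeff P (up_ring.monom P \<one> (Suc i) \<ominus>\<^bsub>P\<^esub> up_ring.monom P \<one> (Suc j)) (Suc i) \<in> Q"
    unfolding poly_ext_iff by blast
  then have "\<one> \<in> Q" using assms(2) by (simp add: a_minus_def)
  then show False using R.prime_one[OF Q] by simp
qed

end

section \<open>The uniform Artin-Rees property for ideals\<close>

text \<open>From the exponent \<open>s\<close> on, the generic combinations of generators of \<open>I\<close> are no zero divisors on
  \<open>I\<^sup>n M\<close> modulo \<open>K\<close>, for every ideal \<open>I\<close>.\<close>

definition torsion_bound :: "('a, 'b) ring_scheme \<Rightarrow> 'a set \<Rightarrow> 'a set \<Rightarrow> nat \<Rightarrow> bool" where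
  "torsion_bound R K M s \<longleftrightarrow> (\<forall>xs j n z. set xs \<subseteq> carrier R \<longrightarrow> s \<le> n \<longrightarrow>
     z \<in> poly_ext R (pow_prod R (Idl\<^bsub>R\<^esub> (set xs)) n M) \<longrightarrow>
     generic_comb R xs j \<otimes>\<^bsub>UP R\<^esub> z \<in> poly_ext R K \<longrightarrow> z \<in> poly_ext R K)"

text \<open>The analogue of \<open>loc_gen_bound\<close> for the submodules of \<open>M/K\<close>.\<close>

definition gen_bound :: "('a, 'b) ring_scheme \<Rightarrow> 'a set \<Rightarrow> 'a set \<Rightarrow> nat \<Rightarrow> bool" where
  "gen_bound R K M e \<longleftrightarrow> (\<forall>Q H. primeideal Q R \<longrightarrow> ideal H R \<longrightarrow> H \<subseteq> M \<longrightarrow>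
     (\<exists>S \<subseteq> H. finite S \<and> card S \<le> e \<and>
        H \<subseteq> satur R Q (Idl\<^bsub>R\<^esub> S <+>\<^bsub>R\<^esub> ((Q \<cdot>\<^bsub>R\<^esub> H) <+>\<^bsub>R\<^esub> K))))"

definition artin_rees :: "('a, 'b) ring_scheme \<Rightarrow> 'a set \<Rightarrow> 'a set \<Rightarrow> nat \<Rightarrow> bool" where
  "artin_rees R K M s \<longleftrightarrow> (\<forall>I n. ideal I R \<longrightarrow> s \<le> n \<longrightarrow>
     pow_prod R I n M \<inter> K = pow_prod R I (n - s) (pow_prod R I s M \<inter> K))"

context cring
begin

lemma pow_prod_satur:
  assumes "primeideal Q R" "ideal J R" "ideal V R" "U \<subseteq> satur R Q V"
  shows "pow_prod R J m U \<subseteq> satur R Q (pow_prod R J m V)"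
  using assms by (induct m) (auto simp: pow_prod_Suc intro!: satur_prod_le pow_prod_ideal del: subsetI)

lemma pow_prod_set_add:
  assumes "ideal J R" "ideal V R" "ideal W R"
  shows "pow_prod R J m (V <+> W) = pow_prod R J m V <+> pow_prod R J m W"
  using assms by (induct m) (simp_all add: pow_prod_Suc ideal_prod_r_distr pow_prod_ideal)

lemma artin_reesI:
  assumes M: "ideal M R" and K: "ideal K R"
    and step: "\<And>I n. ideal I R \<Longrightarrow> s \<le> n \<Longrightarrow> pow_prod R I (Suc n) M \<inter> K \<subseteq> I \<cdot> (pow_prod R I n M \<inter> K)"
  shows "artin_rees R K M s"
  unfolding artin_rees_def
proof (intro allI impI)
  fix I and n :: nat assume I: "ideal I R" and "s \<le> n"
  have iK: "ideal (pow_prod R I s M \<inter> K) R" using i_intersect[OF pow_prod_ideal[OF I M] K] .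
  show "pow_prod R I n M \<inter> K = pow_prod R I (n - s) (pow_prod R I s M \<inter> K)"
  proof
    show "pow_prod R I n M \<inter> K \<subseteq> pow_prod R I (n - s) (pow_prod R I s M \<inter> K)"
      using \<open>s \<le> n\<close>
    proof (induct rule: dec_induct)
      case (step n)
      have "pow_prod R I (Suc n) M \<inter> K \<subseteq> I \<cdot> (pow_prod R I n M \<inter> K)" using assms(3)[OF I step(1)] .
      also have "\<dots> \<subseteq> I \<cdot> pow_prod R I (n - s) (pow_prod R I s M \<inter> K)"
        using step(3) by (intro ideal_prod_mono subset_refl)
      finally show ?case using step(1) by (simp add: Suc_diff_le pow_prod_Suc)
    qed simp
    have "pow_prod R I (n - s) (pow_prod R I s M \<inter> K) \<subseteq> pow_prod R I (n - s) (pow_prod R I s M)"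
      by (intro pow_prod_mono) auto
    then show "pow_prod R I (n - s) (pow_prod R I s M \<inter> K) \<subseteq> pow_prod R I n M \<inter> K"
      using pow_prod_le[OF I iK, of "n - s"] \<open>s \<le> n\<close> by (simp flip: pow_prod_add)
  qed
qed

end

context noetherian_cring
begin

text \<open>An element outside \<open>L\<close> stays outside at an associated prime \<open>(L : m)\<close> with \<open>m\<close> a multiple of that element.\<close>

lemma in_ideal_if_locally:
  assumes L: "ideal L R" and y: "y \<in> carrier R"
    and loc: "\<And>Q. primeideal Q R \<Longrightarrow> y \<in> satur R Q L"
  shows "y \<in> L"
proof (rule ccontr)
  assume "y \<notin> L"
  then have "\<not> PIdl y \<subseteq> L" using cgenideal_self[OF y] by blast
  from associated_prime[OF L cgenideal_ideal[OF y] this]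
  obtain m where m: "m \<in> PIdl y - L" "primeideal (colon R L m) R" by blast
  from loc[OF m(2)] obtain a where a: "a \<in> carrier R" "a \<notin> colon R L m" "a \<otimes> y \<in> L" by (rule saturE)
  from m(1) obtain c where c: "c \<in> carrier R" "m = c \<otimes> y" by (auto simp: PIdl_iff)
  have "a \<otimes> m = c \<otimes> (a \<otimes> y)" unfolding c(2) using a(1) c(1) y by (simp add: m_lcomm)
  then have "a \<otimes> m \<in> L" using ideal_mult[OF L a(3) c(1)] by simp
  then show False using a by (simp add: colon_def)
qed

text \<open>The bound \<open>e\<close> on generators is a bound on the length of \<open>H/QH\<close> modulo \<open>K\<close> for \<open>H = I\<^sup>e\<^sup>+\<^sup>1 M\<close>, and it survives the passage to
  \<open>R[t]\<close> at \<open>Q[t]\<close>. There \<open>reduction_exists\<close> applies; Nakayama's lemma removes the term \<open>QH\<close>, and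
  multiplication by powers of \<open>I\<close> carries the result from \<open>e + 1\<close> to all larger exponents.\<close>

lemma local_reduction:
  assumes M: "ideal M R" and K: "ideal K R" and G: "gen_bound R K M e" and Q: "primeideal Q R"
    and xs: "set xs \<subseteq> carrier R" and n: "e < n"
  defines "I \<equiv> Idl (set xs)"
  shows "\<exists>j. poly_ext R (pow_prod R I n M) \<subseteq> satur (UP R) (poly_ext R Q)
      (((PIdl\<^bsub>UP R\<^esub> (generic_comb R xs j)) \<cdot>\<^bsub>UP R\<^esub> poly_ext R (pow_prod R I (n - 1) M)) <+>\<^bsub>UP R\<^esub> poly_ext R K)"
proof -
  interpret U: UP_cring R "UP R" by unfold_locales simp_all
  let ?P = "UP R" and ?c = "\<lambda>s. up_ring.monom (UP R) s 0"
  let ?E = "poly_ext R"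
  have I: "ideal I R" unfolding I_def using genideal_ideal[OF xs] .
  let ?J = "?E I" and ?H = "pow_prod R I (Suc e) M" and ?G = "pow_prod R I e M"
  have H: "ideal ?H R" "ideal ?G R" using pow_prod_ideal[OF I M] by auto
  have iQ: "ideal Q R" using prime_ideal[OF Q] .
  have QQ: "primeideal (?E Q) ?P" using U.poly_ext_prime[OF Q] .
  have QH: "ideal (Q \<cdot> ?H) R" using ideal_prod_is_ideal[OF iQ H(1)] .
  have Z0: "ideal ((Q \<cdot> ?H) <+> K) R" using add_ideals[OF QH K] .
  define Z where "Z = ?E ((Q \<cdot> ?H) <+> K)"
  have Z: "ideal Z ?P" unfolding Z_def using U.poly_ext_ideal[OF Z0] .
  have EH: "ideal (?E ?H) ?P" "ideal (?E ?G) ?P" "ideal (?E K) ?P" "ideal (?E M) ?P" "ideal ?J ?P" "ideal (?E (Q \<cdot> ?H)) ?P"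
    using U.poly_ext_ideal H K M I QH by auto
  have HM: "?H \<subseteq> M" using pow_prod_le[OF I M] .
  from G Q H HM obtain S where S: "S \<subseteq> ?H" "finite S" "card S \<le> e"
    "?H \<subseteq> satur R Q (Idl S <+> ((Q \<cdot> ?H) <+> K))" unfolding gen_bound_def by meson
  have Sc: "S \<subseteq> carrier R" using S(1) ideal_subset[OF H(1)] by blast
  have len: "len_le ?P (?E Q) (?E ?H <+>\<^bsub>?P\<^esub> Z) Z (Suc e)"
  proof (rule U.P.len_le_mono[OF QQ U.P.len_le_of_gens[OF QQ, of "?c ` S"]])
    show "finite (?c ` S)" using S by simp
    show "ideal Z ?P" by (rule Z)
    show "card (?c ` S) \<le> Suc e" using S card_image_le[of S ?c] by simp
    show iU: "ideal (?E ?H <+>\<^bsub>?P\<^esub> Z) ?P" using U.P.add_ideals[OF EH(1) Z] .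
    show "Z \<subseteq> ?E ?H <+>\<^bsub>?P\<^esub> Z" using U.P.set_add_le2[OF EH(1) Z] .
    have cS: "?c ` S \<subseteq> ?E ?H" using S(1) by (auto intro!: U.monom_in_poly_ext[OF H(1)])
    then show "?c ` S \<subseteq> ?E ?H <+>\<^bsub>?P\<^esub> Z" using U.P.set_add_le1[OF EH(1) Z] by blast
    let ?T = "Idl\<^bsub>?P\<^esub> (?c ` S) <+>\<^bsub>?P\<^esub> Z"
    have iS: "ideal (Idl\<^bsub>?P\<^esub> (?c ` S)) ?P"
      using cS U.P.ideal_subset[OF EH(1)] by (intro U.P.genideal_ideal) auto
    have iT: "ideal ?T ?P" using U.P.add_ideals[OF iS Z] .
    have "?E ?H \<subseteq> satur ?P (?E Q) (?E (Idl S <+> ((Q \<cdot> ?H) <+> K)))"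
      using add_ideals[OF genideal_ideal[OF Sc] Z0] S(4) by (intro U.poly_ext_satur Q H)
    also have "?E (Idl S <+> ((Q \<cdot> ?H) <+> K)) = ?T"
      unfolding U.poly_ext_add[OF genideal_ideal[OF Sc] Z0] U.poly_ext_Idl[OF Sc] Z_def ..
    finally have "?E ?H \<subseteq> satur ?P (?E Q) ?T" .
    moreover have "Z \<subseteq> satur ?P (?E Q) ?T"
      using U.P.satur_le[OF QQ iT] U.P.set_add_le2[OF iS Z] by blast
    ultimately show "?E ?H <+>\<^bsub>?P\<^esub> Z \<subseteq> satur ?P (?E Q) ?T"
      by (intro U.P.set_add_least[OF U.P.satur_ideal[OF QQ iT]])
    fix s c assume "s \<in> ?c ` S" "c \<in> ?E Q"
    then have "c \<otimes>\<^bsub>?P\<^esub> s \<in> ?E Q \<cdot>\<^bsub>?P\<^esub> ?E ?H" using cS by (intro ideal_prod.prod) auto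
    then show "c \<otimes>\<^bsub>?P\<^esub> s \<in> Z"
      unfolding Z_def U.poly_ext_prod[OF iQ H(1), symmetric]
      using U.poly_ext_mono[OF set_add_le1[OF QH K]] by blast
  qed
  have cxs: "set (map ?c xs) \<subseteq> carrier ?P" using xs by auto
  have JI: "?J = Idl\<^bsub>?P\<^esub> (set (map ?c xs))" unfolding I_def U.poly_ext_Idl[OF xs] by simp
  have EHe: "?E ?H = pow_prod ?P ?J (Suc e) (?E M)" "?E ?G = pow_prod ?P ?J e (?E M)"
    by (rule U.poly_ext_pow_prod[OF I M])+
  have "\<exists>j. pow_prod ?P ?J (Suc e) (?E M) \<subseteq> satur ?P (?E Q)
    (((PIdl\<^bsub>?P\<^esub> (horner ?P (map ?c xs) (up_ring.monom ?P \<one> (Suc j)))) \<cdot>\<^bsub>?P\<^esub> pow_prod ?P ?J e (?E M)) <+>\<^bsub>?P\<^esub> Z)"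
    by (rule U.P.reduction_exists[OF QQ cxs JI _ _ Z EH(4)])
      (use U.shift_diff_notin[OF Q] len EHe in auto)
  then obtain j where j: "?E ?H \<subseteq> satur ?P (?E Q)
    (((PIdl\<^bsub>?P\<^esub> (generic_comb R xs j)) \<cdot>\<^bsub>?P\<^esub> ?E ?G) <+>\<^bsub>?P\<^esub> Z)"
    unfolding generic_comb_def EHe by blast
  define y where "y = generic_comb R xs j"
  have yc: "y \<in> carrier ?P" unfolding y_def using U.generic_comb_closed[OF xs] .
  have Py: "ideal (PIdl\<^bsub>?P\<^esub> y) ?P" using U.P.cgenideal_ideal[OF yc] .
  let ?yH = "(PIdl\<^bsub>?P\<^esub> y) \<cdot>\<^bsub>?P\<^esub> ?E ?G"
  have yH: "ideal ?yH ?P" using U.P.ideal_prod_is_ideal[OF Py EH(2)] .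
  define W where "W = ?yH <+>\<^bsub>?P\<^esub> ?E K"
  have W: "ideal W ?P" unfolding W_def using U.P.add_ideals[OF yH EH(3)] .
  have red: "?E ?H \<subseteq> satur ?P (?E Q) W"
  proof -
    obtain S0 where S0: "S0 \<subseteq> carrier R" "finite S0" "?H = Idl S0" using finetely_gen[OF H(1)] by blast
    have QE: "?E Q \<cdot>\<^bsub>?P\<^esub> ?E ?H = ?E (Q \<cdot> ?H)" using U.poly_ext_prod[OF iQ H(1)] by simp
    let ?T = "W <+>\<^bsub>?P\<^esub> ?E (Q \<cdot> ?H)"
    have T: "ideal ?T ?P" using U.P.add_ideals[OF W EH(6)] .
    have WT: "W \<subseteq> ?T" "?E (Q \<cdot> ?H) \<subseteq> ?T" using U.P.set_add_le1[OF W EH(6)] U.P.set_add_le2[OF W EH(6)] .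
    have yK: "?yH \<subseteq> W" "?E K \<subseteq> W" unfolding W_def
      using U.P.set_add_le1[OF yH EH(3)] U.P.set_add_le2[OF yH EH(3)] .
    have "Z \<subseteq> ?T" unfolding Z_def U.poly_ext_add[OF QH K]
      using WT(2) order_trans[OF yK(2) WT(1)] by (rule U.P.set_add_least[OF T])
    then have "?yH <+>\<^bsub>?P\<^esub> Z \<subseteq> ?T" by (rule U.P.set_add_least[OF T order_trans[OF yK(1) WT(1)]])
    from order_trans[OF j[folded y_def] U.P.satur_mono[OF this]]
    have "?E ?H \<subseteq> satur ?P (?E Q) (W <+>\<^bsub>?P\<^esub> (?E Q \<cdot>\<^bsub>?P\<^esub> ?E ?H))" unfolding QE .
    moreover have "?E ?H = Idl\<^bsub>?P\<^esub> (?c ` S0)" unfolding S0(3) by (rule U.poly_ext_Idl[OF S0(1)])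
    moreover have "finite (?c ` S0)" "?c ` S0 \<subseteq> carrier ?P" using S0 by auto
    ultimately show ?thesis by (intro U.P.nakayama[OF QQ W])
  qed
  define m where "m = n - Suc e"
  have nm: "n = m + Suc e" "n - 1 = m + e" using n by (auto simp: m_def)
  have "?E (pow_prod R I n M) = pow_prod ?P ?J m (?E ?H)"
    unfolding nm(1) U.poly_ext_pow_prod[OF I M] U.P.pow_prod_add by simp
  also have "\<dots> \<subseteq> satur ?P (?E Q) (pow_prod ?P ?J m W)"
    using red by (intro U.P.pow_prod_satur QQ EH W)
  also have "\<dots> \<subseteq> satur ?P (?E Q) (((PIdl\<^bsub>?P\<^esub> y) \<cdot>\<^bsub>?P\<^esub> ?E (pow_prod R I (n - 1) M)) <+>\<^bsub>?P\<^esub> ?E K)"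
  proof (rule U.P.satur_mono)
    have "pow_prod ?P ?J m W = pow_prod ?P ?J m ?yH <+>\<^bsub>?P\<^esub> pow_prod ?P ?J m (?E K)"
      unfolding W_def using U.P.pow_prod_set_add[OF EH(5) yH EH(3)] .
    also have "pow_prod ?P ?J m ?yH = (PIdl\<^bsub>?P\<^esub> y) \<cdot>\<^bsub>?P\<^esub> ?E (pow_prod R I (n - 1) M)"
    proof -
      have "?E (pow_prod R I (n - 1) M) = pow_prod ?P ?J m (?E ?G)"
        unfolding nm(2) pow_prod_add by (rule U.poly_ext_pow_prod[OF I H(2)])
      then show ?thesis using U.P.pow_prod_comm[OF Py EH(5,2)] by simp
    qed
    also have "\<dots> <+>\<^bsub>?P\<^esub> pow_prod ?P ?J m (?E K) \<subseteq> \<dots> <+>\<^bsub>?P\<^esub> ?E K"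
      by (intro U.P.set_add_mono subset_refl U.P.pow_prod_le EH)
    finally show "pow_prod ?P ?J m W \<subseteq> ((PIdl\<^bsub>?P\<^esub> y) \<cdot>\<^bsub>?P\<^esub> ?E (pow_prod R I (n - 1) M)) <+>\<^bsub>?P\<^esub> ?E K" .
  qed
  finally show ?thesis unfolding y_def by blast
qed

text \<open>It suffices to argue at each prime \<open>Q\<close>, in \<open>R[t]\<close> at \<open>Q[t]\<close>. Write \<open>H = I\<^sup>n M\<close> and let \<open>y\<close> be a generic combination as in
  \<open>local_reduction\<close>, so that \<open>H = y I\<^sup>n\<^sup>-\<^sup>1 M + (H \<inter> K)\<close>, using that \<open>y I\<^sup>n\<^sup>-\<^sup>1 M\<close> lies in \<open>H\<close>. Multiplication by \<open>I\<close> gives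
  \<open>I H = y H + I (H \<inter> K)\<close>. If \<open>y z + w\<close>, with \<open>z \<in> H\<close> and \<open>w \<in> I (H \<inter> K)\<close>, lies in \<open>K\<close>, then
  \<open>y z \<in> K\<close>, hence \<open>z \<in> H \<inter> K\<close> because \<open>y\<close> is no zero divisor, and \<open>y z + w \<in> I (H \<inter> K)\<close>.\<close>

lemma artin_rees_step:
  assumes M: "ideal M R" and K: "ideal K R"
    and T: "torsion_bound R K M s" and G: "gen_bound R K M e"
    and I: "ideal I R" and n: "s \<le> n" "e < n"
  shows "pow_prod R I (Suc n) M \<inter> K \<subseteq> I \<cdot> (pow_prod R I n M \<inter> K)"
proof
  interpret U: UP_cring R "UP R" by unfold_locales simp_all
  let ?P = "UP R" and ?c = "\<lambda>s. up_ring.monom (UP R) s 0"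
  let ?E = "poly_ext R"
  obtain F where F: "F \<subseteq> carrier R" "finite F" "I = Idl F" using finetely_gen[OF I] by blast
  obtain xs where "set xs = F" using finite_list[OF F(2)] by blast
  then have xs: "set xs \<subseteq> carrier R" "I = Idl (set xs)" using F by auto
  define H where "H = pow_prod R I n M"
  define H1 where "H1 = pow_prod R I (n - 1) M"
  have iH: "ideal H R" "ideal H1 R" unfolding H_def H1_def using pow_prod_ideal[OF I M] by auto
  have HH1: "H = I \<cdot> H1" unfolding H_def H1_def using n(2) by (metis Suc_diff_1 gr_implies_not_zero gr0I pow_prod_Suc)
  have iHK: "ideal (H \<inter> K) R" using i_intersect[OF iH(1) K] .
  define L where "L = I \<cdot> (H \<inter> K)"
  have iL: "ideal L R" unfolding L_def using ideal_prod_is_ideal[OF I iHK] .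
  have LK: "L \<subseteq> K" unfolding L_def using ideal_prod_le2[OF I iHK] by blast
  have EH: "ideal (?E H) ?P" "ideal (?E H1) ?P" "ideal (?E K) ?P" "ideal (?E I) ?P" "ideal (?E (H \<inter> K)) ?P" "ideal (?E L) ?P"
    using U.poly_ext_ideal iH K I iHK iL by auto
  fix x assume x: "x \<in> pow_prod R I (Suc n) M \<inter> K"
  then have xIH: "x \<in> I \<cdot> H" by (simp add: pow_prod_Suc H_def)
  have xc: "x \<in> carrier R" using x ideal_subset[OF K] by blast
  have "x \<in> L"
  proof (rule in_ideal_if_locally[OF iL xc])
    fix Q assume Q: "primeideal Q R"
    have QQ: "primeideal (?E Q) ?P" using U.poly_ext_prime[OF Q] .
    from local_reduction[OF M K G Q xs(1) n(2)] obtain j where j: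
      "?E H \<subseteq> satur ?P (?E Q) (((PIdl\<^bsub>?P\<^esub> (generic_comb R xs j)) \<cdot>\<^bsub>?P\<^esub> ?E H1) <+>\<^bsub>?P\<^esub> ?E K)"
      unfolding H_def H1_def xs(2) by blast
    define y where "y = generic_comb R xs j"
    have yI: "y \<in> ?E I" unfolding y_def using genideal_self[OF xs(1)] xs(2) by (intro U.generic_comb_in I) auto
    have yc: "y \<in> carrier ?P" using yI U.P.ideal_subset[OF EH(4)] by blast
    have Py: "ideal (PIdl\<^bsub>?P\<^esub> y) ?P" using U.P.cgenideal_ideal[OF yc] .
    have yH1: "ideal ((PIdl\<^bsub>?P\<^esub> y) \<cdot>\<^bsub>?P\<^esub> ?E H1) ?P" using U.P.ideal_prod_is_ideal[OF Py EH(2)] .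
    let ?T = "((PIdl\<^bsub>?P\<^esub> y) \<cdot>\<^bsub>?P\<^esub> ?E H1) <+>\<^bsub>?P\<^esub> ?E (H \<inter> K)"
    have T': "ideal ?T ?P" using U.P.add_ideals[OF yH1 EH(5)] .
    have yEH: "y \<otimes>\<^bsub>?P\<^esub> g \<in> ?E H" if "g \<in> ?E H1" for g
      unfolding HH1 U.poly_ext_prod[OF I iH(2)] using yI that by (rule ideal_prod.prod)
    \<comment> \<open>modular law, as \<open>y I\<^sup>n\<^sup>-\<^sup>1 M\<close> lies in \<open>H\<close>\<close>
    have mod: "?E H \<subseteq> satur ?P (?E Q) ?T"
    proof
      fix h assume h: "h \<in> ?E H"
      then have "h \<in> satur ?P (?E Q) (((PIdl\<^bsub>?P\<^esub> y) \<cdot>\<^bsub>?P\<^esub> ?E H1) <+>\<^bsub>?P\<^esub> ?E K)" using j y_def by blast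
      then obtain a where a: "a \<in> carrier ?P" "a \<notin> ?E Q"
        "a \<otimes>\<^bsub>?P\<^esub> h \<in> ((PIdl\<^bsub>?P\<^esub> y) \<cdot>\<^bsub>?P\<^esub> ?E H1) <+>\<^bsub>?P\<^esub> ?E K" "h \<in> carrier ?P" by (rule U.P.saturE)
      from a(3) obtain u k where u: "u \<in> (PIdl\<^bsub>?P\<^esub> y) \<cdot>\<^bsub>?P\<^esub> ?E H1" "k \<in> ?E K"
        "a \<otimes>\<^bsub>?P\<^esub> h = u \<oplus>\<^bsub>?P\<^esub> k" by (rule U.P.set_addE)
      have uH: "u \<in> ?E H" using u(1) yEH U.P.PIdl_prod_iff[OF EH(2) yc] by auto
      have uk: "u \<in> carrier ?P" "k \<in> carrier ?P" using uH u(2) U.P.ideal_subset EH by blast+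
      have "k = (k \<oplus>\<^bsub>?P\<^esub> u) \<ominus>\<^bsub>?P\<^esub> u" using U.P.add_minus_cancel[OF uk(2,1)] by simp
      also have "k \<oplus>\<^bsub>?P\<^esub> u = a \<otimes>\<^bsub>?P\<^esub> h" unfolding u(3) using uk by (rule U.P.a_comm[rotated])
      finally have "k \<in> ?E H" using U.P.ideal_minus[OF EH(1) U.P.ideal_mult[OF EH(1) h a(1)] uH] by simp
      then have "k \<in> ?E (H \<inter> K)" using u(2) by (simp add: U.poly_ext_Int)
      then have "a \<otimes>\<^bsub>?P\<^esub> h \<in> ?T" unfolding u(3) using u(1) by (intro U.P.set_addI)
      then show "h \<in> satur ?P (?E Q) ?T" using a by (intro U.P.saturI[of a]) auto
    qed
    have "?E (I \<cdot> H) \<subseteq> satur ?P (?E Q) (?E I \<cdot>\<^bsub>?P\<^esub> ?T)"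
      unfolding U.poly_ext_prod[OF I iH(1)] using U.P.satur_prod_le[OF QQ EH(4) T' mod] .
    also have "?E I \<cdot>\<^bsub>?P\<^esub> ?T = ((PIdl\<^bsub>?P\<^esub> y) \<cdot>\<^bsub>?P\<^esub> ?E H) <+>\<^bsub>?P\<^esub> ?E L"

    proof -
      have "?E I \<cdot>\<^bsub>?P\<^esub> ?E H1 = ?E H" unfolding HH1 U.poly_ext_prod[OF I iH(2)] ..
      moreover have "?E I \<cdot>\<^bsub>?P\<^esub> ?E (H \<inter> K) = ?E L" unfolding L_def U.poly_ext_prod[OF I iHK] ..
      ultimately show ?thesis
        unfolding U.P.ideal_prod_r_distr[OF EH(4) yH1 EH(5)] U.P.ideal_prod_left_comm[OF EH(4) Py EH(2)] by simp
    qed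
    finally have "?c x \<in> satur ?P (?E Q) (((PIdl\<^bsub>?P\<^esub> y) \<cdot>\<^bsub>?P\<^esub> ?E H) <+>\<^bsub>?P\<^esub> ?E L)"
      using U.monom_in_poly_ext[OF ideal_prod_is_ideal[OF I iH(1)] xIH, of 0] by blast
    then obtain a where a: "a \<in> carrier ?P" "a \<notin> ?E Q"
      "a \<otimes>\<^bsub>?P\<^esub> ?c x \<in> ((PIdl\<^bsub>?P\<^esub> y) \<cdot>\<^bsub>?P\<^esub> ?E H) <+>\<^bsub>?P\<^esub> ?E L" "?c x \<in> carrier ?P" by (rule U.P.saturE)
    from a(3) obtain u w where u: "u \<in> (PIdl\<^bsub>?P\<^esub> y) \<cdot>\<^bsub>?P\<^esub> ?E H" and w: "w \<in> ?E L"
        "a \<otimes>\<^bsub>?P\<^esub> ?c x = u \<oplus>\<^bsub>?P\<^esub> w" by (rule U.P.set_addE)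
    from u obtain z where z: "z \<in> ?E H" "u = y \<otimes>\<^bsub>?P\<^esub> z" using U.P.PIdl_prod_iff[OF EH(1) yc] by blast
    have zc: "z \<in> carrier ?P" "w \<in> carrier ?P" using z w U.P.ideal_subset EH by blast+
    have "?c x \<in> ?E K" using x by (intro U.monom_in_poly_ext K) auto
    then have "a \<otimes>\<^bsub>?P\<^esub> ?c x \<in> ?E K" using U.P.ideal_mult[OF EH(3) _ a(1)] by blast
    then have "a \<otimes>\<^bsub>?P\<^esub> ?c x \<ominus>\<^bsub>?P\<^esub> w \<in> ?E K"
      using w U.poly_ext_mono[OF LK] by (intro U.P.ideal_minus[OF EH(3)]) auto
    then have "y \<otimes>\<^bsub>?P\<^esub> z \<in> ?E K" unfolding w(2) z(2) using yc zc by (simp add: U.P.add_minus_cancel)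
    then have "z \<in> ?E K" using T xs(1) n(1) z(1) unfolding torsion_bound_def H_def xs(2) y_def by blast
    then have "z \<in> ?E (H \<inter> K)" using z by (simp add: U.poly_ext_Int)
    then have "u \<in> ?E L" unfolding z(2) L_def U.poly_ext_prod[OF I iHK] using yI by (intro ideal_prod.prod)
    then have "a \<otimes>\<^bsub>?P\<^esub> ?c x \<in> ?E L" unfolding w(2) using w(1) by (rule U.P.ideal_add[OF EH(6)])
    then have "?c x \<otimes>\<^bsub>?P\<^esub> a \<in> ?E L" using U.P.m_comm[OF a(1,4)] by simp
    then have coe: "up_ring.coeff ?P (?c x \<otimes>\<^bsub>?P\<^esub> a) k \<in> L" for k unfolding U.poly_ext_iff by blast
    \<comment> \<open>a coefficient of the denominator in \<open>R[t]\<close> is a denominator in \<open>R\<close>\<close>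
    from a obtain k where k: "up_ring.coeff ?P a k \<notin> Q" by (auto simp: U.poly_ext_iff)
    have kc: "up_ring.coeff ?P a k \<in> carrier R" using a by simp
    have "up_ring.coeff ?P a k \<otimes> x \<in> L"
      using coe[of k] U.coeff_const_mult[OF xc a(1), of k] m_comm[OF kc xc] by simp
    then show "x \<in> satur R Q L" using k kc xc by (intro saturI[of "up_ring.coeff ?P a k"]) auto
  qed
  then show "x \<in> I \<cdot> (pow_prod R I n M \<inter> K)" unfolding L_def H_def .
qed

lemma artin_rees_of_bounds:
  assumes M: "ideal M R" and K: "ideal K R"
    and T: "torsion_bound R K M s" and G: "gen_bound R K M e"
  shows "artin_rees R K M (s + Suc e)"
  by (rule artin_reesI[OF M K]) (use artin_rees_step[OF M K T G] in auto)

text \<open>The Artin-Rees property for \<open>L = K + (m)\<close> places \<open>z\<close> in \<open>I L \<subseteq> K + I m\<close>, say \<open>z = k + m d\<close> with \<open>d\<close> over \<open>I\<close>. Then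
  \<open>y d\<close> lies in the prime \<open>p[t]\<close> for \<open>p = (K : m)\<close>. Either \<open>d\<close> does, or \<open>y\<close> does, and then \<open>I \<subseteq> p\<close> since
  the coefficients of \<open>y\<close> generate \<open>I\<close>, so \<open>d\<close> lies in \<open>p[t]\<close> as well; in both cases \<open>m d\<close> lies in \<open>K[t]\<close>.\<close>

lemma torsion_bound_step:
  assumes M: "ideal M R" and K: "ideal K R" and m: "m \<in> carrier R"
    and p: "primeideal (colon R K m) R"
    and T: "torsion_bound R (K <+> PIdl m) M s" and AR: "artin_rees R (K <+> PIdl m) M r"
  shows "torsion_bound R K M (s + Suc r)"
  unfolding torsion_bound_def
proof (intro allI impI)
  interpret U: UP_cring R "UP R" by unfold_locales simp_all
  let ?P = "UP R" and ?c = "\<lambda>s. up_ring.monom (UP R) s 0"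
  let ?E = "poly_ext R"
  fix xs j and n :: nat and z
  assume xs: "set xs \<subseteq> carrier R" and n: "s + Suc r \<le> n"
    and z: "z \<in> ?E (pow_prod R (Idl (set xs)) n M)" and yz: "generic_comb R xs j \<otimes>\<^bsub>?P\<^esub> z \<in> ?E K"
  define I where "I = Idl (set xs)"
  define y where "y = generic_comb R xs j"
  have yc: "y \<in> carrier ?P" unfolding y_def using U.generic_comb_closed[OF xs] .
  have I: "ideal I R" unfolding I_def using genideal_ideal[OF xs] .
  have Pm: "ideal (PIdl m) R" using cgenideal_ideal[OF m] .
  let ?L = "K <+> PIdl m" and ?p = "colon R K m"
  have L: "ideal ?L R" "K \<subseteq> ?L" using add_ideals[OF K Pm] set_add_le1[OF K Pm] .
  have "z \<in> ?E ?L" using T xs n z yz U.poly_ext_mono[OF L(2)] unfolding torsion_bound_def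
    by (meson add_leD1 subsetD)
  have EK: "ideal (?E K) ?P" "ideal (?E I) ?P" using U.poly_ext_ideal K I by auto
  have iIK: "ideal (pow_prod R I r M \<inter> ?L) R" using i_intersect[OF pow_prod_ideal[OF I M] L(1)] .
  have "pow_prod R I n M \<inter> ?L = pow_prod R I (n - r) (pow_prod R I r M \<inter> ?L)"
    using AR[unfolded artin_rees_def, rule_format, OF I, of n] n by simp
  also have "n - r = Suc (n - Suc r)" using n by simp
  also have "pow_prod R I \<dots> (pow_prod R I r M \<inter> ?L) \<subseteq> I \<cdot> ?L"
    unfolding pow_prod_Suc using pow_prod_le[OF I iIK, of "n - Suc r"] by (intro ideal_prod_mono) auto
  also have "\<dots> = (I \<cdot> K) <+> (I \<cdot> (PIdl m))" using ideal_prod_r_distr[OF I K Pm] .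
  also have "\<dots> \<subseteq> K <+> ((PIdl m) \<cdot> I)"
    using ideal_prod_le2[OF I K] ideal_prod_commute[OF I Pm] by (intro set_add_mono) auto
  finally have "?E (pow_prod R I n M \<inter> ?L) \<subseteq> ?E (K <+> ((PIdl m) \<cdot> I))" by (rule U.poly_ext_mono)
  also have "\<dots> = ?E K <+>\<^bsub>?P\<^esub> (?E (PIdl m) \<cdot>\<^bsub>?P\<^esub> ?E I)"
    unfolding U.poly_ext_add[OF K ideal_prod_is_ideal[OF Pm I]] U.poly_ext_prod[OF Pm I] ..
  finally have "z \<in> ?E K <+>\<^bsub>?P\<^esub> (?E (PIdl m) \<cdot>\<^bsub>?P\<^esub> ?E I)"
    using z \<open>z \<in> ?E ?L\<close> unfolding I_def U.poly_ext_Int by blast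
  then obtain k w where kw: "k \<in> ?E K" "w \<in> ?E (PIdl m) \<cdot>\<^bsub>?P\<^esub> ?E I" "z = k \<oplus>\<^bsub>?P\<^esub> w" by (rule U.P.set_addE)
  have mc: "?c m \<in> carrier ?P" using m by simp
  have "?E (PIdl m) \<subseteq> PIdl\<^bsub>?P\<^esub> (?c m)"
  proof (rule U.poly_ext_least[OF Pm U.P.cgenideal_ideal[OF mc]])
    fix h assume "h \<in> PIdl m"
    then obtain a where a: "a \<in> carrier R" "h = a \<otimes> m" by (auto simp: PIdl_iff)
    then have "?c h = ?c a \<otimes>\<^bsub>?P\<^esub> ?c m" using U.monom_mult[OF a(1) m, of 0 0] by simp
    then show "?c h \<in> PIdl\<^bsub>?P\<^esub> (?c m)" using a by (auto simp: U.P.PIdl_iff)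
  qed
  then have "w \<in> (PIdl\<^bsub>?P\<^esub> (?c m)) \<cdot>\<^bsub>?P\<^esub> ?E I" using kw(2) U.P.ideal_prod_mono[OF _ subset_refl] by blast
  then obtain d where d: "d \<in> ?E I" "w = ?c m \<otimes>\<^bsub>?P\<^esub> d" using U.P.PIdl_prod_iff[OF EK(2) mc] by blast
  have cc: "k \<in> carrier ?P" "d \<in> carrier ?P" using kw(1) d(1) U.P.ideal_subset EK by blast+
  have ip: "ideal ?p R" using prime_ideal[OF p] .
  have colonE: "f \<in> ?E ?p \<longleftrightarrow> ?c m \<otimes>\<^bsub>?P\<^esub> f \<in> ?E K" if f: "f \<in> carrier ?P" for f
  proof -
    have fc: "up_ring.coeff ?P f i \<in> carrier R" for i using f by simp
    have "up_ring.coeff ?P (?c m \<otimes>\<^bsub>?P\<^esub> f) i = up_ring.coeff ?P f i \<otimes> m" for i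
      using U.coeff_const_mult[OF m f] m_comm[OF m fc] by simp
    then show ?thesis using f fc mc by (simp add: U.poly_ext_iff colon_def del: U.coeff_mult)
  qed
  have "y \<otimes>\<^bsub>?P\<^esub> z \<ominus>\<^bsub>?P\<^esub> y \<otimes>\<^bsub>?P\<^esub> k \<in> ?E K"
    using yz U.P.ideal_mult[OF EK(1) kw(1) yc] unfolding y_def by (rule U.P.ideal_minus[OF EK(1)])
  also have "y \<otimes>\<^bsub>?P\<^esub> z \<ominus>\<^bsub>?P\<^esub> y \<otimes>\<^bsub>?P\<^esub> k = ?c m \<otimes>\<^bsub>?P\<^esub> (y \<otimes>\<^bsub>?P\<^esub> d)"
    unfolding kw(3) d(2) using yc cc mc by algebra
  finally have "y \<otimes>\<^bsub>?P\<^esub> d \<in> ?E ?p" using colonE yc cc by simp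
  then have "y \<in> ?E ?p \<or> d \<in> ?E ?p" using primeideal.I_prime[OF U.poly_ext_prime[OF p] yc cc(2)] by blast
  moreover have "?E I \<subseteq> ?E ?p" if "y \<in> ?E ?p"
  proof -
    have "set xs \<subseteq> ?p" using U.generic_comb_content[OF ip xs] that unfolding y_def .
    then show ?thesis unfolding I_def by (intro U.poly_ext_mono genideal_minimal ip)
  qed
  ultimately have "d \<in> ?E ?p" using d(1) by blast
  then have "w \<in> ?E K" using colonE[OF cc(2)] d(2) by simp
  then show "z \<in> ?E K" unfolding kw(3) using kw(1) by (intro U.P.ideal_add[OF EK(1)])
qed

text \<open>For \<open>L = K + (m)\<close> generators of \<open>H\<close> modulo \<open>L\<close> together with generators of \<open>H \<inter> L\<close> modulo \<open>K\<close> generate \<open>H\<close> modulo \<open>K\<close>, and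
  \<open>L/K\<close> is \<open>R/(K : m)\<close>, whose ideals are covered by \<open>loc_gen_bound\<close>.\<close>

lemma gen_bound_step:
  assumes M: "ideal M R" and K: "ideal K R" and m: "m \<in> carrier R"
    and p: "loc_gen_bound R (colon R K m) e1" and G: "gen_bound R (K <+> PIdl m) M e2"
  shows "gen_bound R K M (e1 + e2)"
  unfolding gen_bound_def
proof (intro allI impI)
  fix Q H assume Q: "primeideal Q R" and H: "ideal H R" "H \<subseteq> M"
  have iQ: "ideal Q R" using prime_ideal[OF Q] .
  have Pm: "ideal (PIdl m) R" using cgenideal_ideal[OF m] .
  let ?L = "K <+> PIdl m" and ?p = "colon R K m"
  have L: "ideal ?L R" "K \<subseteq> ?L" using add_ideals[OF K Pm] set_add_le1[OF K Pm] .
  define H1 where "H1 = H \<inter> ?L"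
  have H1: "ideal H1 R" unfolding H1_def using i_intersect[OF H(1) L(1)] .
  have H1K: "ideal (H1 <+> K) R" using add_ideals[OF H1 K] .
  define J where "J = colon R (H1 <+> K) m"
  have J: "ideal J R" unfolding J_def using colon_ideal[OF H1K m] .
  have pJ: "?p \<subseteq> J" using set_add_le2[OF H1 K] by (auto simp: J_def colon_def)
  from p Q J pJ obtain T where T: "T \<subseteq> J" "finite T" "card T \<le> e1"
    "J \<subseteq> satur R Q (Idl T <+> ((Q \<cdot> J) <+> ?p))" unfolding loc_gen_bound_def by meson
  have Tc: "T \<subseteq> carrier R" using T(1) ideal_subset[OF J] by blast
  have "\<forall>t\<in>T. \<exists>h\<in>H1. \<exists>k\<in>K. t \<otimes> m = h \<oplus> k"
    using T(1) unfolding J_def colon_def by (auto simp: set_add_def')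
  then obtain \<sigma> where \<sigma>: "\<And>t. t \<in> T \<Longrightarrow> \<sigma> t \<in> H1 \<and> (\<exists>k\<in>K. t \<otimes> m = \<sigma> t \<oplus> k)" by metis
  define S1 where "S1 = \<sigma> ` T"
  have S1: "S1 \<subseteq> H1" "finite S1" "card S1 \<le> e1"
    unfolding S1_def using \<sigma> T card_image_le[OF T(2), of \<sigma>] by auto
  from G Q H obtain S2 where S2: "S2 \<subseteq> H" "finite S2" "card S2 \<le> e2"
    "H \<subseteq> satur R Q (Idl S2 <+> ((Q \<cdot> H) <+> ?L))" unfolding gen_bound_def by meson
  define S where "S = S1 \<union> S2"
  have S: "S \<subseteq> H" "finite S" "card S \<le> e1 + e2"
    unfolding S_def using S1 S2 card_Un_le[of S1 S2] by (auto simp: H1_def)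
  have Sc: "S \<subseteq> carrier R" "S2 \<subseteq> carrier R" using S(1) S2(1) ideal_subset[OF H(1)] by auto
  have QH: "ideal (Q \<cdot> H) R" using ideal_prod_is_ideal[OF iQ H(1)] .
  have QHK: "ideal ((Q \<cdot> H) <+> K) R" using add_ideals[OF QH K] .
  have iS: "ideal (Idl S) R" using genideal_ideal[OF Sc(1)] .
  define B where "B = Idl S <+> ((Q \<cdot> H) <+> K)"
  have B: "ideal B R" unfolding B_def using add_ideals[OF iS QHK] .
  have sB: "ideal (satur R Q B) R" "B \<subseteq> satur R Q B"
    using satur_ideal[OF Q B] satur_le[OF Q B] .
  have "Idl S \<subseteq> B" "(Q \<cdot> H) <+> K \<subseteq> B" unfolding B_def using set_add_le1[OF iS QHK] set_add_le2[OF iS QHK] .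
  then have incl: "Idl S \<subseteq> satur R Q B" "Q \<cdot> H \<subseteq> satur R Q B" "K \<subseteq> satur R Q B"
    using sB(2) set_add_le1[OF QH K] set_add_le2[OF QH K] by auto
  let ?C = "colon R (satur R Q B) m"
  have C: "ideal ?C R" using colon_ideal[OF sB(1) m] .
  have "T \<subseteq> ?C"
  proof
    fix t assume t: "t \<in> T"
    then obtain k where k: "k \<in> K" "t \<otimes> m = \<sigma> t \<oplus> k" using \<sigma> by blast
    have "\<sigma> t \<in> S" using t by (simp add: S_def S1_def)
    then have "\<sigma> t \<in> satur R Q B" using genideal_self[OF Sc(1)] incl(1) by blast
    then have "t \<otimes> m \<in> satur R Q B" unfolding k(2) using k(1) incl(3) by (intro ideal_add[OF sB(1)]) auto
    then show "t \<in> ?C" using t Tc by (auto simp: colon_def)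
  qed
  moreover have "Q \<cdot> J \<subseteq> ?C"
  proof (rule ideal_prod_least[OF C])
    fix q c assume q: "q \<in> Q" and c: "c \<in> J"
    have qc: "q \<in> carrier R" "c \<in> carrier R" using q c ideal_subset iQ J by blast+
    obtain h k where hk: "h \<in> H1" "k \<in> K" "c \<otimes> m = h \<oplus> k"
      using c unfolding J_def colon_def by (auto elim!: set_addE)
    have hkc: "h \<in> carrier R" "k \<in> carrier R" using hk ideal_subset H1 K by blast+
    have "q \<otimes> c \<otimes> m = q \<otimes> h \<oplus> q \<otimes> k" using hk(3) qc hkc m by (simp add: m_assoc r_distr)
    moreover have "q \<otimes> h \<in> satur R Q B"
      using ideal_prod.prod[of q Q h H R] q hk(1) incl(2) by (auto simp: H1_def)
    moreover have "q \<otimes> k \<in> satur R Q B" using ideal_mult[OF K hk(2) qc(1)] incl(3) by blast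
    ultimately have "q \<otimes> c \<otimes> m \<in> satur R Q B" using ideal_add[OF sB(1)] by simp
    then show "q \<otimes> c \<in> ?C" using qc by (simp add: colon_def)
  qed
  moreover have "?p \<subseteq> ?C" using incl(3) by (auto simp: colon_def)
  moreover have "ideal ?p R" using colon_ideal[OF K m] .
  ultimately have "Idl T <+> ((Q \<cdot> J) <+> ?p) \<subseteq> ?C"
    by (intro set_add_least[OF C] genideal_minimal[OF C])
  from order_trans[OF T(4) satur_mono[OF this]] have "J \<subseteq> satur R Q ?C" .
  then have JC: "c \<otimes> m \<in> satur R Q B" if c: "c \<in> J" for c
  proof -
    from that \<open>J \<subseteq> satur R Q ?C\<close> have "c \<in> satur R Q ?C" by blast
    then obtain a where a: "a \<in> carrier R" "a \<notin> Q" "a \<otimes> c \<in> ?C" "c \<in> carrier R" by (rule saturE)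
    then have "a \<otimes> (c \<otimes> m) \<in> satur R Q B" using m by (simp add: colon_def m_assoc)
    then show ?thesis using satur_absorb[OF Q, of a "c \<otimes> m"] a m by simp
  qed
  have H1B: "H1 \<subseteq> satur R Q B"
  proof
    fix x assume x: "x \<in> H1"
    then have "x \<in> ?L" by (simp add: H1_def)
    then obtain k c where k: "k \<in> K" "c \<in> carrier R" "x = k \<oplus> c \<otimes> m" by (auto simp: PIdl_iff elim!: set_addE)
    have kc: "k \<in> carrier R" "x \<in> carrier R" using k(1) x ideal_subset K H1 by blast+
    have "c \<otimes> m = x \<oplus> \<ominus> k" unfolding k(3) using kc(1) k(2) m by algebra
    then have "c \<otimes> m \<in> H1 <+> K" using x ideal_uminus[OF K k(1)] by (simp add: set_addI)
    then have "c \<in> J" using k(2) by (simp add: J_def colon_def)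
    then show "x \<in> satur R Q B" unfolding k(3) using JC k(1) incl(3) by (intro ideal_add[OF sB(1)]) auto
  qed
  have "H \<subseteq> satur R Q B"
  proof
    fix x assume x: "x \<in> H"
    then have "x \<in> satur R Q (Idl S2 <+> ((Q \<cdot> H) <+> ?L))" using S2(4) by blast
    then obtain a where a: "a \<in> carrier R" "a \<notin> Q" "a \<otimes> x \<in> Idl S2 <+> ((Q \<cdot> H) <+> ?L)" "x \<in> carrier R"
      by (rule saturE)
    from a(3) obtain s v where sv: "s \<in> Idl S2" "v \<in> (Q \<cdot> H) <+> ?L" "a \<otimes> x = s \<oplus> v" by (rule set_addE)
    from sv(2) obtain u l where "u \<in> Q \<cdot> H" "l \<in> ?L" "v = u \<oplus> l" by (rule set_addE)
    then have d: "s \<in> Idl S2" "u \<in> Q \<cdot> H" "l \<in> ?L" "a \<otimes> x = s \<oplus> (u \<oplus> l)" using sv by auto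
    have sH: "s \<in> H" using d(1) genideal_minimal[OF H(1) S2(1)] by blast
    have uH: "u \<in> H" using d(2) ideal_prod_le2[OF iQ H(1)] by blast
    have cc: "s \<in> carrier R" "u \<in> carrier R" "l \<in> carrier R"
      using sH uH d(3) ideal_subset H(1) L(1) by blast+
    have "l = (s \<oplus> (u \<oplus> l)) \<ominus> (s \<oplus> u)" using cc by algebra
    then have "l = a \<otimes> x \<ominus> (s \<oplus> u)" using d(4) by simp
    then have "l \<in> H" using ideal_minus[OF H(1) ideal_mult[OF H(1) x a(1)] ideal_add[OF H(1) sH uH]] by simp
    then have "l \<in> satur R Q B" using d(3) H1B by (auto simp: H1_def)
    moreover have "s \<in> satur R Q B" using d(1) incl(1) Idl_mono[of S2 S] Sc(1) by (auto simp: S_def)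
    moreover have "u \<in> satur R Q B" using d(2) incl(2) by blast
    ultimately have "a \<otimes> x \<in> satur R Q B" unfolding d(4) by (intro ideal_add[OF sB(1)])
    then show "x \<in> satur R Q B" using satur_absorb[OF Q, of a x] a by simp
  qed
  then show "\<exists>S\<subseteq>H. finite S \<and> card S \<le> e1 + e2 \<and> H \<subseteq> satur R Q (Idl S <+> ((Q \<cdot> H) <+> K))"
    using S unfolding B_def by blast
qed

text \<open>Descending induction along a prime filtration of \<open>M/N\<close>. The two bounds for \<open>K + (m)\<close> imply the Artin-Rees property for
  \<open>K + (m)\<close>, and with it the two bounds for \<open>K\<close>.\<close>

theorem artin_rees_uniform:
  assumes M: "ideal M R" and N: "ideal N R" "N \<subseteq> M"
    and bd: "\<And>p. primeideal p R \<Longrightarrow> {c \<in> carrier R. \<forall>m\<in>M. c \<otimes> m \<in> N} \<subseteq> p \<Longrightarrow> \<exists>e. loc_gen_bound R p e"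
  shows "\<exists>s \<ge> 1. artin_rees R N M s"
proof -
  interpret U: UP_cring R "UP R" by unfold_locales simp_all
  have "\<exists>s e. torsion_bound R K M s \<and> gen_bound R K M e" if "prime_filt R M K" "N \<subseteq> K" for K
    using that
  proof (induct rule: prime_filt.induct)
    case prime_filt_top
    have "torsion_bound R M M 0"
      unfolding torsion_bound_def
      using U.poly_ext_mono[OF pow_prod_le[OF genideal_ideal M]] by blast
    moreover have "gen_bound R M M 0"
      unfolding gen_bound_def
    proof (intro allI impI)
      fix Q H assume Q: "primeideal Q R" and H: "ideal H R" "H \<subseteq> M"
      have QH: "ideal (Q \<cdot> H) R" using ideal_prod_is_ideal[OF prime_ideal[OF Q] H(1)] .
      have e: "ideal (Idl {}) R" by (rule genideal_ideal) simp
      have "H \<subseteq> Idl {} <+> ((Q \<cdot> H) <+> M)"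
        using H(2) set_add_le2[OF QH M] set_add_le2[OF e add_ideals[OF QH M]] by blast
      then have "H \<subseteq> satur R Q (Idl {} <+> ((Q \<cdot> H) <+> M))" by (rule satur_leI[OF Q ideal_subset[OF H(1)]])
      then show "\<exists>S\<subseteq>H. finite S \<and> card S \<le> 0 \<and> H \<subseteq> satur R Q (Idl S <+> ((Q \<cdot> H) <+> M))"
        by (intro exI[of _ "{}"]) auto
    qed
    ultimately show ?case by blast
  next
    case (prime_filt_step K m)
    have m: "m \<in> carrier R" using prime_filt_step(5) ideal_subset[OF M] by blast
    have Pm: "ideal (PIdl m) R" using cgenideal_ideal[OF m] .
    note K = prime_filt_step(3)
    have L: "ideal (K <+> PIdl m) R" "N \<subseteq> K <+> PIdl m"
      using add_ideals[OF K Pm] set_add_le1[OF K Pm] prime_filt_step(7) by auto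
    obtain s e where se: "torsion_bound R (K <+> PIdl m) M s" "gen_bound R (K <+> PIdl m) M e"
      using prime_filt_step(2)[OF L(2)] by blast
    have "{c \<in> carrier R. \<forall>m\<in>M. c \<otimes> m \<in> N} \<subseteq> colon R K m"
      using prime_filt_step(5,7) by (auto simp: colon_def)
    then obtain e' where e': "loc_gen_bound R (colon R K m) e'" using bd[OF prime_filt_step(6)] by blast
    show ?case
      using torsion_bound_step[OF M K m prime_filt_step(6) se(1) artin_rees_of_bounds[OF M L(1) se]]
        gen_bound_step[OF M K m e' se(2)] by blast
  qed
  from this[OF prime_filt_exists[OF M N] subset_refl] show ?thesis
    using artin_rees_of_bounds[OF M N(1)] by (metis add_Suc_right le_add1 plus_1_eq_Suc)
qed

end


section \<open>Regular loci of one-dimensional domains\<close>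

lemma (in ring_hom_cring) prime_image_iff:
  assumes P: "primeideal P R" "{x \<in> carrier R. h x = \<zero>\<^bsub>S\<^esub>} \<subseteq> P" and x: "x \<in> carrier R"
  shows "h x \<in> h ` P \<longleftrightarrow> x \<in> P"
proof
  have iP: "ideal P R" using R.prime_ideal[OF P(1)] .
  assume "h x \<in> h ` P"
  then obtain y where y: "y \<in> P" "h x = h y" by blast
  have yc: "y \<in> carrier R" using y R.ideal_subset[OF iP] by blast
  have "h (x \<ominus>\<^bsub>R\<^esub> y) = \<zero>\<^bsub>S\<^esub>" using y(2) x yc by (simp add: a_minus_def S.r_neg)
  then have "x \<ominus>\<^bsub>R\<^esub> y \<in> P" using P(2) x yc by auto
  then have "(x \<ominus>\<^bsub>R\<^esub> y) \<oplus>\<^bsub>R\<^esub> y \<in> P" using y(1) by (rule R.ideal_add[OF iP])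
  moreover have "(x \<ominus>\<^bsub>R\<^esub> y) \<oplus>\<^bsub>R\<^esub> y = x" using x yc by (simp add: a_minus_def R.a_assoc R.l_neg)
  ultimately show "x \<in> P" by simp
qed simp

text \<open>As \<open>P\<close> contains the kernel, membership in \<open>P\<close> can be read off from the image.\<close>

lemma (in ring_hom_cring) prime_image:
  assumes surj: "h ` carrier R = carrier S"
    and P: "primeideal P R" "{x \<in> carrier R. h x = \<zero>\<^bsub>S\<^esub>} \<subseteq> P"
  shows "primeideal (h ` P) S"
proof (rule primeidealI[OF _ S.is_cring])
  have iP: "ideal P R" using R.prime_ideal[OF P(1)] .
  have Pc: "P \<subseteq> carrier R" using R.ideal_subset[OF iP] .
  show "ideal (h ` P) S"
  proof (rule S.idealI')
    show "h ` P \<subseteq> carrier S" using Pc by auto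
    show "\<zero>\<^bsub>S\<^esub> \<in> h ` P" using R.ideal_zero[OF iP] hom_zero by (metis image_eqI)
    fix x y assume "x \<in> h ` P" "y \<in> h ` P"
    then obtain a b where ab: "a \<in> P" "b \<in> P" "x = h a" "y = h b" by blast
    then have "a \<in> carrier R" "b \<in> carrier R" using Pc by auto
    then have "x \<oplus>\<^bsub>S\<^esub> y = h (a \<oplus>\<^bsub>R\<^esub> b)" using ab by simp
    then show "x \<oplus>\<^bsub>S\<^esub> y \<in> h ` P" using R.ideal_add[OF iP ab(1,2)] by simp
  next
    fix c x assume "c \<in> carrier S" "x \<in> h ` P"
    then obtain a b where ab: "a \<in> carrier R" "b \<in> P" "c = h a" "x = h b" using surj by blast
    then have "b \<in> carrier R" using Pc by auto
    then have "c \<otimes>\<^bsub>S\<^esub> x = h (a \<otimes>\<^bsub>R\<^esub> b)" using ab by simp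
    then show "c \<otimes>\<^bsub>S\<^esub> x \<in> h ` P" using R.ideal_mult[OF iP ab(2,1)] by simp
  qed
  have "\<one>\<^bsub>R\<^esub> \<notin> P" using R.prime_one[OF P(1)] by simp
  then have "h \<one>\<^bsub>R\<^esub> \<notin> h ` P" using prime_image_iff[OF P R.one_closed] by simp
  then show "carrier S \<noteq> h ` P" using S.one_closed by auto
  fix c d assume c: "c \<in> carrier S" "d \<in> carrier S" "c \<otimes>\<^bsub>S\<^esub> d \<in> h ` P"
  obtain a where a: "a \<in> carrier R" "c = h a" using c(1) unfolding surj[symmetric] by blast
  obtain b where b: "b \<in> carrier R" "d = h b" using c(2) unfolding surj[symmetric] by blast
  note ab = a(1) b(1) a(2) b(2)
  have "h (a \<otimes>\<^bsub>R\<^esub> b) \<in> h ` P" using c(3) ab by simp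
  then have "a \<otimes>\<^bsub>R\<^esub> b \<in> P" using prime_image_iff[OF P R.m_closed[OF ab(1,2)]] by blast
  then show "c \<in> h ` P \<or> d \<in> h ` P" using primeideal.I_prime[OF P(1) ab(1,2)] ab by auto
qed

lemma krull_dim_le_1D:
  assumes "krull_dim S \<le> 1"
    and "primeideal P0 S" "primeideal P1 S" "primeideal P2 S" "P0 \<subset> P1" "P1 \<subset> P2"
  shows False
proof -
  define p where "p = (\<lambda>i::nat. if i = 0 then P0 else if i = 1 then P1 else P2)"
  have "(\<forall>i\<le>2. primeideal (p i) S) \<and> (\<forall>i<2. p i \<subset> p (Suc i))"
    using assms(2-) by (auto simp: p_def less_Suc_eq numeral_2_eq_2)
  then have "ereal (real 2) \<le> krull_dim S" unfolding krull_dim_def by (intro SUP_upper) blast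
  also have "\<dots> \<le> 1" by fact
  finally show False by simp
qed

lemma krull_dim_le_1I:
  assumes "\<And>P0 P1 P2. primeideal P0 S \<Longrightarrow> primeideal P1 S \<Longrightarrow> primeideal P2 S \<Longrightarrow> P0 \<subset> P1 \<Longrightarrow> P1 \<subset> P2 \<Longrightarrow> False"
  shows "krull_dim S \<le> 1"
  unfolding krull_dim_def
proof (rule SUP_least)
  fix n assume "n \<in> {n. \<exists>p. (\<forall>i\<le>n. primeideal (p i) S) \<and> (\<forall>i<n. p i \<subset> p (Suc i))}"
  then obtain p where p: "\<And>i. i \<le> n \<Longrightarrow> primeideal (p i) S" "\<And>i. i < n \<Longrightarrow> p i \<subset> p (Suc i)" by blast
  have "n \<le> 1"
  proof (rule ccontr)
    assume "\<not> n \<le> 1"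
    then show False using assms[of "p 0" "p 1" "p 2"] p[of 0] p[of 1] p(1)[of 2] by (simp add: numeral_2_eq_2)
  qed
  then show "ereal (real n) \<le> 1" by (simp add: one_ereal_def)
qed

context cring
begin

lemma submonoid_prime_compl:
  assumes "primeideal q R" shows "submonoid (carrier R - q) R"
  using prime_mult[OF assms] prime_one[OF assms] by unfold_locales auto

text \<open>The localisation at the zero ideal of a domain is a field, hence regular of dimension zero. This makes a regular locus
  that is open also nonempty.\<close>

lemma zero_prime_regular:
  assumes z: "primeideal {\<zero>} R"
  shows "{\<zero>} \<in> regular_locus R"
proof -
  let ?S = "carrier R - {\<zero>}"
  let ?L = "localization R ?S"
  let ?q = "loc_frac R ?S"
  have S: "submonoid ?S R" using submonoid_prime_compl[OF z] .
  interpret L: cring ?L using localization_cring[OF S] .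
  have one: "\<one>\<^bsub>?L\<^esub> = ?q \<one> \<one>" and zero: "\<zero>\<^bsub>?L\<^esub> = ?q \<zero> \<one>"
    by (simp_all add: localization_def)
  have oS: "\<one> \<in> ?S" using prime_one[OF z] .
  have ne: "\<one>\<^bsub>?L\<^esub> \<noteq> \<zero>\<^bsub>?L\<^esub>"
  proof
    assume "\<one>\<^bsub>?L\<^esub> = \<zero>\<^bsub>?L\<^esub>"
    then have "\<exists>t\<in>?S. t \<otimes> (\<one> \<otimes> \<one>) = t \<otimes> (\<one> \<otimes> \<zero>)"
      unfolding one zero using loc_frac_eq_iff[OF S, of \<one> \<zero> \<one> \<one>] oS by simp
    then show False by auto
  qed
  have unit: "P \<in> Units ?L" if P: "P \<in> carrier ?L" "P \<noteq> \<zero>\<^bsub>?L\<^esub>" for P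
  proof -
    obtain r s where r: "r \<in> carrier R" "s \<in> ?S" "P = ?q r s"
      by (rule localization_carrier_cases[OF S P(1)])
    have "r \<noteq> \<zero>"
    proof
      assume "r = \<zero>"
      then have "P = \<zero>\<^bsub>?L\<^esub>" unfolding r(3) zero using r oS by (intro loc_frac_eqI[OF S, of _ _ _ _ \<one>]) auto
      then show False using P by simp
    qed
    then have rS: "r \<in> ?S" using r by simp
    have "P \<otimes>\<^bsub>?L\<^esub> ?q s r = ?q (r \<otimes> s) (s \<otimes> r)"
      unfolding r(3) using r rS by (intro localization_mult[OF S]) auto
    also have "\<dots> = \<one>\<^bsub>?L\<^esub>" unfolding one
      using r rS oS loc_S(3)[OF S, of s r] by (intro loc_frac_eqI[OF S, of _ _ _ _ \<one>]) (auto simp: m_comm)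
    finally have e: "P \<otimes>\<^bsub>?L\<^esub> ?q s r = \<one>\<^bsub>?L\<^esub>" .
    have c: "?q s r \<in> carrier ?L" using r rS by (intro loc_frac_closed[OF S]) auto
    show ?thesis using e c P(1) L.m_comm[OF c P(1)] unfolding Units_def by auto
  qed
  have "\<zero>\<^bsub>?L\<^esub> \<notin> Units ?L" using ne by (auto simp: Units_def)
  then have "Units ?L = carrier ?L - {\<zero>\<^bsub>?L\<^esub>}" using unit by (auto simp: Units_def)
  then interpret F: field ?L by (rule L.cring_fieldI)
  have ideals: "J = {\<zero>\<^bsub>?L\<^esub>} \<or> J = carrier ?L" if "ideal J ?L" for J using F.all_ideals that by blast
  have Idl0: "{\<zero>\<^bsub>?L\<^esub>} = Idl\<^bsub>?L\<^esub> {}"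
    using L.genideal_minimal[OF L.zeroideal, of "{}"] L.ideal_zero[OF L.genideal_ideal[of "{}"]] by auto
  have "noetherian_ring ?L"
  proof (rule L.noetherian_ringI)
    fix J assume "ideal J ?L"
    then show "\<exists>G\<subseteq>carrier ?L. finite G \<and> J = Idl\<^bsub>?L\<^esub> G"
    proof (rule ideals[THEN disjE])
      assume "J = {\<zero>\<^bsub>?L\<^esub>}"
      then show ?thesis using Idl0 by (intro exI[of _ "{}"]) simp
    next
      assume "J = carrier ?L"
      then show ?thesis using L.genideal_one by (intro exI[of _ "{\<one>\<^bsub>?L\<^esub>}"]) simp
    qed
  qed
  moreover have prime0: "J = {\<zero>\<^bsub>?L\<^esub>}" if "primeideal J ?L" for J
    using ideals[OF L.prime_ideal[OF that]] primeideal.I_notcarr[OF that] by auto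
  have maxi: "{J. maximalideal J ?L} = {{\<zero>\<^bsub>?L\<^esub>}}"
    using F.zeromaximalideal prime0 L.maximalideal_prime by blast
  have "krull_dim ?L = 0"
  proof -
    let ?n = "{n. \<exists>p. (\<forall>i\<le>n. primeideal (p i) ?L) \<and> (\<forall>i<n. p i \<subset> p (Suc i))}"
    have "?n = {0}"
    proof (intro equalityI subsetI)
      fix n :: nat assume "n \<in> ?n"
      then obtain p where p: "\<And>i. i \<le> n \<Longrightarrow> primeideal (p i) ?L" "\<And>i. i < n \<Longrightarrow> p i \<subset> p (Suc i)" by blast
      show "n \<in> {0}"
      proof (rule ccontr)
        assume "n \<notin> {0}"
        then have "primeideal (p 0) ?L" "primeideal (p (Suc 0)) ?L" and lt: "p 0 \<subset> p (Suc 0)"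
          using p(1)[of 0] p(1)[of "Suc 0"] p(2)[of 0] by simp_all
        then have "p 0 = {\<zero>\<^bsub>?L\<^esub>}" "p (Suc 0) = {\<zero>\<^bsub>?L\<^esub>}" using prime0 by blast+
        then show False using lt by simp
      qed
    next
      fix n :: nat assume "n \<in> {0}"
      then show "n \<in> ?n"
        using F.zeroprimeideal by (auto intro!: exI[of _ "\<lambda>_. {\<zero>\<^bsub>?L\<^esub>}"])
    qed
    then show ?thesis unfolding krull_dim_def by (simp add: zero_ereal_def)
  qed
  then have "ereal (real (card ({} :: ('a \<times> 'a) set set))) = krull_dim ?L" by (simp add: zero_ereal_def)
  ultimately have "regular_local_ring ?L"
    unfolding regular_local_ring_def using maxi Idl0 L.is_cring
    by (intro conjI exI[of _ "{\<zero>\<^bsub>?L\<^esub>}"] exI[of _ "{}"]) auto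
  then show ?thesis using z by (simp add: regular_locus_def Spec_def)
qed

text \<open>The local ring at \<open>q\<close> has dimension at most one, so regularity provides a generating set of its maximal ideal with at
  most one element; the numerator of that element is \<open>g\<close>. For a field the set is empty and \<open>g = 0\<close>.\<close>

lemma regular_locus_principal:
  assumes q: "primeideal q R" and reg: "q \<in> regular_locus R"
    and dim: "\<And>P0 P1 P2. primeideal P0 R \<Longrightarrow> primeideal P1 R \<Longrightarrow> primeideal P2 R \<Longrightarrow> P0 \<subset> P1 \<Longrightarrow> P1 \<subset> P2 \<Longrightarrow> False"
  shows "\<exists>g\<in>q. q \<subseteq> satur R q (PIdl g)"
proof -
  let ?S = "carrier R - q"
  let ?L = "localization R ?S"
  let ?q = "loc_frac R ?S"
  have S: "submonoid ?S R" using submonoid_prime_compl[OF q] .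
  have iq: "ideal q R" using prime_ideal[OF q] .
  interpret L: cring ?L using localization_cring[OF S] .
  have one: "\<one>\<^bsub>?L\<^esub> = ?q \<one> \<one>" and zero: "\<zero>\<^bsub>?L\<^esub> = ?q \<zero> \<one>"
    by (simp_all add: localization_def)
  have oS: "\<one> \<in> ?S" using prime_one[OF q] .
  let ?h = "\<lambda>r. ?q r \<one>"
  have hc: "?h r \<in> carrier ?L" if "r \<in> carrier R" for r using that oS by (intro loc_frac_closed[OF S])
  have hom: "ring_hom_ring R ?L ?h"
  proof (rule ring_hom_ringI[OF ring_axioms L.ring_axioms])
    fix x y assume xy: "x \<in> carrier R" "y \<in> carrier R"
    show "?h (x \<otimes> y) = ?h x \<otimes>\<^bsub>?L\<^esub> ?h y" using localization_mult[OF S xy oS oS] by simp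
    show "?h (x \<oplus> y) = ?h x \<oplus>\<^bsub>?L\<^esub> ?h y" using localization_add[OF S xy oS oS] xy by simp
  qed (use hc one in auto)
  have den: "?q r s \<otimes>\<^bsub>?L\<^esub> ?h s = ?h r" "?h r \<otimes>\<^bsub>?L\<^esub> ?q \<one> s = ?q r s"
    if "r \<in> carrier R" "s \<in> ?S" for r s
  proof -
    have "?q r s \<otimes>\<^bsub>?L\<^esub> ?h s = ?q (r \<otimes> s) (s \<otimes> \<one>)"
      using that oS by (intro localization_mult[OF S]) auto
    also have "\<dots> = ?h r" using that oS by (intro loc_frac_eqI[OF S, of _ _ _ _ \<one>]) (auto simp: m_comm)
    finally show "?q r s \<otimes>\<^bsub>?L\<^esub> ?h s = ?h r" .
    show "?h r \<otimes>\<^bsub>?L\<^esub> ?q \<one> s = ?q r s"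
      using localization_mult[OF S that(1) one_closed oS that(2)] that by simp
  qed
  have dimL: "krull_dim ?L \<le> 1"
  proof (rule krull_dim_le_1I)
    fix P0 P1 P2 assume P: "primeideal P0 ?L" "primeideal P1 ?L" "primeideal P2 ?L" "P0 \<subset> P1" "P1 \<subset> P2"
    let ?v = "\<lambda>P. {r \<in> carrier R. ?h r \<in> P}"
    have pv: "primeideal (?v P) R" if "primeideal P ?L" for P
      by (rule ring_hom_ring.primeideal_vimage[OF hom is_cring that])
    have strict: "?v P \<subset> ?v P'" if P: "primeideal P ?L" "primeideal P' ?L" "P \<subset> P'" for P P'
    proof -
      obtain w where w: "w \<in> P'" "w \<notin> P" using P(3) by blast
      have iP: "ideal P ?L" "ideal P' ?L" using P L.prime_ideal by auto
      have "w \<in> carrier ?L" using w(1) L.ideal_subset[OF iP(2)] by blast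
      then obtain r s where r: "r \<in> carrier R" "s \<in> ?S" "w = ?q r s"
        by (rule localization_carrier_cases[OF S])
      have c: "?h s \<in> carrier ?L" "?q \<one> s \<in> carrier ?L"
        using r oS by (auto intro: hc loc_frac_closed[OF S])
      have "?h r \<in> P'" using ideal.I_r_closed[OF iP(2) w(1) c(1)] den(1)[OF r(1,2)] r(3) by simp
      moreover have "?h r \<notin> P"
        using ideal.I_r_closed[OF iP(1) _ c(2), of "?h r"] den(2)[OF r(1,2)] r(3) w(2) by auto
      ultimately show ?thesis using P(3) r(1) by blast
    qed
    show False using dim[OF pv pv pv strict strict] P by blast
  qed
  from reg have "regular_local_ring ?L" by (simp add: regular_locus_def)
  then obtain m G where nL: "noetherian_ring ?L" and m: "{J. maximalideal J ?L} = {m}"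
    and G: "G \<subseteq> carrier ?L" "finite G" "m = Idl\<^bsub>?L\<^esub> G" "ereal (real (card G)) = krull_dim ?L"
    unfolding regular_local_ring_def by blast
  interpret N: noetherian_cring ?L using nL L.is_cring by (simp add: noetherian_cring_def)
  have mm: "maximalideal m ?L" using m by blast
  have im: "ideal m ?L" using maximalideal.axioms(1)[OF mm] .
  have mc: "m \<noteq> carrier ?L" using maximalideal.I_notcarr[OF mm] by auto
  have "card G \<le> 1" using dimL unfolding G(4)[symmetric] by (simp add: one_ereal_def)
  have in_m: "J \<subseteq> m" if J: "ideal J ?L" "J \<noteq> carrier ?L" for J
  proof -
    let ?T = "{I. ideal I ?L \<and> J \<subseteq> I \<and> I \<noteq> carrier ?L}"
    obtain I where I: "I \<in> ?T" "\<forall>I'\<in>?T. I \<subseteq> I' \<longrightarrow> I' = I"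
      using N.maximal_ideal_in[of ?T] J by blast
    have "maximalideal I ?L"
    proof (rule maximalidealI)
      fix J' assume "ideal J' ?L" "I \<subseteq> J'"
      then have "J' = I" if "J' \<noteq> carrier ?L"
      proof -
        have "J' \<in> ?T" using that I(1) \<open>ideal J' ?L\<close> \<open>I \<subseteq> J'\<close> by auto
        then show ?thesis using I(2) \<open>I \<subseteq> J'\<close> by blast
      qed
      then show "J' = I \<or> J' = carrier ?L" by blast
    qed (use I(1) in auto)
    then show ?thesis using m I(1) by blast
  qed
  have qm: "?h y \<in> m" if y: "y \<in> q" for y
  proof -
    have yc: "y \<in> carrier R" using y ideal_subset[OF iq] by blast
    have Py: "ideal (PIdl\<^bsub>?L\<^esub> (?h y)) ?L" using L.cgenideal_ideal[OF hc[OF yc]] .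
    have "\<one>\<^bsub>?L\<^esub> \<notin> PIdl\<^bsub>?L\<^esub> (?h y)"
    proof
      assume "\<one>\<^bsub>?L\<^esub> \<in> PIdl\<^bsub>?L\<^esub> (?h y)"
      then obtain c where c: "c \<in> carrier ?L" "\<one>\<^bsub>?L\<^esub> = c \<otimes>\<^bsub>?L\<^esub> ?h y" by (auto simp: L.PIdl_iff)
      obtain r s where r: "r \<in> carrier R" "s \<in> ?S" "c = ?q r s"
        by (rule localization_carrier_cases[OF S c(1)])
      have "?q \<one> \<one> = ?q (r \<otimes> y) s"
        using c(2) localization_mult[OF S r(1) yc r(2) oS] r one by simp
      then obtain t where t: "t \<in> ?S" "t \<otimes> (s \<otimes> \<one>) = t \<otimes> (\<one> \<otimes> (r \<otimes> y))"
        using loc_frac_eq_iff[OF S, of \<one> "r \<otimes> y" \<one> s] r yc oS by auto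
      have "t \<otimes> (\<one> \<otimes> (r \<otimes> y)) \<in> q" using t r yc ideal_mult[OF iq ideal_mult[OF iq y r(1)]] by simp
      then have "t \<otimes> s \<in> q" using t r by simp
      then show False using prime_mult[OF q t(1) r(2)] by simp
    qed
    then have "PIdl\<^bsub>?L\<^esub> (?h y) \<noteq> carrier ?L" by auto
    then show ?thesis using in_m[OF Py] L.cgenideal_self[OF hc[OF yc]] by blast
  qed
  have mq: "r \<in> q" if r: "r \<in> carrier R" "s \<in> ?S" "?q r s \<in> m" for r s
  proof (rule ccontr)
    assume "r \<notin> q"
    then have rS: "r \<in> ?S" using r by simp
    have "?q r s \<otimes>\<^bsub>?L\<^esub> ?q s r = ?q (r \<otimes> s) (s \<otimes> r)"
      using r rS by (intro localization_mult[OF S]) auto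
    also have "\<dots> = \<one>\<^bsub>?L\<^esub>" unfolding one
      using r rS oS loc_S(3)[OF S, of s r] by (intro loc_frac_eqI[OF S, of _ _ _ _ \<one>]) (auto simp: m_comm)
    finally have "\<one>\<^bsub>?L\<^esub> \<in> m"
      using ideal.I_r_closed[OF im r(3), of "?q s r"] loc_frac_closed[OF S, of s r] r rS by auto
    then show False using ideal.one_imp_carrier[OF im] mc by simp
  qed
  show ?thesis
  proof (cases "G = {}")
    case True
    have "m = {\<zero>\<^bsub>?L\<^esub>}" unfolding G(3) True
      using L.genideal_minimal[OF L.zeroideal, of "{}"] L.ideal_zero[OF L.genideal_ideal[of "{}"]] by auto
    then have y0: "?h y = ?h \<zero>" if "y \<in> q" for y using qm[OF that] zero by simp
    have "q \<subseteq> satur R q (PIdl \<zero>)"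
    proof
      fix y assume y: "y \<in> q"
      have yc: "y \<in> carrier R" using y ideal_subset[OF iq] by blast
      obtain t where t: "t \<in> ?S" "t \<otimes> (\<one> \<otimes> y) = t \<otimes> (\<one> \<otimes> \<zero>)"
        using loc_frac_eq_iff[OF S yc zero_closed oS oS] y0[OF y] by blast
      then have "t \<otimes> y \<in> PIdl \<zero>" using yc cgenideal_self[OF zero_closed] by simp
      then show "y \<in> satur R q (PIdl \<zero>)" using t(1) yc by (intro saturI)
    qed
    then show ?thesis using ideal_zero[OF iq] by blast
  next
    case False
    then have "card G = 1" using \<open>card G \<le> 1\<close> G(2) by (metis card_0_eq le_antisym less_one not_less)
    then obtain w where w: "G = {w}" by (auto simp: card_1_singleton_iff)
    have wc: "w \<in> carrier ?L" "w \<in> m" using G(1) w L.genideal_self[OF G(1)] G(3) by auto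
    obtain r s where r: "r \<in> carrier R" "s \<in> ?S" "w = ?q r s"
      by (rule localization_carrier_cases[OF S wc(1)])
    have rq: "r \<in> q" using mq[OF r(1,2)] wc(2) r(3) by simp
    have "q \<subseteq> satur R q (PIdl r)"
    proof
      fix y assume y: "y \<in> q"
      have yc: "y \<in> carrier R" using y ideal_subset[OF iq] by blast
      have "?h y \<in> PIdl\<^bsub>?L\<^esub> w" using qm[OF y] L.cgenideal_eq_genideal[OF wc(1)] G(3) w by simp
      then obtain c where c: "c \<in> carrier ?L" "?h y = c \<otimes>\<^bsub>?L\<^esub> w" by (auto simp: L.PIdl_iff)
      obtain r' s' where r': "r' \<in> carrier R" "s' \<in> ?S" "c = ?q r' s'"
        by (rule localization_carrier_cases[OF S c(1)])
      have ss: "s' \<otimes> s \<in> ?S" using loc_S(3)[OF S r'(2) r(2)] .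
      have "?h y = ?q (r' \<otimes> r) (s' \<otimes> s)"
        using c(2) localization_mult[OF S r'(1) r(1) r'(2) r(2)] r(3) r'(3) by simp
      then obtain t where t: "t \<in> ?S" "t \<otimes> ((s' \<otimes> s) \<otimes> y) = t \<otimes> (\<one> \<otimes> (r' \<otimes> r))"
        using loc_frac_eq_iff[OF S yc m_closed[OF r'(1) r(1)] oS ss] by blast
      have "(t \<otimes> (s' \<otimes> s)) \<otimes> y = (t \<otimes> r') \<otimes> r"
        using t r(1) r'(1) ss yc by (simp add: m_assoc[of t])
      then have "(t \<otimes> (s' \<otimes> s)) \<otimes> y \<in> PIdl r" using t(1) r'(1) by (auto simp: PIdl_iff)
      moreover have "t \<otimes> (s' \<otimes> s) \<in> ?S" using loc_S(3)[OF S t(1) ss] .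
      ultimately show "y \<in> satur R q (PIdl r)" using yc by (intro saturI)
    qed
    then show ?thesis using rq by blast
  qed
qed

lemma regular_locus_open_generic:
  assumes z: "primeideal {\<zero>} R" and op: "openin (zariski_topology R) (regular_locus R)"
    and dim: "\<And>P0 P1 P2. primeideal P0 R \<Longrightarrow> primeideal P1 R \<Longrightarrow> primeideal P2 R \<Longrightarrow> P0 \<subset> P1 \<Longrightarrow> P1 \<subset> P2 \<Longrightarrow> False"
  shows "\<exists>f\<in>carrier R. f \<noteq> \<zero> \<and> (\<forall>q. primeideal q R \<longrightarrow> f \<notin> q \<longrightarrow> (\<exists>g\<in>q. q \<subseteq> satur R q (PIdl g)))"
proof -
  from op obtain E where E: "E \<subseteq> carrier R" "regular_locus R = {p \<in> Spec R. \<not> E \<subseteq> p}"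
    unfolding openin_zariski by blast
  then obtain f where f: "f \<in> E" "f \<noteq> \<zero>" using zero_prime_regular[OF z] by blast
  have "\<exists>g\<in>q. q \<subseteq> satur R q (PIdl g)" if q: "primeideal q R" "f \<notin> q" for q
  proof (rule regular_locus_principal[OF q(1) _ dim])
    show "q \<in> regular_locus R" using E(2) f q by (auto simp: Spec_def)
  qed
  then show ?thesis using f E(1) by blast
qed

end

text \<open>The domain \<open>S = R/p\<close> has an open regular locus, which contains the generic point and therefore some \<open>D(f)\<close>. The generators \<open>g\<close>
  of the maximal ideals of \<open>S\<close> on \<open>D(f)\<close> are lifted to \<open>R\<close>.\<close>

lemma (in ring_hom_cring) loc_gen_bound_of_regular_image:
  assumes noeth: "noetherian_ring R" and surj: "h ` carrier R = carrier S"
    and p: "primeideal p R" "p = {x \<in> carrier R. h x = \<zero>\<^bsub>S\<^esub>}"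
    and op: "openin (zariski_topology S) (regular_locus S)"
    and dim: "\<And>P Q. primeideal P R \<Longrightarrow> primeideal Q R \<Longrightarrow> p \<subset> P \<Longrightarrow> P \<subseteq> Q \<Longrightarrow> P = Q"
  shows "\<exists>e. loc_gen_bound R p e"
proof -
  interpret N: noetherian_cring R using noeth R.is_cring by (simp add: noetherian_cring_def)
  have ip: "ideal p R" using R.prime_ideal[OF p(1)] .
  have h0: "h \<zero>\<^bsub>R\<^esub> = \<zero>\<^bsub>S\<^esub>" by (rule hom_zero)
  have "h ` p = {\<zero>\<^bsub>S\<^esub>}" using p(2) h0 R.zero_closed by force
  then have z: "primeideal {\<zero>\<^bsub>S\<^esub>} S" using prime_image[OF surj p(1)] p(2) by auto
  have dimS: False if P: "primeideal P0 S" "primeideal P1 S" "primeideal P2 S" "P0 \<subset> P1" "P1 \<subset> P2" for P0 P1 P2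
  proof -
    let ?v = "\<lambda>P. {r \<in> carrier R. h r \<in> P}"
    have pv: "primeideal (?v P) R" if "primeideal P S" for P
      by (rule ring_hom_ring.primeideal_vimage[OF ring_hom_ringI2[OF R.ring_axioms S.ring_axioms homh] R.is_cring that])
    have strict: "?v P \<subset> ?v P'" if pr: "primeideal P' S" and lt: "P \<subset> P'" for P P'
    proof -
      obtain w where w: "w \<in> P'" "w \<notin> P" using lt by blast
      have "w \<in> carrier S" using w(1) S.ideal_subset[OF S.prime_ideal[OF pr]] by blast
      then obtain r where "r \<in> carrier R" "w = h r" unfolding surj[symmetric] by blast
      then show ?thesis using w lt by blast
    qed
    have "p \<subseteq> ?v P0" using p(2) S.ideal_zero[OF S.prime_ideal[OF P(1)]] by auto
    then show False using dim[OF pv[OF P(2)] pv[OF P(3)]] strict[OF P(2,4)] strict[OF P(3,5)] by blast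
  qed
  have "\<exists>f\<in>carrier S. f \<noteq> \<zero>\<^bsub>S\<^esub> \<and>
      (\<forall>q. primeideal q S \<longrightarrow> f \<notin> q \<longrightarrow> (\<exists>g\<in>q. q \<subseteq> satur S q (PIdl\<^bsub>S\<^esub> g)))"
    by (rule S.regular_locus_open_generic[OF z op]) (rule dimS)
  then obtain f' where f': "f' \<in> carrier S" "f' \<noteq> \<zero>\<^bsub>S\<^esub>"
    "\<forall>q. primeideal q S \<longrightarrow> f' \<notin> q \<longrightarrow> (\<exists>g\<in>q. q \<subseteq> satur S q (PIdl\<^bsub>S\<^esub> g))"
    by (elim bexE conjE)
  obtain f where f: "f \<in> carrier R" "h f = f'" using f'(1) unfolding surj[symmetric] by blast
  have "f \<notin> p" using f f'(2) p(2) by simp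
  show ?thesis
  proof (rule N.loc_gen_bound_exists[OF p(1) f(1) \<open>f \<notin> p\<close> dim])
    fix Q assume Q: "primeideal Q R" "p \<subseteq> Q" "f \<notin> Q"
    have Q': "{x \<in> carrier R. h x = \<zero>\<^bsub>S\<^esub>} \<subseteq> Q" using Q(2) p(2) by simp
    have iQ: "ideal Q R" using R.prime_ideal[OF Q(1)] .
    have "f' \<notin> h ` Q" using prime_image_iff[OF Q(1) Q' f(1)] f(2) Q(3) by simp
    then obtain g where g: "g \<in> Q" "h ` Q \<subseteq> satur S (h ` Q) (PIdl\<^bsub>S\<^esub> (h g))"
      using f'(3) prime_image[OF surj Q(1) Q'] by blast
    have gc: "g \<in> carrier R" using g R.ideal_subset[OF iQ] by blast
    have "Q \<subseteq> satur R Q (PIdl\<^bsub>R\<^esub> g <+>\<^bsub>R\<^esub> p)"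
    proof
      fix y assume y: "y \<in> Q"
      have yc: "y \<in> carrier R" using y R.ideal_subset[OF iQ] by blast
      have "h y \<in> satur S (h ` Q) (PIdl\<^bsub>S\<^esub> (h g))" using g(2) y by blast
      then obtain b where b: "b \<in> carrier S" "b \<notin> h ` Q" "b \<otimes>\<^bsub>S\<^esub> h y \<in> PIdl\<^bsub>S\<^esub> (h g)" by (rule S.saturE)
      obtain a where a: "a \<in> carrier R" "b = h a" using b(1) unfolding surj[symmetric] by blast
      have aQ: "a \<notin> Q" using b(2) a by auto
      obtain c where c: "c \<in> carrier S" "b \<otimes>\<^bsub>S\<^esub> h y = c \<otimes>\<^bsub>S\<^esub> h g" using b(3) by (auto simp: S.PIdl_iff)
      obtain d where d: "d \<in> carrier R" "c = h d" using c(1) unfolding surj[symmetric] by blast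
      have "h (a \<otimes>\<^bsub>R\<^esub> y) = h (d \<otimes>\<^bsub>R\<^esub> g)" using c(2) a d yc gc by simp
      then have "h (a \<otimes>\<^bsub>R\<^esub> y \<ominus>\<^bsub>R\<^esub> d \<otimes>\<^bsub>R\<^esub> g) = \<zero>\<^bsub>S\<^esub>"
        using a(1) d(1) yc gc by (simp add: a_minus_def S.r_neg del: hom_mult)
      then have k: "a \<otimes>\<^bsub>R\<^esub> y \<ominus>\<^bsub>R\<^esub> d \<otimes>\<^bsub>R\<^esub> g \<in> p" using p(2) a d yc gc by simp
      have "d \<otimes>\<^bsub>R\<^esub> g \<oplus>\<^bsub>R\<^esub> (a \<otimes>\<^bsub>R\<^esub> y \<ominus>\<^bsub>R\<^esub> d \<otimes>\<^bsub>R\<^esub> g) \<in> PIdl\<^bsub>R\<^esub> g <+>\<^bsub>R\<^esub> p"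
        using k d by (intro R.set_addI) (auto simp: R.PIdl_iff)
      moreover have "d \<otimes>\<^bsub>R\<^esub> g \<oplus>\<^bsub>R\<^esub> (a \<otimes>\<^bsub>R\<^esub> y \<ominus>\<^bsub>R\<^esub> d \<otimes>\<^bsub>R\<^esub> g) = a \<otimes>\<^bsub>R\<^esub> y"
        using a(1) d(1) yc gc by algebra
      ultimately have "a \<otimes>\<^bsub>R\<^esub> y \<in> PIdl\<^bsub>R\<^esub> g <+>\<^bsub>R\<^esub> p" by simp
      then show "y \<in> satur R Q (PIdl\<^bsub>R\<^esub> g <+>\<^bsub>R\<^esub> p)" using a aQ yc by (intro R.saturI[of a]) auto
    qed
    then show "\<exists>g\<in>Q. Q \<subseteq> satur R Q (PIdl\<^bsub>R\<^esub> g <+>\<^bsub>R\<^esub> p)" using g(1) by blast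
  qed
qed

text \<open>\<open>A/p\<close> is generated over \<open>A\<close> by no elements at all. It is replaced by an isomorphic copy on the type
  over which the definition of a J-2 ring quantifies.\<close>

lemma J2_regular_image:
  assumes J2: "J2_ring A" and p: "primeideal p A"
  shows "\<exists>(B :: ('a + nat) list list ring) h. ring_hom_cring A B h \<and> h ` carrier A = carrier B \<and>
    p = {x \<in> carrier (A :: ('a, 'c) ring_scheme). h x = \<zero>\<^bsub>B\<^esub>} \<and> openin (zariski_topology B) (regular_locus B)"
proof -
  interpret A: cring A using J2 by (simp add: J2_ring_def)
  interpret p: primeideal p A by fact
  let ?Q = "A Quot p" and ?f = "\<lambda>a. p +>\<^bsub>A\<^esub> a"
  have Q0: "\<zero>\<^bsub>?Q\<^esub> = p" unfolding FactRing_def ring.simps ..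
  interpret f: ring_hom_cring A ?Q ?f by (rule p.rcos_ring_hom_cring)
  have surj: "?f ` carrier A = carrier ?Q"
    unfolding FactRing_def A_RCOSETS_def' partial_object.simps UNION_singleton_eq_range ..
  have ker: "?f a = \<zero>\<^bsub>?Q\<^esub> \<longleftrightarrow> a \<in> p" if "a \<in> carrier A" for a
    unfolding Q0 using that p.rcos_const_imp_mem A.a_rcos_zero[OF p.is_ideal] by blast
  have "carrier ?Q \<subseteq> generate_ring ?Q (?f ` carrier A \<union> {})"
    unfolding surj by (auto intro: generate_ring.incl)
  moreover have "generate_ring ?Q (?f ` carrier A \<union> {}) \<subseteq> carrier ?Q"
    unfolding surj using f.S.generate_ring_incl by auto
  ultimately have "fin_gen_algebra A ?Q ?f"
    unfolding fin_gen_algebra_def using f.S.is_cring f.homh by (intro conjI exI[of _ "{}"]) auto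
  from fin_gen_algebra_copy[OF A.is_cring this]
  obtain B :: "('a + nat) list list ring" and h where h: "h \<in> ring_iso ?Q B" "fin_gen_algebra A B (h \<circ> ?f)"
    by blast
  have hB: "cring B" "h \<circ> ?f \<in> ring_hom A B" using h(2) by (auto simp: fin_gen_algebra_def)
  have bij: "bij_betw h (carrier ?Q) (carrier B)" and hh: "h \<in> ring_hom ?Q B" using h(1) by (auto simp: ring_iso_def)
  interpret hf: ring_hom_cring A B "h \<circ> ?f"
    using hB A.is_cring by (simp add: ring_hom_cring_def ring_hom_cring_axioms_def)
  interpret hQ: ring_hom_cring ?Q B h
    using hB hh f.S.is_cring by (simp add: ring_hom_cring_def ring_hom_cring_axioms_def)
  have "(h \<circ> ?f) ` carrier A = carrier B" using bij unfolding image_comp[symmetric] surj by (simp add: bij_betw_def)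
  moreover have "p = {x \<in> carrier A. (h \<circ> ?f) x = \<zero>\<^bsub>B\<^esub>}"
  proof -
    have "(h \<circ> ?f) a = \<zero>\<^bsub>B\<^esub> \<longleftrightarrow> a \<in> p" if a: "a \<in> carrier A" for a
    proof -
      have "h (?f a) = h \<zero>\<^bsub>?Q\<^esub> \<longleftrightarrow> ?f a = \<zero>\<^bsub>?Q\<^esub>"
        using bij a by (intro inj_on_eq_iff[of h "carrier ?Q"]) (auto simp: bij_betw_def)
      then show ?thesis using ker[OF a] by simp
    qed
    then show ?thesis using p.Icarr by auto
  qed
  moreover have "openin (zariski_topology B) (regular_locus B)" using J2 h(2) unfolding J2_ring_def by blast
  ultimately show ?thesis using hf.ring_hom_cring_axioms by blast
qed


section \<open>Modules as ideals of the trivial extension\<close>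

text \<open>The trivial extension of \<open>R\<close> by \<open>M\<close>, in which \<open>M\<close> is an ideal of square zero. The submodules of \<open>M\<close> become ideals.\<close>

definition trivial_ext :: "('a, 'c) ring_scheme \<Rightarrow> ('a, 'b, 'd) module_scheme \<Rightarrow> ('a \<times> 'b) ring" where
  "trivial_ext R M = \<lparr>carrier = carrier R \<times> carrier M,
     monoid.mult = (\<lambda>(a, x) (b, y). (a \<otimes>\<^bsub>R\<^esub> b, a \<odot>\<^bsub>M\<^esub> y \<oplus>\<^bsub>M\<^esub> b \<odot>\<^bsub>M\<^esub> x)),
     monoid.one = (\<one>\<^bsub>R\<^esub>, \<zero>\<^bsub>M\<^esub>), ring.zero = (\<zero>\<^bsub>R\<^esub>, \<zero>\<^bsub>M\<^esub>),
     ring.add = (\<lambda>(a, x) (b, y). (a \<oplus>\<^bsub>R\<^esub> b, x \<oplus>\<^bsub>M\<^esub> y))\<rparr>"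

lemma trivial_ext_simps [simp]:
  "carrier (trivial_ext R M) = carrier R \<times> carrier M"
  "(a, x) \<otimes>\<^bsub>trivial_ext R M\<^esub> (b, y) = (a \<otimes>\<^bsub>R\<^esub> b, a \<odot>\<^bsub>M\<^esub> y \<oplus>\<^bsub>M\<^esub> b \<odot>\<^bsub>M\<^esub> x)"
  "\<one>\<^bsub>trivial_ext R M\<^esub> = (\<one>\<^bsub>R\<^esub>, \<zero>\<^bsub>M\<^esub>)"
  "\<zero>\<^bsub>trivial_ext R M\<^esub> = (\<zero>\<^bsub>R\<^esub>, \<zero>\<^bsub>M\<^esub>)"
  "(a, x) \<oplus>\<^bsub>trivial_ext R M\<^esub> (b, y) = (a \<oplus>\<^bsub>R\<^esub> b, x \<oplus>\<^bsub>M\<^esub> y)"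
  by (simp_all add: trivial_ext_def)

context Module.module
begin

lemma trivial_ext_cring: "cring (trivial_ext R M)"
proof (intro cringI abelian_groupI comm_monoidI)
  let ?C = "trivial_ext R M"
  fix z assume "z \<in> carrier ?C"
  then obtain a x where "z = (a, x)" "a \<in> carrier R" "x \<in> carrier M" by auto
  then show "\<exists>w\<in>carrier ?C. w \<oplus>\<^bsub>?C\<^esub> z = \<zero>\<^bsub>?C\<^esub>"
    by (intro bexI[of _ "(\<ominus>\<^bsub>R\<^esub> a, \<ominus>\<^bsub>M\<^esub> x)"]) (auto simp: R.l_neg M.l_neg)
next
  let ?C = "trivial_ext R M"
  fix u v w assume "u \<in> carrier ?C" "v \<in> carrier ?C" "w \<in> carrier ?C"
  then obtain a x b y c z where d: "u = (a, x)" "v = (b, y)" "w = (c, z)"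
    "a \<in> carrier R" "b \<in> carrier R" "c \<in> carrier R" "x \<in> carrier M" "y \<in> carrier M" "z \<in> carrier M"
    by auto
  show "u \<otimes>\<^bsub>?C\<^esub> v \<otimes>\<^bsub>?C\<^esub> w = u \<otimes>\<^bsub>?C\<^esub> (v \<otimes>\<^bsub>?C\<^esub> w)"
  proof -
    have "c \<odot>\<^bsub>M\<^esub> (a \<odot>\<^bsub>M\<^esub> y) = a \<odot>\<^bsub>M\<^esub> (c \<odot>\<^bsub>M\<^esub> y)" "c \<odot>\<^bsub>M\<^esub> (b \<odot>\<^bsub>M\<^esub> x) = (b \<otimes>\<^bsub>R\<^esub> c) \<odot>\<^bsub>M\<^esub> x"
      using d by (simp_all flip: smult_assoc1 add: R.m_comm)
    then show ?thesis using d by (simp add: smult_r_distr smult_assoc1 R.m_assoc M.a_assoc)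
  qed
  show "(u \<oplus>\<^bsub>?C\<^esub> v) \<otimes>\<^bsub>?C\<^esub> w = u \<otimes>\<^bsub>?C\<^esub> w \<oplus>\<^bsub>?C\<^esub> v \<otimes>\<^bsub>?C\<^esub> w"
    using d by (simp add: smult_l_distr smult_r_distr R.l_distr M.a_ac)
qed (auto simp: R.m_comm M.a_ac R.a_ac)

lemma gen_submodule_incl: "S \<subseteq> gen_submodule R M S"
  by (auto simp: gen_submodule_def)

lemma gen_submodule_least: "submodule H R M \<Longrightarrow> S \<subseteq> H \<Longrightarrow> gen_submodule R M S \<subseteq> H"
  by (auto simp: gen_submodule_def)

lemma gen_submodule_submodule:
  assumes "S \<subseteq> carrier M" shows "submodule (gen_submodule R M S) R M"
proof (rule submoduleI)
  show "gen_submodule R M S \<subseteq> carrier M" using gen_submodule_least[OF carrier_is_submodule assms] .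
  show "\<zero>\<^bsub>M\<^esub> \<in> gen_submodule R M S"
    unfolding gen_submodule_def using subgroup.one_closed[OF submodule.axioms(1)] by fastforce
qed (auto simp: gen_submodule_def submoduleE(3-5))

lemma submodule_zero: "submodule H R M \<Longrightarrow> \<zero>\<^bsub>M\<^esub> \<in> H"
  using subgroup.one_closed[OF submodule.axioms(1)] by fastforce

lemma submodule_ideal:
  assumes H: "submodule H R M" shows "ideal ({\<zero>} \<times> H) (trivial_ext R M)"
proof -
  interpret C: cring "trivial_ext R M" by (rule trivial_ext_cring)
  note E = submoduleE[OF H] submodule_zero[OF H]
  show ?thesis
  proof (rule C.idealI')
    fix a z assume "a \<in> carrier (trivial_ext R M)" "z \<in> {\<zero>} \<times> H"
    then obtain b x y where "a = (b, x)" "z = (\<zero>, y)" "b \<in> carrier R" "x \<in> carrier M" "y \<in> H" by auto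
    then show "a \<otimes>\<^bsub>trivial_ext R M\<^esub> z \<in> {\<zero>} \<times> H" using E(1,4) by (auto simp: subset_iff)
  qed (use E in auto)
qed

lemma ideal_times_ideal:
  assumes I: "ideal I R" shows "ideal (I \<times> carrier M) (trivial_ext R M)"
proof -
  interpret C: cring "trivial_ext R M" by (rule trivial_ext_cring)
  have c: "I \<subseteq> carrier R" using R.ideal_subset[OF I] .
  show ?thesis
    by (rule C.idealI') (use c R.ideal_zero[OF I] R.ideal_add[OF I] R.ideal_mult[OF I] in \<open>auto simp: subset_iff\<close>)
qed

lemma scalar_ideal:
  assumes E: "ideal E (trivial_ext R M)" and u: "u \<in> carrier (trivial_ext R M)"
  shows "ideal {a \<in> carrier R. (a, \<zero>\<^bsub>M\<^esub>) \<otimes>\<^bsub>trivial_ext R M\<^esub> u \<in> E} R" (is "ideal ?I R")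
proof -
  interpret C: cring "trivial_ext R M" by (rule trivial_ext_cring)
  let ?C = "trivial_ext R M"
  show ?thesis
  proof (rule R.idealI')
    have "(\<zero>, \<zero>\<^bsub>M\<^esub>) \<otimes>\<^bsub>?C\<^esub> u = \<zero>\<^bsub>?C\<^esub>" using C.l_null[OF u] by simp
    then show "\<zero> \<in> ?I" using C.ideal_zero[OF E] by simp
    fix a b assume a: "a \<in> ?I" and b: "b \<in> ?I"
    then have "(a \<oplus> b, \<zero>\<^bsub>M\<^esub>) \<otimes>\<^bsub>?C\<^esub> u = (a, \<zero>\<^bsub>M\<^esub>) \<otimes>\<^bsub>?C\<^esub> u \<oplus>\<^bsub>?C\<^esub> (b, \<zero>\<^bsub>M\<^esub>) \<otimes>\<^bsub>?C\<^esub> u"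
      using C.l_distr[of "(a, \<zero>\<^bsub>M\<^esub>)" "(b, \<zero>\<^bsub>M\<^esub>)" u] u by simp
    then show "a \<oplus> b \<in> ?I" using a b C.ideal_add[OF E] by simp
  next
    fix a b assume a: "a \<in> carrier R" and b: "b \<in> ?I"
    then have "(a \<otimes> b, \<zero>\<^bsub>M\<^esub>) \<otimes>\<^bsub>?C\<^esub> u = (a, \<zero>\<^bsub>M\<^esub>) \<otimes>\<^bsub>?C\<^esub> ((b, \<zero>\<^bsub>M\<^esub>) \<otimes>\<^bsub>?C\<^esub> u)"
      using C.m_assoc[of "(a, \<zero>\<^bsub>M\<^esub>)" "(b, \<zero>\<^bsub>M\<^esub>)" u] u by simp
    then show "a \<otimes> b \<in> ?I"
      using a b C.ideal_mult[OF E, of _ "(a, \<zero>\<^bsub>M\<^esub>)"] by simp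
  qed auto
qed

text \<open>If \<open>K \<inter> D\<close> is finitely generated and \<open>K\<close> lies in \<open>R u + D\<close>, then \<open>K/(K \<inter> D)\<close> is the image of an ideal of \<open>R\<close>, and \<open>K\<close> is finitely
  generated. Used with \<open>u\<close> a module generator, and once more with \<open>u = 1\<close>, this shows that the trivial extension is
  noetherian.\<close>

lemma fin_gen_extension:
  assumes noeth: "noetherian_ring R"
    and K: "ideal K (trivial_ext R M)" and D: "ideal D (trivial_ext R M)" and u: "u \<in> carrier (trivial_ext R M)"
    and dec: "\<And>z. z \<in> K \<Longrightarrow> \<exists>a\<in>carrier R. \<exists>d\<in>D. z = (a, \<zero>\<^bsub>M\<^esub>) \<otimes>\<^bsub>trivial_ext R M\<^esub> u \<oplus>\<^bsub>trivial_ext R M\<^esub> d"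
    and S: "finite S" "S \<subseteq> K" "K \<inter> D \<subseteq> Idl\<^bsub>trivial_ext R M\<^esub> S"
  shows "\<exists>T. finite T \<and> T \<subseteq> K \<and> K \<subseteq> Idl\<^bsub>trivial_ext R M\<^esub> T"
proof -
  let ?C = "trivial_ext R M"
  interpret C: cring ?C by (rule trivial_ext_cring)
  let ?\<sigma> = "\<lambda>a. (a, \<zero>\<^bsub>M\<^esub>) \<otimes>\<^bsub>?C\<^esub> u"
  have \<sigma>c: "?\<sigma> a \<in> carrier ?C" if "a \<in> carrier R" for a
    using that C.m_closed[of "(a, \<zero>\<^bsub>M\<^esub>)" u] u by simp
  have cK: "K \<subseteq> carrier ?C" "D \<subseteq> carrier ?C" using C.ideal_subset K D by auto
  define I where "I = {a \<in> carrier R. ?\<sigma> a \<in> K <+>\<^bsub>?C\<^esub> D}"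
  have I: "ideal I R" unfolding I_def using scalar_ideal[OF C.add_ideals[OF K D] u] .
  obtain F where F: "F \<subseteq> carrier R" "finite F" "I = Idl F" using noetherian_ring.finetely_gen[OF noeth I] by blast
  have "\<forall>f\<in>F. \<exists>t\<in>K. \<exists>d\<in>D. ?\<sigma> f = t \<oplus>\<^bsub>?C\<^esub> d"
    using R.genideal_self[OF F(1)] F(3) unfolding I_def by (auto simp: set_add_def' simp del: trivial_ext_simps)
  then obtain t where t: "\<And>f. f \<in> F \<Longrightarrow> t f \<in> K \<and> (\<exists>d\<in>D. ?\<sigma> f = t f \<oplus>\<^bsub>?C\<^esub> d)" by metis
  let ?T = "t ` F"
  have TK: "?T \<subseteq> K" using t by auto
  then have Tc: "?T \<subseteq> carrier ?C" using cK by auto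
  have iT: "ideal (Idl\<^bsub>?C\<^esub> ?T) ?C" using C.genideal_ideal[OF Tc] .
  let ?B = "{a \<in> carrier R. ?\<sigma> a \<in> Idl\<^bsub>?C\<^esub> ?T <+>\<^bsub>?C\<^esub> D}"
  have "ideal ?B R" using scalar_ideal[OF C.add_ideals[OF iT D] u] .
  moreover have "F \<subseteq> ?B"
  proof
    fix f assume f: "f \<in> F"
    then obtain d where "d \<in> D" "?\<sigma> f = t f \<oplus>\<^bsub>?C\<^esub> d" using t by blast
    moreover have "t f \<in> Idl\<^bsub>?C\<^esub> ?T" using C.genideal_self[OF Tc] f by auto
    ultimately show "f \<in> ?B" using f F(1) C.set_addI by auto
  qed
  ultimately have IT: "I \<subseteq> ?B" unfolding F(3) by (rule R.genideal_minimal)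
  have STc: "S \<union> ?T \<subseteq> carrier ?C" using S(2) cK Tc by blast
  let ?W = "Idl\<^bsub>?C\<^esub> (S \<union> ?T)"
  have iST: "ideal (?W) ?C" using C.genideal_ideal[OF STc] .
  have incl: "Idl\<^bsub>?C\<^esub> S \<subseteq> ?W" "Idl\<^bsub>?C\<^esub> ?T \<subseteq> ?W"
    using STc by (auto intro!: C.Idl_mono del: subsetI)
  have "K \<subseteq> ?W"
  proof
    fix z assume z: "z \<in> K"
    then obtain a d where a: "a \<in> carrier R" "d \<in> D" "z = ?\<sigma> a \<oplus>\<^bsub>?C\<^esub> d" using dec by blast
    have cc: "z \<in> carrier ?C" "d \<in> carrier ?C" "?\<sigma> a \<in> carrier ?C" using z a \<sigma>c cK by blast+
    have "?\<sigma> a = z \<oplus>\<^bsub>?C\<^esub> \<ominus>\<^bsub>?C\<^esub> d" unfolding a(3) using cc(2,3) by (simp add: C.a_assoc C.r_neg del: trivial_ext_simps)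
    then have "?\<sigma> a \<in> K <+>\<^bsub>?C\<^esub> D" using z C.ideal_uminus[OF D a(2)] C.set_addI by metis
    then have "?\<sigma> a \<in> Idl\<^bsub>?C\<^esub> ?T <+>\<^bsub>?C\<^esub> D" using IT a(1) unfolding I_def by blast
    then obtain v d' where v: "v \<in> Idl\<^bsub>?C\<^esub> ?T" "d' \<in> D" "?\<sigma> a = v \<oplus>\<^bsub>?C\<^esub> d'" by (rule C.set_addE)
    have vK: "v \<in> K" using v(1) C.genideal_minimal[OF K TK] by blast
    have vc: "v \<in> carrier ?C" "d' \<in> carrier ?C" using vK v(2) cK by blast+
    have zv: "z = v \<oplus>\<^bsub>?C\<^esub> (d' \<oplus>\<^bsub>?C\<^esub> d)" unfolding a(3) v(3) using vc cc(2) by (rule C.a_assoc)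
    have dd: "d' \<oplus>\<^bsub>?C\<^esub> d \<in> D" using C.ideal_add[OF D v(2) a(2)] .
    have ddc: "d' \<oplus>\<^bsub>?C\<^esub> d \<in> carrier ?C" using dd cK(2) by blast
    have "d' \<oplus>\<^bsub>?C\<^esub> d = (d' \<oplus>\<^bsub>?C\<^esub> d \<oplus>\<^bsub>?C\<^esub> v) \<ominus>\<^bsub>?C\<^esub> v"
      by (rule C.add_minus_cancel[OF ddc vc(1), symmetric])
    also have "d' \<oplus>\<^bsub>?C\<^esub> d \<oplus>\<^bsub>?C\<^esub> v = z" unfolding zv by (rule C.a_comm[OF ddc vc(1)])
    finally have "d' \<oplus>\<^bsub>?C\<^esub> d \<in> K" using C.ideal_minus[OF K z vK] by simp
    then have ddI: "d' \<oplus>\<^bsub>?C\<^esub> d \<in> ?W" using dd S(3) incl by blast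
    have "v \<in> ?W" using v(1) incl by blast
    then show "z \<in> ?W" unfolding zv using ddI by (rule C.ideal_add[OF iST])
  qed
  then show ?thesis using S TK F(2) by (intro exI[of _ "S \<union> ?T"]) auto
qed

lemma gen_submodule_insert:
  assumes "S \<subseteq> carrier M" "s \<in> carrier M" "x \<in> gen_submodule R M (insert s S)"
  shows "\<exists>a\<in>carrier R. \<exists>d\<in>gen_submodule R M S. x = a \<odot>\<^bsub>M\<^esub> s \<oplus>\<^bsub>M\<^esub> d"
proof -
  let ?H = "{x. \<exists>a\<in>carrier R. \<exists>d\<in>gen_submodule R M S. x = a \<odot>\<^bsub>M\<^esub> s \<oplus>\<^bsub>M\<^esub> d}"
  note G = submoduleE[OF gen_submodule_submodule[OF assms(1)]] submodule_zero[OF gen_submodule_submodule[OF assms(1)]]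
  have c: "d \<in> carrier M" if "d \<in> gen_submodule R M S" for d using that G(1) by blast
  have z0: "\<zero>\<^bsub>M\<^esub> = \<zero> \<odot>\<^bsub>M\<^esub> s \<oplus>\<^bsub>M\<^esub> \<zero>\<^bsub>M\<^esub>" using assms(2) by simp
  have add: "x \<oplus>\<^bsub>M\<^esub> y \<in> ?H" if xy: "x \<in> ?H" "y \<in> ?H" for x y
  proof -
    obtain a d where a: "a \<in> carrier R" "d \<in> gen_submodule R M S" "x = a \<odot>\<^bsub>M\<^esub> s \<oplus>\<^bsub>M\<^esub> d" using xy(1) by blast
    obtain b e where b: "b \<in> carrier R" "e \<in> gen_submodule R M S" "y = b \<odot>\<^bsub>M\<^esub> s \<oplus>\<^bsub>M\<^esub> e" using xy(2) by blast
    have "x \<oplus>\<^bsub>M\<^esub> y = (a \<oplus> b) \<odot>\<^bsub>M\<^esub> s \<oplus>\<^bsub>M\<^esub> (d \<oplus>\<^bsub>M\<^esub> e)"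
      unfolding a(3) b(3) using a(1) b(1) c[OF a(2)] c[OF b(2)] assms(2) by (simp add: smult_l_distr M.a_ac)
    then show ?thesis using a b G(5)[OF a(2) b(2)] R.a_closed[OF a(1) b(1)] by blast
  qed
  have smult: "b \<odot>\<^bsub>M\<^esub> x \<in> ?H" if b: "b \<in> carrier R" and x: "x \<in> ?H" for b x
  proof -
    obtain a d where a: "a \<in> carrier R" "d \<in> gen_submodule R M S" "x = a \<odot>\<^bsub>M\<^esub> s \<oplus>\<^bsub>M\<^esub> d" using x by blast
    have "b \<odot>\<^bsub>M\<^esub> x = (b \<otimes> a) \<odot>\<^bsub>M\<^esub> s \<oplus>\<^bsub>M\<^esub> (b \<odot>\<^bsub>M\<^esub> d)"
      unfolding a(3) using a(1) b c[OF a(2)] assms(2) by (simp add: smult_r_distr smult_assoc1)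
    then show ?thesis using G(4)[OF b a(2)] R.m_closed[OF b a(1)] by blast
  qed
  have Hc: "?H \<subseteq> carrier M" using c assms(2) by auto
  have "submodule ?H R M"
  proof (rule submoduleI[OF Hc _ _ add smult])
    show "\<zero>\<^bsub>M\<^esub> \<in> ?H" using z0 G(7) by blast
    fix x assume x: "x \<in> ?H"
    have "(\<ominus> \<one>) \<odot>\<^bsub>M\<^esub> x \<in> ?H" using smult[OF _ x] by simp
    then show "\<ominus>\<^bsub>M\<^esub> x \<in> ?H" using x Hc smult_l_minus[of \<one> x] by (auto simp: subset_iff)
  qed
  moreover have "insert s S \<subseteq> ?H"
  proof -
    have "s = \<one> \<odot>\<^bsub>M\<^esub> s \<oplus>\<^bsub>M\<^esub> \<zero>\<^bsub>M\<^esub>" using assms(2) by simp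
    then have "s \<in> ?H" using G(7) by blast
    moreover have "y \<in> ?H" if "y \<in> S" for y
    proof -
      have y: "y \<in> gen_submodule R M S" using that gen_submodule_incl by blast
      have "y = \<zero> \<odot>\<^bsub>M\<^esub> s \<oplus>\<^bsub>M\<^esub> y" using assms(2) c[OF y] by simp
      then show ?thesis using y by blast
    qed
    ultimately show ?thesis by blast
  qed
  ultimately have "gen_submodule R M (insert s S) \<subseteq> ?H" by (rule gen_submodule_least)
  then show ?thesis using assms(3) by blast
qed

lemma trivial_ext_noetherian:
  assumes noeth: "noetherian_ring R" and fg: "fin_gen_module R M"
  shows "noetherian_ring (trivial_ext R M)"
proof -
  let ?C = "trivial_ext R M"
  interpret C: cring ?C by (rule trivial_ext_cring)
  have small: "\<exists>T. finite T \<and> T \<subseteq> K \<and> K \<subseteq> Idl\<^bsub>?C\<^esub> T"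
    if "finite S" "S \<subseteq> carrier M" "ideal K ?C" "K \<subseteq> {\<zero>} \<times> gen_submodule R M S" for S K
    using that
  proof (induct S arbitrary: K)
    case empty
    have "submodule {\<zero>\<^bsub>M\<^esub>} R M" by (rule submoduleI) auto
    then have "gen_submodule R M {} \<subseteq> {\<zero>\<^bsub>M\<^esub>}" by (rule gen_submodule_least) simp
    then have "K \<subseteq> {\<zero>\<^bsub>?C\<^esub>}" using empty by auto
    then have "K \<subseteq> Idl\<^bsub>?C\<^esub> {}" using C.ideal_zero[OF C.genideal_ideal[of "{}"]] by auto
    then show ?case by (intro exI[of _ "{}"]) auto
  next
    case (insert s S)
    have s: "s \<in> carrier M" "S \<subseteq> carrier M" using insert by auto
    let ?D = "{\<zero>} \<times> gen_submodule R M S"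
    have D: "ideal ?D ?C" using submodule_ideal[OF gen_submodule_submodule[OF s(2)]] .
    have Gc: "gen_submodule R M S \<subseteq> carrier M" using submoduleE(1)[OF gen_submodule_submodule[OF s(2)]] .
    obtain T where T: "finite T" "T \<subseteq> K \<inter> ?D" "K \<inter> ?D \<subseteq> Idl\<^bsub>?C\<^esub> T"
      using insert(3)[OF s(2) C.i_intersect[OF insert(5) D]] by blast
    show ?case
    proof (rule fin_gen_extension[OF noeth insert(5) D, of "(\<zero>, s)" T])
      fix z assume "z \<in> K"
      then obtain x where x: "z = (\<zero>, x)" "x \<in> gen_submodule R M (insert s S)" using insert(6) by auto
      then obtain a d where a: "a \<in> carrier R" "d \<in> gen_submodule R M S" "x = a \<odot>\<^bsub>M\<^esub> s \<oplus>\<^bsub>M\<^esub> d"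
        using gen_submodule_insert[OF s(2,1)] by blast
      then have "z = (a, \<zero>\<^bsub>M\<^esub>) \<otimes>\<^bsub>?C\<^esub> (\<zero>, s) \<oplus>\<^bsub>?C\<^esub> (\<zero>, d)" using x s Gc by auto
      then show "\<exists>a\<in>carrier R. \<exists>d\<in>?D. z = (a, \<zero>\<^bsub>M\<^esub>) \<otimes>\<^bsub>?C\<^esub> (\<zero>, s) \<oplus>\<^bsub>?C\<^esub> d" using a by blast
    qed (use s T in auto)
  qed
  obtain S where S: "S \<subseteq> carrier M" "finite S" "carrier M = gen_submodule R M S"
    using fg unfolding fin_gen_module_def by blast
  let ?D = "{\<zero>} \<times> carrier M"
  have D: "ideal ?D ?C" using submodule_ideal[OF carrier_is_submodule] .
  show ?thesis
  proof (rule C.noetherian_ringI)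
    fix K assume K: "ideal K ?C"
    have Kc: "K \<subseteq> carrier ?C" using C.ideal_subset[OF K] .
    obtain T where T: "finite T" "T \<subseteq> K \<inter> ?D" "K \<inter> ?D \<subseteq> Idl\<^bsub>?C\<^esub> T"
      using small[OF S(2,1) C.i_intersect[OF K D]] S(3) by blast
    have "\<exists>T. finite T \<and> T \<subseteq> K \<and> K \<subseteq> Idl\<^bsub>?C\<^esub> T"
    proof (rule fin_gen_extension[OF noeth K D, of "\<one>\<^bsub>?C\<^esub>" T])
      fix z assume "z \<in> K"
      then obtain a x where x: "z = (a, x)" "a \<in> carrier R" "x \<in> carrier M" using Kc by auto
      then have "z = (a, \<zero>\<^bsub>M\<^esub>) \<otimes>\<^bsub>?C\<^esub> \<one>\<^bsub>?C\<^esub> \<oplus>\<^bsub>?C\<^esub> (\<zero>, x)" by simp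
      then show "\<exists>a\<in>carrier R. \<exists>d\<in>?D. z = (a, \<zero>\<^bsub>M\<^esub>) \<otimes>\<^bsub>?C\<^esub> \<one>\<^bsub>?C\<^esub> \<oplus>\<^bsub>?C\<^esub> d" using x by blast
    qed (use T in auto)
    then obtain T where T': "finite T" "T \<subseteq> K" "K \<subseteq> Idl\<^bsub>?C\<^esub> T" by blast
    then have "K = Idl\<^bsub>?C\<^esub> T" using C.genideal_minimal[OF K T'(2)] by blast
    then show "\<exists>T\<subseteq>carrier ?C. finite T \<and> K = Idl\<^bsub>?C\<^esub> T"
      using Kc T' by blast
  qed
qed

lemma ideal_smult_subset:
  assumes "I \<subseteq> carrier R" "H \<subseteq> carrier M"
  shows "{a \<odot>\<^bsub>M\<^esub> x | a x. a \<in> I \<and> x \<in> H} \<subseteq> carrier M"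
  using assms by auto

lemma ideal_smult_submodule:
  "I \<subseteq> carrier R \<Longrightarrow> H \<subseteq> carrier M \<Longrightarrow> submodule (ideal_smult R M I H) R M"
  unfolding ideal_smult_def by (intro gen_submodule_submodule ideal_smult_subset)

lemma smult_in_ideal_smult: "a \<in> I \<Longrightarrow> x \<in> H \<Longrightarrow> a \<odot>\<^bsub>M\<^esub> x \<in> ideal_smult R M I H"
  unfolding ideal_smult_def by (rule set_mp[OF gen_submodule_incl]) blast

lemma ideal_smult_least:
  "submodule L R M \<Longrightarrow> (\<And>a x. a \<in> I \<Longrightarrow> x \<in> H \<Longrightarrow> a \<odot>\<^bsub>M\<^esub> x \<in> L) \<Longrightarrow> ideal_smult R M I H \<subseteq> L"
  unfolding ideal_smult_def by (rule gen_submodule_least) auto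

lemma scaled_submodule:
  assumes L: "submodule L R M" and a: "a \<in> carrier R"
  shows "submodule {x \<in> carrier M. a \<odot>\<^bsub>M\<^esub> x \<in> L} R M" (is "submodule ?L R M")
proof (rule submoduleI)
  note E = submoduleE[OF L] submodule_zero[OF L]
  show "\<zero>\<^bsub>M\<^esub> \<in> ?L" using E(7) a by simp
  fix x assume x: "x \<in> ?L"
  then show "\<ominus>\<^bsub>M\<^esub> x \<in> ?L" using E(3) a by (simp add: smult_r_minus)
  fix y assume "y \<in> ?L"
  then show "x \<oplus>\<^bsub>M\<^esub> y \<in> ?L" using x E(5) a by (simp add: smult_r_distr)
next
  note E = submoduleE[OF L]
  fix b x assume b: "b \<in> carrier R" and x: "x \<in> ?L"
  then have "a \<odot>\<^bsub>M\<^esub> (b \<odot>\<^bsub>M\<^esub> x) = b \<odot>\<^bsub>M\<^esub> (a \<odot>\<^bsub>M\<^esub> x)" using a by (simp flip: smult_assoc1 add: R.m_comm)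
  then show "b \<odot>\<^bsub>M\<^esub> x \<in> ?L" using x b E(4) by simp
qed auto

lemma ideal_smult_prod:
  assumes I: "ideal I R" and J: "ideal J R" and H: "submodule H R M"
  shows "ideal_smult R M (I \<cdot> J) H = ideal_smult R M I (ideal_smult R M J H)" (is "?l = ?r")
proof
  have Hc: "H \<subseteq> carrier M" using submoduleE(1)[OF H] .
  have c: "I \<subseteq> carrier R" "J \<subseteq> carrier R" "I \<cdot> J \<subseteq> carrier R" using R.ideal_subset I J R.ideal_prod_is_ideal[OF I J] by auto
  have sJ: "submodule (ideal_smult R M J H) R M" using ideal_smult_submodule[OF c(2) Hc] .
  have sIJ: "submodule (?l) R M" using ideal_smult_submodule[OF c(3) Hc] .
  have sI: "submodule (?r) R M"
    using ideal_smult_submodule[OF c(1) submoduleE(1)[OF sJ]] .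
  show "?l \<subseteq> ?r"
  proof (rule ideal_smult_least[OF sI])
    fix c x assume "c \<in> I \<cdot> J" and x: "x \<in> H"
    then have "c \<in> carrier R \<and> c \<odot>\<^bsub>M\<^esub> x \<in> ?r"
    proof (induct c rule: ideal_prod.induct)
      case (prod i j)
      have "i \<odot>\<^bsub>M\<^esub> (j \<odot>\<^bsub>M\<^esub> x) \<in> ?r"
        using prod x by (intro smult_in_ideal_smult)
      then show ?case using prod x c Hc by (auto simp: smult_assoc1 subset_iff)
    next
      case (sum s1 s2)
      then show ?case using x Hc submoduleE(5)[OF sI] by (auto simp: smult_l_distr subset_iff)
    qed
    then show "c \<odot>\<^bsub>M\<^esub> x \<in> ?r" ..
  qed
  show "?r \<subseteq> ?l"
  proof (rule ideal_smult_least[OF sIJ])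
    fix a x assume a: "a \<in> I" and x: "x \<in> ideal_smult R M J H"
    have ac: "a \<in> carrier R" using a c by blast
    have "ideal_smult R M J H \<subseteq> {x \<in> carrier M. a \<odot>\<^bsub>M\<^esub> x \<in> ?l}"
    proof (rule ideal_smult_least[OF scaled_submodule[OF sIJ ac]])
      fix b y assume b: "b \<in> J" and y: "y \<in> H"
      have bc: "b \<in> carrier R" "y \<in> carrier M" using b c y Hc by blast+
      have "(a \<otimes> b) \<odot>\<^bsub>M\<^esub> y \<in> ?l"
        using a b y by (intro smult_in_ideal_smult ideal_prod.prod)
      then show "b \<odot>\<^bsub>M\<^esub> y \<in> {x \<in> carrier M. a \<odot>\<^bsub>M\<^esub> x \<in> ?l}"
        using ac bc by (simp add: smult_assoc1)
    qed
    then show "a \<odot>\<^bsub>M\<^esub> x \<in> ?l" using x by blast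
  qed
qed

lemma ideal_smult_one:
  assumes H: "submodule H R M" shows "ideal_smult R M (carrier R) H = H"
proof
  show "ideal_smult R M (carrier R) H \<subseteq> H" by (rule ideal_smult_least[OF H]) (rule submoduleE(4)[OF H])
  show "H \<subseteq> ideal_smult R M (carrier R) H"
  proof
    fix x assume x: "x \<in> H"
    then have "\<one> \<odot>\<^bsub>M\<^esub> x \<in> ideal_smult R M (carrier R) H" by (intro smult_in_ideal_smult) auto
    then show "x \<in> ideal_smult R M (carrier R) H" using x submoduleE(1)[OF H] by (auto simp: subset_iff)
  qed
qed

text \<open>The translation of \<open>I H\<close> for a submodule \<open>H\<close>: the second component of \<open>I \<times> M\<close> does not contribute because \<open>M\<close> has square zero.\<close>

lemma ideal_prod_submodule:
  assumes I: "ideal I R" and H: "submodule H R M"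
  shows "(I \<times> carrier M) \<cdot>\<^bsub>trivial_ext R M\<^esub> ({\<zero>} \<times> H) = {\<zero>} \<times> ideal_smult R M I H"
proof
  let ?C = "trivial_ext R M"
  interpret C: cring ?C by (rule trivial_ext_cring)
  have Hc: "H \<subseteq> carrier M" using submoduleE(1)[OF H] .
  have Ic: "I \<subseteq> carrier R" using R.ideal_subset I by auto
  have sI: "submodule (ideal_smult R M I H) R M" using ideal_smult_submodule[OF Ic Hc] .
  have sIc: "ideal_smult R M I H \<subseteq> carrier M" using submoduleE(1)[OF sI] .
  have prod: "(a, x) \<otimes>\<^bsub>?C\<^esub> (\<zero>, y) = (\<zero>, a \<odot>\<^bsub>M\<^esub> y)" if "a \<in> carrier R" "x \<in> carrier M" "y \<in> carrier M" for a x y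
    using that by simp
  show "(I \<times> carrier M) \<cdot>\<^bsub>?C\<^esub> ({\<zero>} \<times> H) \<subseteq> {\<zero>} \<times> ideal_smult R M I H"
  proof (rule C.ideal_prod_least[OF submodule_ideal[OF sI]])
    fix i j assume "i \<in> I \<times> carrier M" "j \<in> {\<zero>} \<times> H"
    then obtain a x y where d: "i = (a, x)" "j = (\<zero>, y)" "a \<in> I" "x \<in> carrier M" "y \<in> H" by auto
    then have "i \<otimes>\<^bsub>?C\<^esub> j = (\<zero>, a \<odot>\<^bsub>M\<^esub> y)" using prod Ic Hc by blast
    then show "i \<otimes>\<^bsub>?C\<^esub> j \<in> {\<zero>} \<times> ideal_smult R M I H" using smult_in_ideal_smult[OF d(3,5)] by simp
  qed
  let ?E = "(I \<times> carrier M) \<cdot>\<^bsub>?C\<^esub> ({\<zero>} \<times> H)"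
  have E: "ideal ?E ?C" using C.ideal_prod_is_ideal[OF ideal_times_ideal[OF I] submodule_ideal[OF H]] .
  let ?Y = "{y \<in> carrier M. (\<zero>, y) \<in> ?E}"
  have "submodule ?Y R M"
  proof (rule submoduleI)
    show "\<zero>\<^bsub>M\<^esub> \<in> ?Y" using C.ideal_zero[OF E] by simp
    have sm: "a \<odot>\<^bsub>M\<^esub> x \<in> ?Y" if "a \<in> carrier R" "x \<in> ?Y" for a x
      using C.ideal_mult[OF E, of "(\<zero>, x)" "(a, \<zero>\<^bsub>M\<^esub>)"] that by simp
    then show "\<And>a x. a \<in> carrier R \<Longrightarrow> x \<in> ?Y \<Longrightarrow> a \<odot>\<^bsub>M\<^esub> x \<in> ?Y" .
    fix x assume x: "x \<in> ?Y"
    then show "\<ominus>\<^bsub>M\<^esub> x \<in> ?Y" using sm[of "\<ominus> \<one>" x] smult_l_minus[of \<one> x] by simp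
    fix y assume y: "y \<in> ?Y"
    then show "x \<oplus>\<^bsub>M\<^esub> y \<in> ?Y"
      using x C.ideal_add[OF E, of "(\<zero>, x)" "(\<zero>, y)"] by simp
  qed auto
  then have "ideal_smult R M I H \<subseteq> ?Y"
  proof (rule ideal_smult_least)
    fix a x assume a: "a \<in> I" and x: "x \<in> H"
    have "(a, \<zero>\<^bsub>M\<^esub>) \<otimes>\<^bsub>?C\<^esub> (\<zero>, x) \<in> ?E" using a x by (intro ideal_prod.prod) auto
    moreover have ac: "a \<in> carrier R" "x \<in> carrier M" using a x Ic Hc by blast+
    ultimately show "a \<odot>\<^bsub>M\<^esub> x \<in> ?Y"
      using prod[OF ac(1) M.zero_closed ac(2)] smult_closed[OF ac] by (simp only: mem_Collect_eq simp_thms)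
  qed
  then show "{\<zero>} \<times> ideal_smult R M I H \<subseteq> ?E" by auto
qed

lemma ideals_pow_ideal: "ideal I R \<Longrightarrow> ideal (I [^]\<^bsub>ideals_set R\<^esub> (n :: nat)) R"
  using monoid.nat_pow_closed[OF comm_monoid.axioms(1)[OF R.ideals_set_is_comm_monoid], of I n]
  by (simp add: ideals_set_def)

lemma pow_prod_submodule:
  assumes I: "ideal I R" and H: "submodule H R M"
  shows "pow_prod (trivial_ext R M) (I \<times> carrier M) n ({\<zero>} \<times> H)
    = {\<zero>} \<times> ideal_smult R M (I [^]\<^bsub>ideals_set R\<^esub> n) H"
  using H
proof (induct n arbitrary: H)
  case 0
  have "I [^]\<^bsub>ideals_set R\<^esub> (0::nat) = carrier R" by (simp add: nat_pow_def ideals_set_def)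
  then show ?case using ideal_smult_one[OF 0] by (simp add: cring.pow_prod_0[OF trivial_ext_cring])
next
  case (Suc n)
  interpret C: cring "trivial_ext R M" by (rule trivial_ext_cring)
  have Hc: "H \<subseteq> carrier M" using submoduleE(1)[OF Suc(2)] .
  have sI: "submodule (ideal_smult R M I H) R M" using ideal_smult_submodule[OF R.ideal_subset[OF I] Hc] .
  have "pow_prod (trivial_ext R M) (I \<times> carrier M) (Suc n) ({\<zero>} \<times> H)
    = pow_prod (trivial_ext R M) (I \<times> carrier M) n ({\<zero>} \<times> ideal_smult R M I H)"
    using C.pow_prod_add[of "I \<times> carrier M" n 1] ideal_prod_submodule[OF I Suc(2)] by (simp add: C.pow_prod_Suc)
  also have "\<dots> = {\<zero>} \<times> ideal_smult R M (I [^]\<^bsub>ideals_set R\<^esub> n) (ideal_smult R M I H)" using Suc(1)[OF sI] .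
  also have "ideal_smult R M (I [^]\<^bsub>ideals_set R\<^esub> n) (ideal_smult R M I H)
     = ideal_smult R M ((I [^]\<^bsub>ideals_set R\<^esub> n) \<cdot> I) H"
    using ideal_smult_prod[OF ideals_pow_ideal[OF I] I Suc(2)] by simp
  also have "(I [^]\<^bsub>ideals_set R\<^esub> n) \<cdot> I = I [^]\<^bsub>ideals_set R\<^esub> (Suc n)" by (simp add: nat_pow_def ideals_set_def)
  finally show ?case .
qed

lemma annihilator_ideal: "ideal (annihilator R M) R"
  by (rule R.idealI') (auto simp: annihilator_def smult_l_distr smult_assoc1)

lemma annihilator_quot:
  assumes N: "submodule N R M" and a: "a \<in> annihilator R (quot_module M N)" and x: "x \<in> carrier M"
  shows "a \<odot>\<^bsub>M\<^esub> x \<in> N"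
proof -
  have Nc: "N \<subseteq> carrier M" using submoduleE(1)[OF N] .
  have z: "\<zero>\<^bsub>M\<^esub> \<in> N" using submodule_zero[OF N] .
  have ac: "a \<in> carrier R" using a by (simp add: annihilator_def)
  have "N +>\<^bsub>M\<^esub> x \<in> carrier (quot_module M N)" using x by (auto simp: quot_module_def A_RCOSETS_def')
  then have "(\<Union>y \<in> N +>\<^bsub>M\<^esub> x. N +>\<^bsub>M\<^esub> (a \<odot>\<^bsub>M\<^esub> y)) = N"
    using a by (auto simp: annihilator_def quot_module_def)
  moreover have "\<zero>\<^bsub>M\<^esub> \<oplus>\<^bsub>M\<^esub> x \<in> N +>\<^bsub>M\<^esub> x" using z by (auto simp: a_r_coset_def')
  moreover have "\<zero>\<^bsub>M\<^esub> \<oplus>\<^bsub>M\<^esub> (a \<odot>\<^bsub>M\<^esub> x) \<in> N +>\<^bsub>M\<^esub> (a \<odot>\<^bsub>M\<^esub> x)" using z by (auto simp: a_r_coset_def')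
  ultimately show ?thesis using x ac by auto
qed

end

lemma no_long_chain_above:
  assumes A: "cring A" and K: "ideal K A" and dim: "krull_dim (A Quot K) \<le> 1"
    and P: "primeideal P0 A" "primeideal P1 A" "primeideal P2 A" "K \<subseteq> P0" "P0 \<subset> P1" "P1 \<subset> P2"
  shows False
proof -
  have surj: "(+>\<^bsub>A\<^esub>) K ` carrier A = carrier (A Quot K)"
    unfolding FactRing_def A_RCOSETS_def' partial_object.simps UNION_singleton_eq_range ..
  have K0: "\<zero>\<^bsub>A Quot K\<^esub> = K" unfolding FactRing_def ring.simps ..
  have ker: "{x \<in> carrier A. K +>\<^bsub>A\<^esub> x = \<zero>\<^bsub>A Quot K\<^esub>} \<subseteq> K"
    unfolding K0 using ideal.rcos_const_imp_mem[OF K] by blast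
  interpret f: ring_hom_cring A "A Quot K" "(+>\<^bsub>A\<^esub>) K" by (rule ideal.rcos_ring_hom_cring[OF K A])
  let ?i = "\<lambda>P. (+>\<^bsub>A\<^esub>) K ` P"
  have kP: "{x \<in> carrier A. K +>\<^bsub>A\<^esub> x = \<zero>\<^bsub>A Quot K\<^esub>} \<subseteq> P" if "K \<subseteq> P" for P using ker that by blast
  have prime: "primeideal (?i P) (A Quot K)" if "primeideal P A" "K \<subseteq> P" for P
    using f.prime_image[OF surj that(1) kP[OF that(2)]] .
  have strict: "?i P \<subset> ?i P'" if h: "primeideal P A" "K \<subseteq> P" "primeideal P' A" "P \<subset> P'" for P P'
  proof -
    obtain w where w: "w \<in> P'" "w \<notin> P" using h(4) by blast
    have "w \<in> carrier A" using w(1) f.R.ideal_subset[OF f.R.prime_ideal[OF h(3)]] by blast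
    then have "K +>\<^bsub>A\<^esub> w \<notin> ?i P" using f.prime_image_iff[OF h(1) kP[OF h(2)]] w(2) by blast
    then show ?thesis using w(1) h(4) by blast
  qed
  have "K \<subseteq> P1" "K \<subseteq> P2" using P by auto
  then show False
    using krull_dim_le_1D[OF dim prime prime prime strict strict] P by blast
qed

theorem theorem1:
  fixes A :: "('a, 'c) ring_scheme"
    and M :: "('a, 'b, 'd) module_scheme"
    and N :: "'b set"
  assumes "J2_ring A"
    and "fin_gen_module A M"
    and "submodule N A M"
    and "fin_gen_module A (M\<lparr>carrier := N\<rparr>)"
    and "module_dim A (quot_module M N) \<le> 1"
  shows "\<exists>s::nat. s \<ge> 1 \<and> (\<forall>n \<ge> s. \<forall>I. ideal I A \<longrightarrow>
           ideal_smult A M (I [^]\<^bsub>ideals_set A\<^esub> n) (carrier M) \<inter> N =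
           ideal_smult A M (I [^]\<^bsub>ideals_set A\<^esub> (n - s))
             (ideal_smult A M (I [^]\<^bsub>ideals_set A\<^esub> s) (carrier M) \<inter> N))"
proof -
  interpret M: Module.module A M using assms(2) by (simp add: fin_gen_module_def)
  interpret Q: Module.module A "quot_module M N" by (rule M.quot_module_module[OF assms(3)])
  have noeth: "noetherian_ring A" using assms(1) by (simp add: J2_ring_def)
  let ?C = "trivial_ext A M"
  interpret C: noetherian_cring ?C
    using M.trivial_ext_noetherian[OF noeth assms(2)] M.trivial_ext_cring by (simp add: noetherian_cring_def)
  let ?M = "{\<zero>\<^bsub>A\<^esub>} \<times> carrier M" and ?N = "{\<zero>\<^bsub>A\<^esub>} \<times> N"
  have iM: "ideal ?M ?C" using M.submodule_ideal[OF M.carrier_is_submodule] .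
  have iN: "ideal ?N ?C" using M.submodule_ideal[OF assms(3)] .
  have Nc: "N \<subseteq> carrier M" using M.submoduleE(1)[OF assms(3)] .
  define K where "K = annihilator A (quot_module M N)"
  have K: "ideal K A" unfolding K_def by (rule Q.annihilator_ideal)
  have dim: "krull_dim (A Quot K) \<le> 1" using assms(5) by (simp add: module_dim_def K_def)
  have "\<exists>s \<ge> 1. artin_rees ?C ?N ?M s"
  proof (rule C.artin_rees_uniform[OF iM iN])
    show "?N \<subseteq> ?M" using Nc by auto
    fix p assume p: "primeideal p ?C" and ann: "{c \<in> carrier ?C. \<forall>m\<in>?M. c \<otimes>\<^bsub>?C\<^esub> m \<in> ?N} \<subseteq> p"
    let ?\<sigma> = "\<lambda>a. (a, \<zero>\<^bsub>M\<^esub>)"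
    have hom: "ring_hom_ring A ?C ?\<sigma>"
      by (rule ring_hom_ringI[OF M.R.ring_axioms C.ring_axioms]) auto
    let ?v = "\<lambda>P. {a \<in> carrier A. ?\<sigma> a \<in> P}"
    have pv: "primeideal (?v P) A" if "primeideal P ?C" for P
      by (rule ring_hom_ring.primeideal_vimage[OF hom M.R.is_cring that])
    have mem: "(a, x) \<in> P \<longleftrightarrow> a \<in> ?v P" if P: "primeideal P ?C" and ax: "a \<in> carrier A" "x \<in> carrier M" for P a x
    proof -
      have iP: "ideal P ?C" using C.prime_ideal[OF P] .
      \<comment> \<open>primes contain the ideal \<open>0 \<times> M\<close> of square zero, so they correspond to the primes of \<open>A\<close>\<close>
      have nil: "(\<zero>\<^bsub>A\<^esub>, y) \<in> P" if "y \<in> carrier M" for y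
      proof -
        have "(\<zero>\<^bsub>A\<^esub>, y) \<otimes>\<^bsub>?C\<^esub> (\<zero>\<^bsub>A\<^esub>, y) \<in> P" using C.ideal_zero[OF iP] that by simp
        then show ?thesis using primeideal.I_prime[OF P, of "(\<zero>\<^bsub>A\<^esub>, y)" "(\<zero>\<^bsub>A\<^esub>, y)"] that by auto
      qed
      have "?\<sigma> a = (a, x) \<oplus>\<^bsub>?C\<^esub> (\<zero>\<^bsub>A\<^esub>, \<ominus>\<^bsub>M\<^esub> x)" "(a, x) = ?\<sigma> a \<oplus>\<^bsub>?C\<^esub> (\<zero>\<^bsub>A\<^esub>, x)"
        using ax by (simp_all add: M.M.r_neg)
      then show ?thesis using C.ideal_add[OF iP] nil ax by (metis (no_types, lifting) M.M.a_inv_closed mem_Collect_eq)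
    qed
    define p0 where "p0 = ?v p"
    have p0: "primeideal p0 A" unfolding p0_def using pv[OF p] .
    have Kp: "K \<subseteq> p0"
    proof
      fix a assume a: "a \<in> K"
      then have ac: "a \<in> carrier A" by (simp add: K_def annihilator_def)
      have "?\<sigma> a \<in> {c \<in> carrier ?C. \<forall>m\<in>?M. c \<otimes>\<^bsub>?C\<^esub> m \<in> ?N}"
        using ac M.annihilator_quot[OF assms(3) a[unfolded K_def]] Nc by (auto simp: subset_iff)
      then show "a \<in> p0" using ann ac unfolding p0_def by blast
    qed
    obtain B :: "('a + nat) list list ring" and h where B: "ring_hom_cring A B h" "h ` carrier A = carrier B"
      "p0 = {x \<in> carrier A. h x = \<zero>\<^bsub>B\<^esub>}" "openin (zariski_topology B) (regular_locus B)"
      using J2_regular_image[OF assms(1) p0] by blast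
    interpret h: ring_hom_cring A B h by fact
    have "h \<circ> fst \<in> ring_hom ?C B" by (rule ring_hom_memI) auto
    then interpret g: ring_hom_cring ?C B "h \<circ> fst"
      using C.is_cring h.S.is_cring by (simp add: ring_hom_cring_def ring_hom_cring_axioms_def)
    show "\<exists>e. loc_gen_bound ?C p e"
    proof (rule g.loc_gen_bound_of_regular_image[OF C.noetherian_ring_axioms _ p _ B(4)])
      have "fst ` carrier ?C = carrier A" using M.M.zero_closed by (force simp: image_iff)
      then show "(h \<circ> fst) ` carrier ?C = carrier B" unfolding image_comp[symmetric] using B(2) by simp
      have "z \<in> p \<longleftrightarrow> z \<in> carrier ?C \<and> h (fst z) = \<zero>\<^bsub>B\<^esub>" for z
      proof (cases z)
        case (Pair a x)
        have "z \<in> carrier ?C" if "z \<in> p" using that C.ideal_subset[OF C.prime_ideal[OF p]] by blast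
        then show ?thesis using mem[OF p, of a x] B(3) unfolding Pair p0_def by auto
      qed
      then show "p = {x \<in> carrier ?C. (h \<circ> fst) x = \<zero>\<^bsub>B\<^esub>}" by auto
      fix P Q assume P: "primeideal P ?C" and Q: "primeideal Q ?C" and PQ: "p \<subset> P" "P \<subseteq> Q"
      have lt: "?v P \<subset> ?v P'" if P': "primeideal P ?C" "primeideal P' ?C" "P \<subset> P'" for P P'
      proof -
        obtain z where z: "z \<in> P'" "z \<notin> P" using P'(3) by blast
        have "z \<in> carrier ?C" using z(1) C.ideal_subset[OF C.prime_ideal[OF P'(2)]] by blast
        then obtain a x where "z = (a, x)" "a \<in> carrier A" "x \<in> carrier M" by auto
        then have "a \<in> ?v P'" "a \<notin> ?v P" using z mem P' by blast+
        then show ?thesis using P'(3) by blast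
      qed
      show "P = Q"
      proof (rule ccontr)
        assume "P \<noteq> Q"
        then have "P \<subset> Q" using PQ(2) by blast
        then show False
          using no_long_chain_above[OF M.R.is_cring K dim p0 pv[OF P] pv[OF Q] Kp]
            lt[OF p P PQ(1)] lt[OF P Q] unfolding p0_def by blast
      qed
    qed
  qed
  then obtain s where s: "s \<ge> 1" "artin_rees ?C ?N ?M s" by blast
  have "ideal_smult A M (I [^]\<^bsub>ideals_set A\<^esub> n) (carrier M) \<inter> N =
      ideal_smult A M (I [^]\<^bsub>ideals_set A\<^esub> (n - s)) (ideal_smult A M (I [^]\<^bsub>ideals_set A\<^esub> s) (carrier M) \<inter> N)"
    if n: "s \<le> n" and I: "ideal I A" for n I
  proof -
    let ?J = "I \<times> carrier M"
    let ?H = "ideal_smult A M (I [^]\<^bsub>ideals_set A\<^esub> s) (carrier M) \<inter> N"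
    have pow: "pow_prod ?C ?J k ?M \<inter> ?N = {\<zero>\<^bsub>A\<^esub>} \<times> (ideal_smult A M (I [^]\<^bsub>ideals_set A\<^esub> k) (carrier M) \<inter> N)" for k
      unfolding M.pow_prod_submodule[OF I M.carrier_is_submodule] by auto
    have "submodule (ideal_smult A M (I [^]\<^bsub>ideals_set A\<^esub> s) (carrier M)) A M"
      using M.R.ideal_subset[OF M.ideals_pow_ideal[OF I]] by (intro M.ideal_smult_submodule) auto
    then have "submodule ?H A M"
      using M.submoduleE M.submodule_zero assms(3) by (intro M.submoduleI) (auto dest: M.submoduleE)
    then have "{\<zero>\<^bsub>A\<^esub>} \<times> (ideal_smult A M (I [^]\<^bsub>ideals_set A\<^esub> n) (carrier M) \<inter> N)
      = {\<zero>\<^bsub>A\<^esub>} \<times> ideal_smult A M (I [^]\<^bsub>ideals_set A\<^esub> (n - s)) ?H"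
      using s(2)[unfolded artin_rees_def, rule_format, OF M.ideal_times_ideal[OF I] n]
      unfolding pow M.pow_prod_submodule[OF I \<open>submodule ?H A M\<close>] by simp
    then show ?thesis by blast
  qed
  then show ?thesis using s(1) by blast
qed

end
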